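(* Let $1\le j\le k\le n$. For every $u\in\mathrm{Conv}_{sc}(\mathbb R^n)$, $$\operatorname{supp}\mathrm{MA}^*(u[k],\mathbf I_{B^n}[n-k];\cdot)\subseteq\operatorname{supp}\mathrm{MA}^*(u[j],\mathbf I_{B^n}[n-j];\cdot).$$
   Context: $\mathrm{Conv}_{sc}(\mathbb R^n)$ is the set of lower semicontinuous, proper, convex $u:\mathbb R^n\to(-\infty,\infty]$ with $u(x)/|x|\to\infty$ as $|x|\to\infty$; $u^*(x)=\sup_y(\langle x,y\rangle-u(y))$ is the Legendre–Fenchel conjugate (finite-valued convex for such $u$). $\mathrm{MA}(v;B)=V_n(\bigcup_{b\in B}\partial v(b))$ for convex $v:\mathbb R^n\to\mathbb R$; the mixed Monge–Ampère measure is the unique symmetric family with $\mathrm{MA}(\sum_i\lambda_iv_i;\cdot)=\sum\lambda_{i_1}\cdots\lambda_{i_n}\mathrm{MA}(v_{i_1},\dots,v_{i_n};\cdot)$ for $\lambda_i\ge0$; the conjugate mixed Monge–Ampère measure is $\mathrm{MA}^*(u_1,\dots,u_n;\cdot)=\mathrm{MA}(u_1^*,\dots,u_n^*;\cdot)$; $w[k]$ means $w$ repeated $k$ times. $\mathbf I_{B^n}$ is the convex indicator function of the unit ball ($0$ on $B^n$, $+\infty$ outside), so $\mathbf I_{B^n}^*(x)=|x|$. *)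

theory Defs
  imports "HOL-Analysis.Analysis"
begin

definition lsc_ereal :: "('a::euclidean_space \<Rightarrow> ereal) \<Rightarrow> bool" where
  "lsc_ereal u \<longleftrightarrow> (\<forall>x. u x \<le> Liminf (at x) u)"

definition proper_ereal :: "('a::euclidean_space \<Rightarrow> ereal) \<Rightarrow> bool" where
  "proper_ereal u \<longleftrightarrow> (\<exists>x. u x \<noteq> \<infinity>) \<and> (\<forall>x. u x \<noteq> -\<infinity>)"

definition convex_ereal :: "('a::euclidean_space \<Rightarrow> ereal) \<Rightarrow> bool" where
  "convex_ereal u \<longleftrightarrow> (\<forall>x y t. 0 \<le> t \<and> t \<le> 1 \<longrightarrow>
      u ((1 - t) *\<^sub>R x + t *\<^sub>R y) \<le> ereal (1 - t) * u x + ereal t * u y)"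

definition Conv_sc :: "('a::euclidean_space \<Rightarrow> ereal) set" where
  "Conv_sc = {u. lsc_ereal u \<and> proper_ereal u \<and> convex_ereal u \<and>
      ((\<lambda>x. u x / ereal (norm x)) \<longlongrightarrow> \<infinity>) at_infinity}"

text \<open>Legendre--Fenchel conjugate (finite-valued for u in Conv_sc).\<close>
definition conjugate :: "('a::euclidean_space \<Rightarrow> ereal) \<Rightarrow> 'a \<Rightarrow> real" where
  "conjugate u x = real_of_ereal (SUP y. ereal (inner x y) - u y)"

definition ind_ball :: "'a::euclidean_space \<Rightarrow> ereal" where
  "ind_ball x = (if x \<in> cball 0 1 then 0 else \<infinity>)"

definition subdiff :: "('a::euclidean_space \<Rightarrow> real) \<Rightarrow> 'a \<Rightarrow> 'a set" where
  "subdiff v b = {y. \<forall>z. v z \<ge> v b + inner y (z - b)}"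

definition MA :: "('a::euclidean_space \<Rightarrow> real) \<Rightarrow> 'a set \<Rightarrow> real" where
  "MA v B = measure lebesgue (\<Union>b\<in>B. subdiff v b)"

definition finite_convex :: "('a::euclidean_space \<Rightarrow> real) \<Rightarrow> bool" where
  "finite_convex v \<longleftrightarrow> convex_on UNIV v"

text \<open>A family F of mixed Monge--Ampere measures (arguments: lists of n = DIM('a)
  finite convex functions; evaluated on bounded Borel sets), characterised as the
  symmetric family satisfying the polynomial expansion of MA of nonnegative
  combinations.\<close>
definition is_mixed_MA_family ::
    "(('a::euclidean_space \<Rightarrow> real) list \<Rightarrow> 'a set \<Rightarrow> real) \<Rightarrow> bool" where
  "is_mixed_MA_family F \<longleftrightarrow>
     (\<forall>vs ws B. length vs = DIM('a) \<and> mset ws = mset vs \<longrightarrow> F ws B = F vs B) \<and>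
     (\<forall>(m::nat) (vs :: nat \<Rightarrow> 'a \<Rightarrow> real) (lam :: nat \<Rightarrow> real) B.
        (\<forall>i<m. finite_convex (vs i) \<and> lam i \<ge> 0) \<and> B \<in> sets borel \<and> bounded B \<longrightarrow>
        MA (\<lambda>x. \<Sum>i<m. lam i * vs i x) B =
        (\<Sum>is\<in>{is. length is = DIM('a) \<and> set is \<subseteq> {..<m}}.
            (\<Prod>i\<leftarrow>is. lam i) * F (map vs is) B))"

definition mixed_MA :: "('a::euclidean_space \<Rightarrow> real) list \<Rightarrow> 'a set \<Rightarrow> real" where
  "mixed_MA vs B = (THE r. \<exists>F. is_mixed_MA_family F \<and> F vs B = r)"

definition conj_mixed_MA :: "('a::euclidean_space \<Rightarrow> ereal) list \<Rightarrow> 'a set \<Rightarrow> real" where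
  "conj_mixed_MA us B = mixed_MA (map conjugate us) B"

definition supp_MA :: "('a::euclidean_space set \<Rightarrow> real) \<Rightarrow> 'a set" where
  "supp_MA \<mu> = {x. \<forall>e>0. \<mu> (ball x e) > 0}"

end

theory Submission
  imports Defs "HOL-Computational_Algebra.Polynomial"
begin

text \<open>
  For a convex function \<open>v\<close> on \<open>\<real>\<^sup>n\<close>, the mixed measures of \<open>v\<close> and \<open>|\<cdot>|\<close> on a set \<open>B\<close> are, up to positive
  factors, the coefficients of \<open>t \<mapsto> MA (v + t|\<cdot>|) B\<close>.  In the coordinates \<open>p = b + y\<close>, \<open>y \<in> \<partial>v(b)\<close>, of the graph
  of \<open>\<partial>v\<close>, the point \<open>b = prox p\<close> is \<open>1\<close>-Lipschitz, so by Rademacher's theorem and the area formula the coefficient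
  of \<open>t\<^sup>d\<close> is the integral of that of \<open>det (I - M + t H M)\<close>, where \<open>M\<close> is the symmetric derivative of \<open>prox\<close> and
  \<open>H\<close> the Hessian of the norm at \<open>b\<close>.  If the coefficient of \<open>t\<^bsup>n-k\<^esup>\<close> is positive at some \<open>p\<close>, then the set where
  \<open>v\<close> touches its supporting affine function of slope \<open>y\<close> at \<open>b\<close> lies in \<open>b + V\<close> with \<open>dim V = n - k\<close> and
  \<open>b \<notin> V\<close>.  Hence for \<open>1 \<le> j \<le> k\<close> some \<open>j\<close>-dimensional linear subspace \<open>E\<close> through \<open>b\<close> meets the touching set only in
  \<open>b\<close>.  Replacing the norm near \<open>b\<close> by a function with smaller Hessian that is linear on the subspaces near \<open>E\<close>
  of a foliation, the measure of the subgradient image grows at least like \<open>t\<^bsup>n-j\<^esup>\<close>, while it would be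
  \<open>O(t\<^bsup>n-j-1\<^esup>)\<close> if the coefficient of \<open>t\<^bsup>n-j\<^esup>\<close> vanished almost everywhere.  The kink of the norm at the origin is
  treated in the same way, with \<open>v\<close> replaced by its directional derivative and the norm by \<open>|\<cdot>|\<^sup>2/2\<close>.
\<close>

section \<open>Lipschitz functions are differentiable almost everywhere\<close>

text \<open>The growth of \<open>MA (v + t|.|)\<close> cannot decide a single coefficient: the
  Hessian of the norm has rank \<open>n - 1\<close>, so higher powers of \<open>t\<close> can hide a
  vanishing coefficient of \<open>t^m\<close>, \<open>m = n - j\<close>. A comparison function whose
  Hessian has rank at most \<open>m\<close> cuts these powers off. It is used only near
  \<open>b\<close>, and its Hessian \<open>H'\<close> must be dominated by that of the norm,
  \<open>H\<close>, in the sense that \<open>0 < a . H' a\<close> implies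
  \<open>0 < a . H a\<close>; a vanishing principal minor of \<open>H\<close> then forces a
  vanishing one of \<open>H'\<close> in the same eigenbasis of the derivative of
  \<open>prox\<close>. Near \<open>b\<close> the choice is \<open>|P z|^2 / (2 <z, b/|b|>)\<close>,
  with \<open>P\<close> the orthogonal projection whose kernel is \<open>E\<close>: it is positively
  homogeneous, so its Hessian at \<open>z\<close> kills \<open>z\<close>, like that of the norm.
  Since \<open>b\<close> lies in \<open>E\<close>, necessarily \<open>m < n\<close>, which is where
  \<open>1 \<le> j\<close> enters. All coefficients are interpolated from the values at
  \<open>t = 1, ..., n + 1\<close>, so that they inherit their integral formulas from those of
  \<open>MA\<close> at positive \<open>t\<close>.\<close>

text \<open>A Vitali cover of \<open>E\<close> by short intervals inside \<open>T\<close> of slope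
  at most \<open>p\<close> has a disjoint subfamily covering \<open>E\<close> up to a null set. The
  images of these intervals have total length at most \<open>p\<close> times the measure of
  \<open>T\<close>, and the Lipschitz image of the uncovered null set is null.\<close>

lemma Vitali_slope_image:
  fixes f :: "real \<Rightarrow> real"
  assumes mono: "\<And>x y. x < y \<Longrightarrow> f x < f y"
    and Lip: "\<And>x y. \<bar>f x - f y\<bar> \<le> L * \<bar>x - y\<bar>"
    and slope: "\<And>x d. x \<in> E \<Longrightarrow> 0 < d \<Longrightarrow>
       \<exists>a b. a < b \<and> a \<le> x \<and> x \<le> b \<and> b - a < d \<and> f b - f a \<le> p * (b - a)"
    and T: "open T" "E \<subseteq> T" "T \<in> lmeasurable" and p: "p \<ge> 0"
  obtains T' where "T' \<in> lmeasurable" "f ` E \<subseteq> T'" "measure lebesgue T' \<le> p * measure lebesgue T"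
proof -
  define K where "K = {(a,b). a < b \<and> {a..b} \<subseteq> T \<and> f b - f a \<le> p * (b - a)}"
  define c r where "c = (\<lambda>(a,b). (a+b)/2::real)" and "r = (\<lambda>(a,b). (b-a)/2::real)"
  have cb: "cball (c i) (r i) = {fst i..snd i}" for i
    by (auto simp: c_def r_def cball_eq_atLeastAtMost split_beta field_simps)
  have monoL: "f x \<le> f y" if "x \<le> y" for x y using mono[of x y] that by (cases "x = y") auto
  have contf: "continuous_on A f" for A
  proof -
    have "L-lipschitz_on A f" if "L \<ge> 0" using Lip that by (auto simp: lipschitz_on_def dist_real_def)
    moreover have "L \<ge> 0" using Lip[of 0 1] by auto
    ultimately show ?thesis using lipschitz_on_continuous_on by blast
  qed
  have im: "f ` {a..b} = {f a..f b}" if le: "a \<le> b" for a b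
  proof
    show "f ` {a..b} \<subseteq> {f a..f b}" using monoL by auto
    show "{f a..f b} \<subseteq> f ` {a..b}"
    proof
      fix y assume "y \<in> {f a..f b}"
      then obtain x where "a \<le> x" "x \<le> b" "f x = y"
        using IVT'[of f a y b, OF _ _ le contf] by auto
      then show "y \<in> f ` {a..b}" by auto
    qed
  qed
  obtain C where C: "countable C" "C \<subseteq> K"
     "pairwise (\<lambda>i j. disjnt (cball (c i) (r i)) (cball (c j) (r j))) C"
     "negligible(E - (\<Union>i \<in> C. cball (c i) (r i)))"
  proof (rule Vitali_covering_theorem_cballs[of K r E c])
    show "0 < r i" if "i \<in> K" for i using that by (auto simp: K_def r_def)
    fix x d :: real assume x: "x \<in> E" "0 < d"
    obtain e where e: "e > 0" "ball x e \<subseteq> T" using T x by (meson openE subsetD)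
    obtain a b where ab: "a < b" "a \<le> x" "x \<le> b" "b - a < min d e" "f b - f a \<le> p * (b - a)"
      using slope[OF x(1), of "min d e"] x e by auto
    have "{a..b} \<subseteq> ball x e" using ab by (auto simp: dist_real_def)
    then have "(a,b) \<in> K" using ab e by (auto simp: K_def)
    moreover have "x \<in> cball (c (a,b)) (r (a,b))" using ab by (simp add: cb)
    moreover have "r (a,b) < d" using ab x by (auto simp: r_def)
    ultimately show "\<exists>i. i \<in> K \<and> x \<in> cball (c i) (r i) \<and> r i < d" by blast
  qed
  have Kpos: "fst i < snd i" "{fst i..snd i} \<subseteq> T" "f (snd i) - f (fst i) \<le> p * (snd i - fst i)" if "i \<in> C" for i
  proof -
    have "case i of (a,b) \<Rightarrow> a < b \<and> {a..b} \<subseteq> T \<and> f b - f a \<le> p * (b - a)"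
      using that C(2) unfolding K_def by blast
    then show "fst i < snd i" "{fst i..snd i} \<subseteq> T" "f (snd i) - f (fst i) \<le> p * (snd i - fst i)"
      by (auto simp only: split_beta)
  qed
  have disj: "disjoint_family_on (\<lambda>i. {fst i..snd i}) C"
    using C(3) unfolding cb by (auto simp: disjoint_family_on_def pairwise_def disjnt_def)
  define W where "W = (\<Union>i\<in>C. {f (fst i)..f (snd i)})"
  define N where "N = f ` (E - (\<Union>i \<in> C. cball (c i) (r i)))"
  have negN: "negligible N" unfolding N_def
  proof (rule negligible_locally_Lipschitz_image)
    show "\<exists>T B. open T \<and> x \<in> T \<and> (\<forall>y\<in>(E - (\<Union>i\<in>C. cball (c i) (r i))) \<inter> T. norm (f y - f x) \<le> B * norm (y - x))" for x
      by (rule exI[of _ UNIV], rule exI[of _ L]) (use Lip in auto)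
  qed (use C in auto)
  have Wsets: "W \<in> sets lebesgue" unfolding W_def using C(1) by (intro sets.countable_UN') auto
  have "emeasure lebesgue W \<le> (\<integral>\<^sup>+i. emeasure lebesgue {f (fst i)..f (snd i)} \<partial>count_space C)"
    unfolding W_def
  proof (rule eq_refl, rule emeasure_UN_countable)
    show "disjoint_family_on (\<lambda>i. {f (fst i)..f (snd i)}) C"
    proof -
      have inj: "inj f" by (metis injI mono linorder_cases order_less_irrefl)
      have "f ` {fst i..snd i} \<inter> f ` {fst j..snd j} = {}" if "i \<in> C" "j \<in> C" "i \<noteq> j" for i j
        using disj that inj unfolding disjoint_family_on_def by (metis image_Int image_empty)
      then show ?thesis using Kpos by (auto simp: disjoint_family_on_def im less_imp_le)
    qed
  qed (use C in auto)
  also have "\<dots> \<le> (\<integral>\<^sup>+i. ennreal p * emeasure lebesgue {fst i..snd i} \<partial>count_space C)"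
  proof (rule nn_integral_mono)
    fix i assume "i \<in> space (count_space C)"
    then have i: "i \<in> C" by simp
    have "emeasure lebesgue {f (fst i)..f (snd i)} = ennreal (f (snd i) - f (fst i))"
      using mono[OF Kpos(1)[OF i]] by simp
    also have "\<dots> \<le> ennreal (p * (snd i - fst i))" using Kpos(3)[OF i] by (rule ennreal_leI)
    also have "\<dots> = ennreal p * emeasure lebesgue {fst i..snd i}"
      using Kpos(1)[OF i] p by (simp add: ennreal_mult')
    finally show "emeasure lebesgue {f (fst i)..f (snd i)} \<le> ennreal p * emeasure lebesgue {fst i..snd i}" .
  qed
  also have "\<dots> = ennreal p * (\<integral>\<^sup>+i. emeasure lebesgue {fst i..snd i} \<partial>count_space C)"
    by (rule nn_integral_cmult) simp
  also have "(\<integral>\<^sup>+i. emeasure lebesgue {fst i..snd i} \<partial>count_space C) = emeasure lebesgue (\<Union>i\<in>C. {fst i..snd i})"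
    by (rule emeasure_UN_countable[symmetric]) (use C disj in auto)
  also have "\<dots> \<le> emeasure lebesgue T"
    by (rule emeasure_mono) (use Kpos(2) T in \<open>blast intro: fmeasurableD\<close>)+
  finally have "emeasure lebesgue W \<le> ennreal p * emeasure lebesgue T" by (simp add: mult_left_mono)
  also have "\<dots> = ennreal (p * measure lebesgue T)"
    using T(3) p by (simp add: emeasure_eq_measure2 ennreal_mult'')
  finally have Wle: "emeasure lebesgue W \<le> ennreal (p * measure lebesgue T)" .
  then have Wm: "W \<in> lmeasurable" using Wsets by (auto simp: fmeasurable_def intro: le_less_trans)
  have WN: "W \<union> N \<in> lmeasurable" "measure lebesgue (W \<union> N) = measure lebesgue W"
    using Wm negN Wsets measure_Un_null_set[of W lebesgue N] negligible_iff_null_sets[of N]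
    by (auto simp: negligible_iff_measure intro: fmeasurable.Un)
  show ?thesis
  proof (rule that[OF WN(1)])
    have "f ` E \<subseteq> f ` (\<Union>i \<in> C. cball (c i) (r i)) \<union> N" unfolding N_def by auto
    also have "f ` (\<Union>i \<in> C. cball (c i) (r i)) \<subseteq> W"
      unfolding cb W_def image_UN
    proof (rule UN_mono[OF subset_refl])
      fix i assume "i \<in> C"
      from im[OF less_imp_le[OF Kpos(1)[OF this]]]
      show "f ` {fst i..snd i} \<subseteq> {f (fst i)..f (snd i)}" by simp
    qed
    finally show "f ` E \<subseteq> W \<union> N" by blast
    show "measure lebesgue (W \<union> N) \<le> p * measure lebesgue T"
      using Wle Wm WN(2) p by (simp add: emeasure_eq_measure2)
  qed
qed

lemma lmeasurable_outer_open:
  assumes S: "S \<in> lmeasurable" and e: "0 < (e::real)"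
  obtains T where "open T" "S \<subseteq> T" "T \<in> lmeasurable" "measure lebesgue T < measure lebesgue S + e"
proof -
  obtain T where T: "open T" "S \<subseteq> T" "T - S \<in> lmeasurable" "emeasure lebesgue (T - S) < ennreal e"
    using sets_lebesgue_outer_open[OF fmeasurableD[OF S] e] by blast
  have eq: "T = S \<union> (T - S)" using T by blast
  have "T \<in> lmeasurable" by (subst eq) (intro fmeasurable.Un S T)
  moreover have "measure lebesgue (T - S) < e"
    using T(3,4) e by (simp add: emeasure_eq_measure2 ennreal_less_iff)
  moreover have "measure lebesgue T \<le> measure lebesgue S + measure lebesgue (T - S)"
    by (subst eq) (intro measure_Un_le fmeasurableD S T)
  ultimately show ?thesis using that T by fastforce
qed

text \<open>Short intervals of slope at most \<open>p\<close> contract outer measure by the factor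
  \<open>p\<close>; seen through the inverse function, those of slope at least \<open>q\<close>
  contract it by \<open>1 / q\<close>. Going there and back gives \<open>m \<le> (p / q) * m\<close>
  for the outer measure \<open>m\<close> of \<open>E\<close>. The hypothesis \<open>grow\<close>
  makes the inverse exist and be Lipschitz.\<close>

lemma negligible_oscillating_slopes:
  fixes f :: "real \<Rightarrow> real"
  assumes grow: "\<And>x y. x < y \<Longrightarrow> y - x \<le> f y - f x"
    and Lip: "\<And>x y. \<bar>f x - f y\<bar> \<le> L * \<bar>x - y\<bar>"
    and lo: "\<And>x d. x \<in> E \<Longrightarrow> 0 < d \<Longrightarrow>
       \<exists>a b. a < b \<and> a \<le> x \<and> x \<le> b \<and> b - a < d \<and> f b - f a \<le> p * (b - a)"
    and hi: "\<And>x d. x \<in> E \<Longrightarrow> 0 < d \<Longrightarrow>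
       \<exists>a b. a < b \<and> a \<le> x \<and> x \<le> b \<and> b - a < d \<and> f b - f a \<ge> q * (b - a)"
    and pq: "0 < p" "p < q" and bd: "bounded E"
  shows "negligible E"
proof -
  have mono: "f x < f y" if "x < y" for x y using grow[OF that] that by linarith
  have L1: "L \<ge> 1" using grow[of 0 1] Lip[of 1 0] by auto
  have inj: "inj f" by (metis injI mono linorder_cases order_less_irrefl)
  have contf: "continuous_on A f" for A
  proof -
    have "L-lipschitz_on A f" using Lip L1 by (auto simp: lipschitz_on_def dist_real_def)
    then show ?thesis using lipschitz_on_continuous_on by blast
  qed
  have surj: "surj f"
  proof -
    have "\<exists>x. f x = y" for y
    proof -
      define R where "R = \<bar>y - f 0\<bar> + 1"
      have "f (-R) \<le> y" "y \<le> f R" using grow[of "-R" 0] grow[of 0 R] unfolding R_def by linarith+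
      then show ?thesis using IVT'[of f "-R" y R] contf by (auto simp: R_def)
    qed
    then show ?thesis by (metis surjI)
  qed
  define g where "g = inv f"
  have gf: "g (f x) = x" and fg: "f (g x) = x" for x using inj surj by (auto simp: g_def surj_f_inv_f)
  have gmono: "g x < g y" if "x < y" for x y
    using that by (metis fg mono linorder_cases order_less_asym order_less_irrefl)
  have gLip: "\<bar>g x - g y\<bar> \<le> 1 * \<bar>x - y\<bar>" for x y
    using grow[of "g x" "g y"] grow[of "g y" "g x"] by (cases "g x" "g y" rule: linorder_cases) (auto simp: fg)
  have glo: "\<exists>a b. a < b \<and> a \<le> y \<and> y \<le> b \<and> b - a < d \<and> g b - g a \<le> (1/q) * (b - a)"
    if y: "y \<in> f ` E" and d: "0 < d" for y d
  proof -
    obtain x where x: "x \<in> E" "y = f x" using y by auto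
    obtain a b where ab: "a < b" "a \<le> x" "x \<le> b" "b - a < d/L" "f b - f a \<ge> q * (b - a)"
      using hi[OF x(1), of "d/L"] d L1 by auto
    have "f a \<le> f x" "f x \<le> f b" using ab mono by (metis order_le_less)+
    moreover have "f b - f a < d"
    proof -
      have "f b - f a \<le> L * (b - a)" using Lip[of b a] ab by auto
      also have "\<dots> < d" using ab L1 by (simp add: field_simps)
      finally show ?thesis .
    qed
    moreover have "g (f b) - g (f a) \<le> (1/q) * (f b - f a)"
      using ab pq by (simp add: gf field_simps)
    ultimately show ?thesis using x mono[OF ab(1)] by blast
  qed
  \<comment> \<open>Its infimum is the outer measure of \<open>E\<close>, finite because
    \<open>E\<close> is bounded.\<close>
  define \<M> where "\<M> = {measure lebesgue T | T. T \<in> lmeasurable \<and> E \<subseteq> T}"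
  define m where "m = Inf \<M>"
  obtain B where "\<forall>x\<in>E. norm x \<le> B" using bd unfolding bounded_iff by blast
  then have B: "E \<subseteq> cball 0 B" by auto
  have ne: "\<M> \<noteq> {}" unfolding \<M>_def using B by (force intro: exI[of _ "cball 0 B"])
  have bb: "bdd_below \<M>" unfolding \<M>_def by (rule bdd_belowI[of _ 0]) auto
  have mle: "m \<le> measure lebesgue T" if "T \<in> lmeasurable" "E \<subseteq> T" for T
    unfolding m_def by (rule cInf_lower[OF _ bb]) (use that in \<open>auto simp: \<M>_def\<close>)
  have m0: "m \<ge> 0" unfolding m_def by (rule cInf_greatest[OF ne]) (auto simp: \<M>_def)
  have key: "m \<le> (1/q) * (p * (m + e) + e)" if e: "e > 0" for e
  proof -
    have "Inf \<M> < m + e/2" unfolding m_def using e by simp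
    then obtain T where T: "T \<in> lmeasurable" "E \<subseteq> T" "measure lebesgue T < m + e/2"
      using cInf_lessD[OF ne] by (auto simp: \<M>_def)
    obtain O1 where O1: "open O1" "T \<subseteq> O1" "O1 \<in> lmeasurable" "measure lebesgue O1 < measure lebesgue T + e/2"
      using lmeasurable_outer_open[OF T(1), of "e/2"] e by auto
    obtain T2 where T2: "T2 \<in> lmeasurable" "f ` E \<subseteq> T2" "measure lebesgue T2 \<le> p * measure lebesgue O1"
      using Vitali_slope_image[OF mono Lip lo O1(1) subset_trans[OF T(2) O1(2)] O1(3) less_imp_le[OF pq(1)]] by blast
    obtain O2 where O2: "open O2" "T2 \<subseteq> O2" "O2 \<in> lmeasurable" "measure lebesgue O2 < measure lebesgue T2 + e"
      using lmeasurable_outer_open[OF T2(1), of e] e by auto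
    have EO: "f ` E \<subseteq> O2" using T2 O2 by blast
    have q0: "1/q \<ge> 0" using pq by simp
    obtain T3 where T3: "T3 \<in> lmeasurable" "g ` f ` E \<subseteq> T3" "measure lebesgue T3 \<le> (1/q) * measure lebesgue O2"
      using Vitali_slope_image[OF gmono gLip glo O2(1) EO O2(3) q0] by blast
    have "m \<le> measure lebesgue T3" using T3 by (intro mle) (auto simp: gf image_image)
    also have "\<dots> \<le> (1/q) * measure lebesgue O2" by fact
    also have "\<dots> \<le> (1/q) * (p * (m + e) + e)"
    proof (rule mult_left_mono)
      have "measure lebesgue T2 \<le> p * (m + e)"
        using T2(3) O1(4) T(3) pq mult_left_mono[of "measure lebesgue O1" "m+e" p] by linarith
      then show "measure lebesgue O2 \<le> p * (m + e) + e" using O2 by linarith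
    qed (use pq in auto)
    finally show ?thesis .
  qed
  have "m = 0"
  proof (rule ccontr)
    assume "m \<noteq> 0"
    then have mp: "m > 0" using m0 by simp
    \<comment> \<open>Chosen so that \<open>(p + 1) * e\<close> is half of the gap
      \<open>(q - p) * m\<close>.\<close>
    define e where "e = (q - p) * m / (2 * (p + 1))"
    have ep: "e > 0" using mp pq by (simp add: e_def)
    have "q * m \<le> p * (m + e) + e" using key[OF ep] pq by (simp add: field_simps)
    then have "(q - p) * m \<le> (p + 1) * e" by (simp add: algebra_simps)
    also have "\<dots> = (q-p)*m/2"
    proof -
      have "p + 1 \<noteq> 0" using pq by simp
      then show ?thesis unfolding e_def by (simp only: times_divide_eq_right mult.assoc[symmetric] mult.commute[of 2] mult_divide_mult_cancel_left divide_divide_eq_left[symmetric]) (simp add: divide_simps)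
    qed
    finally have "(q - p) * m \<le> (q - p) * m / 2" .
    moreover have "0 < (q - p) * m" using mp pq by simp
    ultimately show False by linarith
  qed
  show ?thesis unfolding negligible_outer
  proof (intro allI impI)
    fix e :: real assume "e > 0"
    then have "Inf \<M> < e" using \<open>m = 0\<close> by (simp add: m_def)
    then show "\<exists>T. E \<subseteq> T \<and> T \<in> lmeasurable \<and> measure lebesgue T < e"
      using cInf_lessD[OF ne] by (auto simp: \<M>_def)
  qed
qed

text \<open>Adding a large multiple of the identity makes a Lipschitz function increasing; bounded difference
  quotients without a limit oscillate between two rational slopes.\<close>
lemma Lipschitz_real_differentiable_AE:
  fixes f :: "real \<Rightarrow> real"
  assumes Lip: "\<And>x y. \<bar>f x - f y\<bar> \<le> L * \<bar>x - y\<bar>"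
  shows "negligible {x. \<not> (\<exists>l. ((\<lambda>h. (f (x + h) - f x) / h) \<longlongrightarrow> l) (at 0))}"
proof -
  have L0: "L \<ge> 0" using Lip[of 0 1] by auto
  define F where "F = (\<lambda>x. f x + (L + 1) * x)"
  have grow: "y - x \<le> F y - F x" if "x < y" for x y
  proof -
    have "\<bar>f x - f y\<bar> \<le> L * (y - x)" using Lip[of x y] that by simp
    then show ?thesis unfolding F_def by (simp add: algebra_simps abs_le_iff)
  qed
  have FLip: "\<bar>F x - F y\<bar> \<le> (2*L+1) * \<bar>x - y\<bar>" for x y
  proof -
    have "\<bar>F x - F y\<bar> \<le> \<bar>f x - f y\<bar> + \<bar>(L+1) * (x - y)\<bar>" unfolding F_def by (simp add: algebra_simps)
    also have "\<dots> \<le> L * \<bar>x - y\<bar> + (L+1) * \<bar>x - y\<bar>" using Lip[of x y] L0 by (simp add: abs_mult)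
    finally show ?thesis by (simp add: algebra_simps)
  qed
  define Q where "Q = (\<lambda>x h. (F (x + h) - F x) / h)"
  define E where "E = (\<lambda>p q R. {x. \<bar>x\<bar> \<le> R \<and> (\<forall>d>0. \<exists>h. h \<noteq> 0 \<and> \<bar>h\<bar> < d \<and> Q x h \<le> p) \<and> (\<forall>d>0. \<exists>h. h \<noteq> 0 \<and> \<bar>h\<bar> < d \<and> Q x h \<ge> q)})"
  have int: "\<exists>a b. a < b \<and> a \<le> x \<and> x \<le> b \<and> b - a = \<bar>h\<bar> \<and> F b - F a = Q x h * (b - a)" if "h \<noteq> 0" for x h
  proof (cases "h > 0")
    case True then show ?thesis by (intro exI[of _ x] exI[of _ "x+h"]) (auto simp: Q_def)
  next
    case False then show ?thesis using that by (intro exI[of _ "x+h"] exI[of _ x]) (auto simp: Q_def field_simps)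
  qed
  have negE: "negligible (E p q R)" if "0 < p" "p < q" for p q R
  proof (rule negligible_oscillating_slopes[OF grow FLip _ _ that])
    show "\<exists>a b. a < b \<and> a \<le> x \<and> x \<le> b \<and> b - a < d \<and> F b - F a \<le> p * (b - a)" if "x \<in> E p q R" "0 < d" for x d
    proof -
      obtain h where "h \<noteq> 0" "\<bar>h\<bar> < d" "Q x h \<le> p" using \<open>x \<in> E p q R\<close> \<open>0 < d\<close> unfolding E_def by blast
      then show ?thesis using int[of h x] by (metis abs_ge_zero mult_right_mono)
    qed
    show "\<exists>a b. a < b \<and> a \<le> x \<and> x \<le> b \<and> b - a < d \<and> F b - F a \<ge> q * (b - a)" if "x \<in> E p q R" "0 < d" for x d
    proof -
      obtain h where "h \<noteq> 0" "\<bar>h\<bar> < d" "Q x h \<ge> q" using \<open>x \<in> E p q R\<close> \<open>0 < d\<close> unfolding E_def by blast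
      then show ?thesis using int[of h x] by (metis abs_ge_zero mult_right_mono)
    qed
    show "bounded (E p q R)" by (rule boundedI[of _ R]) (auto simp: E_def)
  qed
  \<comment> \<open>Rational slopes and integer radii leave only countably many exceptional
    sets.\<close>
  define I where "I = {(p,q). p \<in> \<rat> \<and> q \<in> \<rat> \<and> 0 < p \<and> p < (q::real)} \<times> (UNIV::nat set)"
  have cI: "countable I"
  proof -
    have "I \<subseteq> (\<rat> \<times> \<rat>) \<times> UNIV" by (auto simp: I_def)
    then show ?thesis using countable_rat by (meson countable_SIGMA countableI_type countable_subset)
  qed
  have "negligible (\<Union>i\<in>I. E (fst (fst i)) (snd (fst i)) (real (snd i)))"
    using cI by (intro negligible_countable_Union) (auto simp: I_def negE)
  moreover have "{x. \<not> (\<exists>l. ((\<lambda>h. (f (x + h) - f x) / h) \<longlongrightarrow> l) (at 0))} \<subseteq> (\<Union>i\<in>I. E (fst (fst i)) (snd (fst i)) (real (snd i)))"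
  proof
    fix x assume "x \<in> {x. \<not> (\<exists>l. ((\<lambda>h. (f (x + h) - f x) / h) \<longlongrightarrow> l) (at 0))}"
    then have nol: "\<not> ((\<lambda>h. (f (x + h) - f x) / h) \<longlongrightarrow> l) (at 0)" for l by auto
    have nolQ: "\<not> (Q x \<longlongrightarrow> l) (at 0)" for l
    proof
      assume "(Q x \<longlongrightarrow> l) (at 0)"
      then have "((\<lambda>h. Q x h - (L+1)) \<longlongrightarrow> l - (L+1)) (at 0)" by (intro tendsto_intros)
      then have "((\<lambda>h. (f (x + h) - f x) / h) \<longlongrightarrow> l - (L+1)) (at 0)"
      proof (rule tendsto_cong[THEN iffD1, rotated])
        show "\<forall>\<^sub>F h in at 0. Q x h - (L+1) = (f (x + h) - f x) / h"
          unfolding eventually_at_filter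
          by (rule always_eventually) (simp add: Q_def F_def divide_simps, simp add: algebra_simps)
      qed
      then show False using nol by blast
    qed
    have Qb: "1 \<le> Q x h \<and> Q x h \<le> 2*L+1" if "h \<noteq> 0" for h
    proof -
      obtain a b where ab: "a < b" "F b - F a = Q x h * (b - a)" using int[OF \<open>h \<noteq> 0\<close>] by blast
      have "1 * (b - a) \<le> Q x h * (b - a)" using grow[OF ab(1)] ab by simp
      moreover have "Q x h * (b - a) \<le> (2*L+1) * (b - a)"
        using FLip[of b a] ab abs_le_D1[of "F b - F a"] by simp
      ultimately show ?thesis using ab by (simp only: mult_le_cancel_right)
    qed
    define lo hi where "lo = Liminf (at 0) (\<lambda>h. ereal (Q x h))" and "hi = Limsup (at 0) (\<lambda>h. ereal (Q x h))"
    have lo1: "1 \<le> lo" unfolding lo_def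
      by (rule Liminf_bounded) (use Qb in \<open>auto simp: eventually_at_filter one_ereal_def\<close>)
    have hi1: "hi \<le> ereal (2*L+1)" unfolding hi_def
      by (rule Limsup_bounded) (use Qb in \<open>auto simp: eventually_at_filter\<close>)
    have lohi: "lo \<le> hi" unfolding lo_def hi_def by (rule Liminf_le_Limsup) simp
    have "lo \<noteq> hi"
    proof
      assume eq: "lo = hi"
      have "\<bar>lo\<bar> \<noteq> \<infinity>" using lo1 hi1 eq by auto
      then obtain l where l: "lo = ereal l" by (cases lo) auto
      have "((\<lambda>h. ereal (Q x h)) \<longlongrightarrow> ereal l) (at 0)"
        by (rule Liminf_eq_Limsup) (use eq l in \<open>auto simp: lo_def hi_def\<close>)
      then show False using nolQ by simp
    qed
    then have lh: "lo < hi" using lohi by simp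
    \<comment> \<open>The order \<open>lo < p0 < p < q < q0 < hi\<close> leaves room for rational
      \<open>p\<close> and \<open>q\<close>: if all quotients near 0 exceeded \<open>p\<close>, then
      \<open>lo\<close> would be at least \<open>p\<close>.\<close>
    obtain p0 where p0: "lo < ereal p0" "ereal p0 < hi" using ereal_dense2[OF lh] by auto
    obtain q0 where q0: "ereal p0 < ereal q0" "ereal q0 < hi" using ereal_dense2[OF p0(2)] by auto
    obtain p where p: "p \<in> \<rat>" "p0 < p" "p < q0" using Rats_dense_in_real q0 by auto
    obtain q where q: "q \<in> \<rat>" "p < q" "q < q0" using Rats_dense_in_real p by blast
    have pp: "0 < p"
    proof -
      have "ereal 1 < ereal p0" using lo1 p0(1) by (metis one_ereal_def order_le_less_trans)
      then show ?thesis using p by simp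
    qed
    obtain R where R: "\<bar>x\<bar> \<le> real R" using real_arch_simple by blast
    have "x \<in> E p q R" unfolding E_def
    proof (safe)
      show "\<bar>x\<bar> \<le> real R" by fact
      fix d :: real assume d: "d > 0"
      show "\<exists>h. h \<noteq> 0 \<and> \<bar>h\<bar> < d \<and> Q x h \<le> p"
      proof (rule ccontr)
        assume "\<not> ?thesis"
        then have "eventually (\<lambda>h. ereal p \<le> ereal (Q x h)) (at 0)"
          unfolding eventually_at using d by (intro exI[of _ d]) (auto simp: dist_real_def not_le less_imp_le)
        then have "ereal p \<le> lo" unfolding lo_def by (rule Liminf_bounded)
        then show False using p0 p by (meson ereal_less_eq(3) less_le_trans not_less order_less_imp_le)
      qed
      show "\<exists>h. h \<noteq> 0 \<and> \<bar>h\<bar> < d \<and> Q x h \<ge> q"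
      proof (rule ccontr)
        assume "\<not> ?thesis"
        then have "eventually (\<lambda>h. ereal (Q x h) \<le> ereal q) (at 0)"
          unfolding eventually_at using d by (intro exI[of _ d]) (auto simp: dist_real_def not_le less_imp_le)
        then have "hi \<le> ereal q" unfolding hi_def by (rule Limsup_bounded)
        then show False using q0 q by (meson ereal_less_eq(3) less_le_trans not_less order_less_imp_le)
      qed
    qed
    then show "x \<in> (\<Union>i\<in>I. E (fst (fst i)) (snd (fst i)) (real (snd i)))"
      using p q pp by (intro UN_I[of "((p,q),R)"]) (auto simp: I_def)
  qed
  ultimately show ?thesis by (rule negligible_subset)
qed

section \<open>Null sets along parallel lines, and functions with vanishing integrals over
  boxes\<close>

lemma emeasure_lborel_translate:
  fixes E :: "'a::euclidean_space set"
  assumes "E \<in> sets borel"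
  shows "(\<integral>\<^sup>+x. indicator E (x + c) \<partial>lborel) = emeasure lborel E"
proof -
  have "emeasure lborel E = (\<integral>\<^sup>+x. indicator E x \<partial>(distr lborel borel ((+) c)))"
    using assms by (simp add: lborel_distr_plus)
  also have "\<dots> = (\<integral>\<^sup>+x. indicator E (x + c) \<partial>lborel)"
    using assms by (subst nn_integral_distr) (auto simp: add.commute)
  finally show ?thesis by simp
qed

text \<open>Integrate the indicator of \<open>x + s \<theta> \<in> E\<close> over all
  \<open>x\<close> and over \<open>s\<close> in \<open>[0, 1]\<close>. Translation invariance makes
  the inner integral over \<open>x\<close> equal to the measure of \<open>E\<close> for every
  \<open>s\<close>, while the inner integral over \<open>s\<close> vanishes for every
  \<open>x\<close>. This avoids coordinates adapted to \<open>\<theta>\<close>.\<close>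

lemma negligible_if_negligible_on_lines:
  fixes E :: "'a::euclidean_space set"
  assumes E: "E \<in> sets borel" and lines: "\<And>x. negligible {s::real. x + s *\<^sub>R \<theta> \<in> E}"
  shows "negligible E"
proof -
  define F :: "'a \<Rightarrow> real \<Rightarrow> ennreal" where "F x s = indicator E (x + s *\<^sub>R \<theta>) * indicator {0..1} s" for x s
  have Fm: "case_prod F \<in> borel_measurable (lborel \<Otimes>\<^sub>M lborel)"
    unfolding F_def split_beta' using E by measurable
  have "emeasure lborel E = (\<integral>\<^sup>+s. emeasure lborel E * indicator {0..1::real} s \<partial>lborel)"
    by (subst nn_integral_cmult_indicator) auto
  also have "\<dots> = (\<integral>\<^sup>+s. \<integral>\<^sup>+x. F x s \<partial>lborel \<partial>lborel)"
    unfolding F_def using E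
    by (intro nn_integral_cong) (subst nn_integral_multc, auto simp: emeasure_lborel_translate)
  also have "\<dots> = (\<integral>\<^sup>+x. \<integral>\<^sup>+s. F x s \<partial>lborel \<partial>lborel)"
    by (rule lborel_pair.Fubini'[OF Fm])
  also have "\<dots> = (\<integral>\<^sup>+x. 0 \<partial>(lborel::'a measure))"
  proof (rule nn_integral_cong)
    fix x
    have S: "{s. x + s *\<^sub>R \<theta> \<in> E} \<in> sets borel" using E by measurable
    have "emeasure lborel {s. x + s *\<^sub>R \<theta> \<in> E} = 0"
      using lines[of x] S by (simp add: negligible_iff_null_sets null_sets_def)
    then have "AE s in lborel. s \<notin> {s. x + s *\<^sub>R \<theta> \<in> E}"
      using S by (intro AE_not_in) (auto simp: null_sets_def)
    then have "(\<integral>\<^sup>+s. F x s \<partial>lborel) = (\<integral>\<^sup>+s. 0 \<partial>(lborel::real measure))"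
      by (intro nn_integral_cong_AE) (auto simp: F_def)
    then show "(\<integral>\<^sup>+s. F x s \<partial>lborel) = 0" by simp
  qed
  finally show ?thesis using E by (simp add: negligible_iff_null_sets null_sets_def)
qed

text \<open>The density \<open>1 + g / K'\<close> is nonnegative and gives every box its volume.
  Uniqueness of Lebesgue measure and of densities leaves only \<open>g = 0\<close> almost
  everywhere.\<close>

lemma AE_zero_if_integral_boxes_zero:
  fixes g :: "'a::euclidean_space \<Rightarrow> real"
  assumes [measurable]: "g \<in> borel_measurable borel" and bd: "\<And>x. \<bar>g x\<bar> \<le> K"
    and zero: "\<And>l u. (\<integral>x. indicator (box l u) x * g x \<partial>lborel) = 0"
  shows "AE x in lborel. g x = 0"
proof -
  define K' where "K' = K + 1"
  have K': "K' > 0" using bd[of undefined] by (simp add: K'_def)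
  define F where "F x = 1 + g x / K'" for x
  have Fnn: "0 \<le> F x" for x using bd[of x] K' by (simp add: F_def K'_def field_simps abs_le_iff)
  have [measurable]: "F \<in> borel_measurable borel" unfolding F_def by measurable
  have "lborel = density lborel (\<lambda>x. ennreal (F x))"
  proof (rule lborel_eqI)
    fix l u :: 'a assume lu: "\<And>b. b \<in> Basis \<Longrightarrow> l \<bullet> b \<le> u \<bullet> b"
    have int1: "integrable lborel (indicat_real (box l u))"
      by (rule integrable_real_indicator) (simp_all add: emeasure_lborel_box_finite[unfolded infinity_ennreal_def])
    have int2: "integrable lborel (\<lambda>x. indicator (box l u) x * g x)"
      by (rule Bochner_Integration.integrable_bound[OF integrable_mult_right[OF int1, of K]])
        (use bd in \<open>auto simp: abs_mult indicator_def intro!: order_trans[OF _ abs_ge_self]\<close>)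
    have "emeasure (density lborel (\<lambda>x. ennreal (F x))) (box l u) = (\<integral>\<^sup>+x. ennreal (indicator (box l u) x * F x) \<partial>lborel)"
      by (subst emeasure_density) (auto intro!: nn_integral_cong simp: indicator_def)
    also have "\<dots> = ennreal (\<integral>x. indicator (box l u) x * F x \<partial>lborel)"
    proof (rule nn_integral_eq_integral)
      have "(\<lambda>x. indicator (box l u) x * F x) = (\<lambda>x. indicator (box l u) x + (1/K') * (indicator (box l u) x * g x))"
        by (auto simp: F_def field_simps)
      then show "integrable lborel (\<lambda>x. indicator (box l u) x * F x)" using int1 int2 by simp
    qed (use Fnn in auto)
    also have "(\<integral>x. indicator (box l u) x * F x \<partial>lborel) = (\<integral>x. indicator (box l u) x + (1/K') * (indicator (box l u) x * g x) \<partial>lborel)"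
      by (rule Bochner_Integration.integral_cong) (auto simp: F_def field_simps)
    also have "\<dots> = measure lborel (box l u)"
      using int1 int2 zero by simp
    also have "ennreal \<dots> = (\<Prod>b\<in>Basis. (u - l) \<bullet> b)"
      using lu by (simp add: emeasure_eq_ennreal_measure[symmetric] emeasure_lborel_box_eq emeasure_lborel_box_finite less_imp_neq)
    finally show "emeasure (density lborel (\<lambda>x. ennreal (F x))) (box l u) = (\<Prod>b\<in>Basis. (u - l) \<bullet> b)" .
  qed simp
  then have "density lborel (\<lambda>x::'a. 1) = density lborel (\<lambda>x. ennreal (F x))"
    by (simp add: density_1)
  then have "AE x in lborel. 1 = ennreal (F x)"
    by (rule sigma_finite_measure.density_unique[OF sigma_finite_lborel, rotated -1]) auto
  then show ?thesis
  proof eventually_elim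
    case (elim x)
    then have "F x = 1" using Fnn[of x] by (metis ennreal_eq_1)
    then show ?case using K' by (simp add: F_def)
  qed
qed

section \<open>Directional derivatives and Rademacher's theorem\<close>

locale Lipschitz_real =
  fixes f :: "'a::euclidean_space \<Rightarrow> real" and L :: real
  assumes Lip: "\<And>x y. \<bar>f x - f y\<bar> \<le> L * norm (x - y)"
begin

lemma L_nonneg: "0 \<le> L"
proof -
  obtain b :: 'a where "b \<in> Basis" using nonempty_Basis by blast
  then show ?thesis using Lip[of b 0] by simp
qed

lemma cont: "continuous_on A f"
proof -
  have "L-lipschitz_on A f" using Lip L_nonneg by (auto simp: lipschitz_on_def dist_norm)
  then show ?thesis using lipschitz_on_continuous_on by blast
qed

lemma f_measurable [measurable]: "f \<in> borel_measurable borel"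
  by (rule borel_measurable_continuous_onI[OF cont])

definition dq :: "'a \<Rightarrow> real \<Rightarrow> 'a \<Rightarrow> real" where
  "dq \<theta> h x = (f (x + h *\<^sub>R \<theta>) - f x) / h"

definition good :: "'a \<Rightarrow> 'a \<Rightarrow> bool" where
  "good \<theta> x \<longleftrightarrow> (\<exists>l. ((\<lambda>h. dq \<theta> h x) \<longlongrightarrow> l) (at 0))"

lemma dq_bound: "\<bar>dq \<theta> h x\<bar> \<le> L * norm \<theta>"
proof (cases "h = 0")
  case False
  have "\<bar>f (x + h *\<^sub>R \<theta>) - f x\<bar> \<le> L * norm \<theta> * \<bar>h\<bar>" using Lip[of "x + h *\<^sub>R \<theta>" x] by (simp add: mult_ac)
  then show ?thesis using False by (simp add: dq_def abs_divide divide_le_eq)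
qed (simp add: dq_def L_nonneg)

text \<open>Existence of the limit becomes countably many conditions on rational increments, which
  makes the set of bad points Borel. Conversely, the Cauchy condition yields a limit along
  \<open>1 / (n + 1)\<close>, then along the rationals, and continuity of \<open>f\<close> extends
  it to all real increments.\<close>

lemma good_iff_rational_Cauchy:
  "good \<theta> x \<longleftrightarrow> (\<forall>k::nat. \<exists>m::nat. \<forall>r s::rat. r \<noteq> 0 \<and> s \<noteq> 0 \<and> \<bar>real_of_rat r\<bar> < 1/Suc m \<and> \<bar>real_of_rat s\<bar> < 1/Suc m \<longrightarrow>
     \<bar>dq \<theta> (of_rat r) x - dq \<theta> (of_rat s) x\<bar> \<le> 1/Suc k)" (is "_ \<longleftrightarrow> ?C")
proof
  assume "good \<theta> x"
  then obtain l where l: "((\<lambda>h. dq \<theta> h x) \<longlongrightarrow> l) (at 0)" by (auto simp: good_def)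
  show ?C
  proof
    fix k :: nat
    have "\<forall>\<^sub>F h in at 0. dist (dq \<theta> h x) l < (1/Suc k)/2"
      by (rule tendstoD[OF l]) simp
    then obtain d where d: "d > 0" "\<And>h. h \<noteq> 0 \<Longrightarrow> \<bar>h\<bar> < d \<Longrightarrow> \<bar>dq \<theta> h x - l\<bar> < (1/Suc k)/2"
      unfolding eventually_at by (auto simp: dist_real_def)
    obtain m where m: "1/Suc m < d" using nat_approx_posE[OF d(1)] by auto
    show "\<exists>m::nat. \<forall>r s::rat. r \<noteq> 0 \<and> s \<noteq> 0 \<and> \<bar>real_of_rat r\<bar> < 1/Suc m \<and> \<bar>real_of_rat s\<bar> < 1/Suc m \<longrightarrow>
     \<bar>dq \<theta> (of_rat r) x - dq \<theta> (of_rat s) x\<bar> \<le> 1/Suc k"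
    proof (intro exI[of _ m] allI impI, elim conjE)
      fix r s :: rat assume "r \<noteq> 0" "s \<noteq> 0" "\<bar>real_of_rat r\<bar> < 1/Suc m" "\<bar>real_of_rat s\<bar> < 1/Suc m"
      then have "\<bar>dq \<theta> (of_rat r) x - l\<bar> < (1/Suc k)/2" "\<bar>dq \<theta> (of_rat s) x - l\<bar> < (1/Suc k)/2"
        using d(2) m by auto
      then show "\<bar>dq \<theta> (of_rat r) x - dq \<theta> (of_rat s) x\<bar> \<le> 1/Suc k"
        unfolding abs_less_iff abs_le_iff by linarith
    qed
  qed
next
  assume C: ?C
  define s where "s n = dq \<theta> (1 / Suc n) x" for n
  have srat: "s n = dq \<theta> (of_rat (1 / of_nat (Suc n))) x" for n
    by (simp add: s_def of_rat_divide del: of_nat_Suc)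
  have near: "\<exists>m. (\<forall>n\<ge>m. \<forall>r. r \<noteq> 0 \<and> \<bar>real_of_rat r\<bar> < 1/Suc m \<longrightarrow> \<bar>dq \<theta> (of_rat r) x - s n\<bar> \<le> 1/Suc k)" for k
  proof -
    obtain m where m: "\<forall>r s::rat. r \<noteq> 0 \<and> s \<noteq> 0 \<and> \<bar>real_of_rat r\<bar> < 1/Suc m \<and> \<bar>real_of_rat s\<bar> < 1/Suc m \<longrightarrow>
     \<bar>dq \<theta> (of_rat r) x - dq \<theta> (of_rat s) x\<bar> \<le> 1/Suc k" using C by blast
    show ?thesis
    proof (intro exI[of _ "Suc m"] allI impI)
      fix n r assume n: "Suc m \<le> n" and r: "r \<noteq> 0 \<and> \<bar>real_of_rat r\<bar> < 1/Suc (Suc m)"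
      have "1 / real (Suc n) < 1/ real (Suc m)" using n by (intro divide_strict_left_mono) auto
      then have "\<bar>real_of_rat (1 / of_nat (Suc n))\<bar> < 1/Suc m" by (simp add: of_rat_divide del: of_nat_Suc)
      moreover have "1/real (Suc (Suc m)) < 1/Suc m" by (intro divide_strict_left_mono) auto
      ultimately show "\<bar>dq \<theta> (of_rat r) x - s n\<bar> \<le> 1/Suc k" unfolding srat using m r by (auto simp del: of_nat_Suc)
    qed
  qed
  have "Cauchy s"
  proof (rule CauchyI)
    fix e :: real assume "e > 0"
    then obtain k where k: "1/Suc k < e" using nat_approx_posE by blast
    obtain m where m: "\<forall>n\<ge>m. \<forall>r. r \<noteq> 0 \<and> \<bar>real_of_rat r\<bar> < 1/Suc m \<longrightarrow> \<bar>dq \<theta> (of_rat r) x - s n\<bar> \<le> 1/Suc k" using near by blast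
    have "\<bar>s i - s j\<bar> \<le> 1/Suc k" if "i \<ge> Suc m" "j \<ge> m" for i j
    proof -
      have "1 / real (Suc i) < 1/ real (Suc m)" using that by (intro divide_strict_left_mono) auto
      then have "\<bar>real_of_rat (1 / of_nat (Suc i))\<bar> < 1/Suc m" by (simp add: of_rat_divide del: of_nat_Suc)
      then show ?thesis unfolding srat[of i] using m that(2) by (auto simp del: of_nat_Suc)
    qed
    then show "\<exists>M. \<forall>i\<ge>M. \<forall>j\<ge>M. norm (s i - s j) < e"
      using k by (intro exI[of _ "Suc m"] allI impI) (metis Suc_leD order_le_less_trans real_norm_def)
  qed
  then obtain l where l: "s \<longlonglongrightarrow> l" using Cauchy_convergent_iff convergent_def by blast
  have "((\<lambda>h. dq \<theta> h x) \<longlongrightarrow> l) (at 0)"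
  proof (rule tendstoI)
    fix e :: real assume "e > 0"
    then obtain k where k: "1/Suc k < e" using nat_approx_posE by blast
    obtain m where m: "\<forall>n\<ge>m. \<forall>r. r \<noteq> 0 \<and> \<bar>real_of_rat r\<bar> < 1/Suc m \<longrightarrow> \<bar>dq \<theta> (of_rat r) x - s n\<bar> \<le> 1/Suc k" using near by blast
    have rat: "\<bar>dq \<theta> (of_rat r) x - l\<bar> \<le> 1/Suc k" if "r \<noteq> 0" "\<bar>real_of_rat r\<bar> < 1/Suc m" for r
    proof (rule tendsto_upperbound)
      show "(\<lambda>n. \<bar>dq \<theta> (of_rat r) x - s n\<bar>) \<longlonglongrightarrow> \<bar>dq \<theta> (of_rat r) x - l\<bar>" by (intro tendsto_intros l)
      show "\<forall>\<^sub>F n in sequentially. \<bar>dq \<theta> (of_rat r) x - s n\<bar> \<le> 1/Suc k"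
        using m that unfolding eventually_sequentially by blast
    qed simp
    have real: "\<bar>dq \<theta> h x - l\<bar> \<le> 1/Suc k" if h: "h \<noteq> 0" "\<bar>h\<bar> < 1/Suc m" for h
    proof (rule ccontr)
      assume "\<not> ?thesis"
      then have gt: "1/Suc k < \<bar>dq \<theta> h x - l\<bar>" by simp
      have "continuous_on {h. h \<noteq> 0} (\<lambda>h. f (x + h *\<^sub>R \<theta>))"
        by (rule continuous_on_compose2[OF cont[of UNIV]]) (auto intro!: continuous_intros)
      then have "continuous_on {h. h \<noteq> 0} (\<lambda>h. \<bar>dq \<theta> h x - l\<bar>)"
        unfolding dq_def by (intro continuous_on_rabs continuous_on_diff continuous_on_divide continuous_on_const continuous_on_id) auto
      moreover have "open {h::real. h \<noteq> 0}" by (intro open_Collect_neq continuous_intros)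
      ultimately have "isCont (\<lambda>h. \<bar>dq \<theta> h x - l\<bar>) h"
        using h by (simp add: continuous_on_eq_continuous_at)
      then have "\<forall>\<^sub>F h' in nhds h. 1/Suc k < \<bar>dq \<theta> h' x - l\<bar>"
        using gt order_tendstoD(1)[OF tendsto_at_iff_tendsto_nhds[THEN iffD1, OF isCont_def[THEN iffD1]]] by blast
      moreover have "\<forall>\<^sub>F h' in nhds h. h' \<in> {h'. h' \<noteq> 0 \<and> \<bar>h'\<bar> < 1/Suc m}"
        using h by (intro eventually_nhds_in_open) (auto intro!: open_Collect_conj open_Collect_neq open_Collect_less continuous_intros)
      ultimately have "\<forall>\<^sub>F h' in nhds h. 1/Suc k < \<bar>dq \<theta> h' x - l\<bar> \<and> h' \<noteq> 0 \<and> \<bar>h'\<bar> < 1/Suc m"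
        by eventually_elim auto
      then obtain d where d: "d > 0" "\<And>h'. \<bar>h' - h\<bar> < d \<Longrightarrow> 1/Suc k < \<bar>dq \<theta> h' x - l\<bar> \<and> h' \<noteq> 0 \<and> \<bar>h'\<bar> < 1/Suc m"
        unfolding eventually_nhds_metric by (auto simp: dist_real_def)
      obtain r where r: "h < of_rat r" "of_rat r < h + d" using of_rat_dense[of h "h+d"] d by auto
      then have "1/Suc k < \<bar>dq \<theta> (of_rat r) x - l\<bar> \<and> real_of_rat r \<noteq> 0 \<and> \<bar>real_of_rat r\<bar> < 1/Suc m"
        by (intro d(2)) auto
      then show False using rat[of r] by auto
    qed
    have "0 < 1/real (Suc m)" by simp
    then show "\<forall>\<^sub>F h in at 0. dist (dq \<theta> h x) l < e"
      unfolding eventually_at using real k by (intro exI[of _ "1/real (Suc m)"]) (force simp: dist_real_def simp del: of_nat_Suc)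
  qed
  then show "good \<theta> x" by (auto simp: good_def)
qed

lemma good_measurable: "{x. \<not> good \<theta> x} \<in> sets borel"
proof -
  have [measurable]: "(\<lambda>x. dq \<theta> h x) \<in> borel_measurable borel" for h
    unfolding dq_def by measurable
  show ?thesis unfolding good_iff_rational_Cauchy by measurable
qed

lemma negligible_not_good: "negligible {x. \<not> good \<theta> x}"
proof (rule negligible_if_negligible_on_lines[OF good_measurable])
  fix x
  define g where "g s = f (x + s *\<^sub>R \<theta>)" for s
  have "\<bar>g s - g t\<bar> \<le> (L * norm \<theta>) * \<bar>s - t\<bar>" for s t
    unfolding g_def using Lip[of "x + s *\<^sub>R \<theta>" "x + t *\<^sub>R \<theta>"]
    by (simp add: scaleR_diff_left[symmetric] mult_ac)
  from Lipschitz_real_differentiable_AE[OF this]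
  have "negligible {s. \<not> (\<exists>l. ((\<lambda>h. (g (s + h) - g s) / h) \<longlongrightarrow> l) (at 0))}" .
  then show "negligible {s. x + s *\<^sub>R \<theta> \<in> {x. \<not> good \<theta> x}}"
    by (simp add: good_def dq_def g_def scaleR_add_left add.assoc)
qed

lemma AE_good: "AE x in lborel. good \<theta> x"
  using negligible_not_good[of \<theta>] good_measurable[of \<theta>]
  by (intro AE_I[of _ _ "{x. \<not> good \<theta> x}"]) (auto simp: negligible_iff_null_sets null_sets_def)

text \<open>The limsup along \<open>1 / (n + 1)\<close> is a total Borel function that equals the
  directional derivative wherever that exists.\<close>

definition dd :: "'a \<Rightarrow> 'a \<Rightarrow> real" where
  "dd \<theta> x = real_of_ereal (limsup (\<lambda>n. ereal (dq \<theta> (1 / Suc n) x)))"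

lemma dd_measurable [measurable]: "dd \<theta> \<in> borel_measurable borel"
  unfolding dd_def dq_def by measurable

lemma dd_bound: "\<bar>dd \<theta> x\<bar> \<le> L * norm \<theta>"
proof -
  have "limsup (\<lambda>n. ereal (dq \<theta> (1 / Suc n) x)) \<le> ereal (L * norm \<theta>)"
    by (rule Limsup_bounded) (use dq_bound in \<open>auto simp: abs_le_iff intro!: always_eventually\<close>)
  moreover have "ereal (- (L * norm \<theta>)) \<le> liminf (\<lambda>n. ereal (dq \<theta> (1 / Suc n) x))"
    by (rule Liminf_bounded) (use dq_bound in \<open>auto simp: abs_le_iff minus_le_iff intro!: always_eventually\<close>)
  then have "ereal (- (L * norm \<theta>)) \<le> limsup (\<lambda>n. ereal (dq \<theta> (1 / Suc n) x))"
    by (rule order_trans) (rule Liminf_le_Limsup, simp)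
  ultimately show ?thesis unfolding dd_def
    by (cases "limsup (\<lambda>n. ereal (dq \<theta> (1 / Suc n) x))") (auto simp: abs_le_iff)
qed

lemma filterlim_inverse_Suc: "c \<noteq> 0 \<Longrightarrow> filterlim (\<lambda>n. c / real (Suc n)) (at 0) sequentially"
  unfolding filterlim_at using LIMSEQ_Suc[OF lim_const_over_n[of c]] by (auto simp del: of_nat_Suc)

lemma good_limit:
  assumes "good \<theta> x"
  shows "((\<lambda>h. dq \<theta> h x) \<longlongrightarrow> dd \<theta> x) (at 0)" "(\<lambda>n. dq \<theta> (1 / Suc n) x) \<longlonglongrightarrow> dd \<theta> x"
proof -
  obtain l where l: "((\<lambda>h. dq \<theta> h x) \<longlongrightarrow> l) (at 0)" using assms by (auto simp: good_def)
  have 1: "(\<lambda>n. dq \<theta> (1 / Suc n) x) \<longlonglongrightarrow> l"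
    using filterlim_compose[OF l filterlim_inverse_Suc[of 1]] by simp
  then have "limsup (\<lambda>n. ereal (dq \<theta> (1 / Suc n) x)) = ereal l"
    by (intro lim_imp_Limsup) auto
  then have "dd \<theta> x = l" by (simp add: dd_def)
  then show "((\<lambda>h. dq \<theta> h x) \<longlongrightarrow> dd \<theta> x) (at 0)" "(\<lambda>n. dq \<theta> (1 / Suc n) x) \<longlonglongrightarrow> dd \<theta> x"
    using l 1 by auto
qed

lemma dd_scale_AE: "AE x in lborel. dd (c *\<^sub>R \<theta>) x = c * dd \<theta> x"
  using AE_good[of \<theta>] AE_good[of "c *\<^sub>R \<theta>"]
proof eventually_elim
  case (elim x)
  show ?case
  proof (cases "c = 0")
    case True then show ?thesis by (simp add: dd_def dq_def Limsup_const)
  next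
    case False
    have "(\<lambda>n. c * dq \<theta> (c / Suc n) x) \<longlonglongrightarrow> c * dd \<theta> x"
      using filterlim_compose[OF good_limit(1)[OF elim(1)] filterlim_inverse_Suc[OF False]] by (intro tendsto_intros)
    moreover have "c * dq \<theta> (c / Suc n) x = dq (c *\<^sub>R \<theta>) (1 / Suc n) x" for n
      using False by (simp add: dq_def field_simps)
    ultimately show ?thesis using good_limit(2)[OF elim(2)] LIMSEQ_unique by (simp del: of_nat_Suc) blast
  qed
qed

lemma integrable_box_bounded:
  assumes [measurable]: "g \<in> borel_measurable borel" and "\<And>x. \<bar>g x\<bar> \<le> K" "bounded S" "S \<in> sets borel"
  shows "integrable lborel (\<lambda>x::'a. indicator S x * (g x :: real))"
proof -
  have "emeasure lborel S < \<infinity>" using assms by (intro emeasure_bounded_finite)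
  then have int1: "integrable lborel (indicat_real S)" using assms by simp
  show ?thesis
    by (rule Bochner_Integration.integrable_bound[OF integrable_mult_right[OF int1, of K]])
      (use assms in \<open>auto simp: abs_mult indicator_def intro!: order_trans[OF _ abs_ge_self]\<close>)
qed

text \<open>Additivity in the direction is first obtained after integration over a box. The quotient
  of \<open>\<theta> + \<eta>\<close> is that of \<open>\<theta>\<close> at a shifted point plus
  that of \<open>\<eta>\<close>; translation moves the shift, which tends to 0, from the quotient to
  the indicator of the box, and dominated convergence applies.\<close>

lemma integral_dd_additive:
  "(\<integral>x. indicator (box l u) x * dd (\<theta> + \<eta>) x \<partial>lborel) =
   (\<integral>x. indicator (box l u) x * dd \<theta> x \<partial>lborel) + (\<integral>x. indicator (box l u) x * dd \<eta> x \<partial>lborel)"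
proof -
  define q where "q \<theta> n x = dq \<theta> (1 / Suc n) x" for \<theta> n x
  have qm [measurable]: "q \<theta> n \<in> borel_measurable borel" for \<theta> n unfolding q_def dq_def by measurable
  have qb: "\<bar>q \<theta> n x\<bar> \<le> L * norm \<theta>" for \<theta> n x unfolding q_def by (rule dq_bound)
  define B where "B = box l u"
  have B: "B \<in> sets borel" "bounded B" by (auto simp: B_def)
  have conv: "(\<lambda>n. \<integral>x. indicator B x * q \<theta> n x \<partial>lborel) \<longlonglongrightarrow> (\<integral>x. indicator B x * dd \<theta> x \<partial>lborel)" for \<theta>
  proof (rule integral_dominated_convergence[where w = "\<lambda>x. indicator B x * (L * norm \<theta>)"])
    show "integrable lborel (\<lambda>x. indicator B x * (L * norm \<theta>))"
      using B by (intro integrable_box_bounded) auto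
    show "AE x in lborel. (\<lambda>n. indicator B x * q \<theta> n x) \<longlonglongrightarrow> indicator B x * dd \<theta> x"
      using AE_good[of \<theta>] by eventually_elim (auto simp: q_def intro!: tendsto_intros good_limit(2) simp del: of_nat_Suc)
  qed (use qb B in \<open>auto simp: abs_mult indicator_def\<close>)
  obtain R where R: "\<And>x. x \<in> B \<Longrightarrow> norm x \<le> R" using B(2) by (auto simp: bounded_iff)
  \<comment> \<open>A ball containing all the shifted boxes, for the dominating function.\<close>
  define C :: "'a set" where "C = cball 0 (R + norm \<eta>)"
  have conv2: "(\<lambda>n. \<integral>x. indicator B (x - \<eta> /\<^sub>R Suc n) * q \<theta> n x \<partial>lborel) \<longlonglongrightarrow> (\<integral>x. indicator B x * dd \<theta> x \<partial>lborel)"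
  proof (rule integral_dominated_convergence[where w = "\<lambda>x. indicator C x * (L * norm \<theta>)"])
    show "integrable lborel (\<lambda>x. indicator C x * (L * norm \<theta>))"
      by (intro integrable_box_bounded) (auto simp: C_def)
    \<comment> \<open>The shifted indicators converge off the boundary of the box, which is
      null.\<close>
    have "AE x in lborel. x \<notin> cbox l u - box l u"
      using negligible_frontier_interval[of l u]
      by (intro AE_not_in) (auto simp: negligible_iff_null_sets null_sets_def)
    then show "AE x in lborel. (\<lambda>n. indicator B (x - \<eta> /\<^sub>R Suc n) * q \<theta> n x) \<longlonglongrightarrow> indicator B x * dd \<theta> x"
      using AE_good[of \<theta>]
    proof eventually_elim
      case (elim x)
      have lim: "(\<lambda>n. x - \<eta> /\<^sub>R Suc n) \<longlonglongrightarrow> x"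
      proof -
        have "(\<lambda>n. x - inverse (real (Suc n)) *\<^sub>R \<eta>) \<longlonglongrightarrow> x - 0 *\<^sub>R \<eta>"
          by (intro tendsto_intros LIMSEQ_inverse_real_of_nat)
        then show ?thesis by simp
      qed
      have "\<forall>\<^sub>F n in sequentially. indicator B (x - \<eta> /\<^sub>R Suc n) = (indicator B x :: real)"
      proof (cases "x \<in> box l u")
        case True
        then have "\<forall>\<^sub>F n in sequentially. x - \<eta> /\<^sub>R Suc n \<in> box l u"
          using lim open_box topological_tendstoD by blast
        then show ?thesis by eventually_elim (use True in \<open>simp add: B_def\<close>)
      next
        case False
        then have "x \<in> - cbox l u" using elim by auto
        then have "\<forall>\<^sub>F n in sequentially. x - \<eta> /\<^sub>R Suc n \<in> - cbox l u"
          using lim closed_cbox topological_tendstoD open_Compl by blast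
        then show ?thesis by eventually_elim (use False box_subset_cbox in \<open>auto simp: B_def indicator_def\<close>)
      qed
      then have "(\<lambda>n. indicator B (x - \<eta> /\<^sub>R Suc n) :: real) \<longlonglongrightarrow> indicator B x"
        by (rule tendsto_eventually)
      then show ?case using good_limit(2)[OF elim(2)] by (auto simp: q_def intro!: tendsto_intros simp del: of_nat_Suc)
    qed
    fix n
    show "AE x in lborel. norm (indicator B (x - \<eta> /\<^sub>R Suc n) * q \<theta> n x) \<le> indicator C x * (L * norm \<theta>)"
    proof (rule AE_I2)
      fix x
      show "norm (indicator B (x - \<eta> /\<^sub>R Suc n) * q \<theta> n x) \<le> indicator C x * (L * norm \<theta>)"
      proof (cases "x - \<eta> /\<^sub>R Suc n \<in> B")
        case True
        have "norm x \<le> norm (x - \<eta> /\<^sub>R Suc n) + norm (\<eta> /\<^sub>R Suc n)" by (metis norm_triangle_sub add.commute)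
        also have "norm (\<eta> /\<^sub>R Suc n) \<le> norm \<eta>"
          by (simp add: divide_simps mult_le_cancel_left1)
        finally have "x \<in> C" using R[OF True] by (simp add: C_def)
        then show ?thesis using True qb[of \<theta> n x] by simp
      qed (use L_nonneg in \<open>auto simp: indicator_def\<close>)
    qed
  qed (use B in measurable)
  have shift: "(\<integral>x. indicator B x * q \<theta> n (x + \<eta> /\<^sub>R Suc n) \<partial>lborel) = (\<integral>x. indicator B (x - \<eta> /\<^sub>R Suc n) * q \<theta> n x \<partial>lborel)" for n
  proof -
    have m: "(\<lambda>x. indicator B (x - \<eta> /\<^sub>R Suc n) * q \<theta> n x) \<in> borel_measurable borel"
      using B by measurable
    have "(\<integral>x. indicator B (x - \<eta> /\<^sub>R Suc n) * q \<theta> n x \<partial>lborel) = (\<integral>x. indicator B (x - \<eta> /\<^sub>R Suc n) * q \<theta> n x \<partial>(distr lborel borel ((+) (\<eta> /\<^sub>R Suc n))))"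
      by (simp add: lborel_distr_plus)
    also have "\<dots> = (\<integral>x. indicator B x * q \<theta> n (x + \<eta> /\<^sub>R Suc n) \<partial>lborel)"
      by (subst integral_distr) (use m in \<open>auto simp: add.commute\<close>)
    finally show ?thesis by simp
  qed
  have split: "(\<integral>x. indicator B x * q (\<theta> + \<eta>) n x \<partial>lborel) =
    (\<integral>x. indicator B (x - \<eta> /\<^sub>R Suc n) * q \<theta> n x \<partial>lborel) + (\<integral>x. indicator B x * q \<eta> n x \<partial>lborel)" for n
  proof -
    have "q (\<theta> + \<eta>) n x = q \<theta> n (x + \<eta> /\<^sub>R Suc n) + q \<eta> n x" for x
    proof -
      have "x + (1 / real (Suc n)) *\<^sub>R (\<theta> + \<eta>) = x + \<eta> /\<^sub>R Suc n + (1 / real (Suc n)) *\<^sub>R \<theta>"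
        by (simp add: scaleR_add_right divide_inverse del: of_nat_Suc)
      then show ?thesis by (simp add: q_def dq_def diff_divide_distrib divide_inverse del: of_nat_Suc) (simp add: algebra_simps)
    qed
    then have "(\<integral>x. indicator B x * q (\<theta> + \<eta>) n x \<partial>lborel) = (\<integral>x. indicator B x * q \<theta> n (x + \<eta> /\<^sub>R Suc n) + indicator B x * q \<eta> n x \<partial>lborel)"
      by (simp add: distrib_left)
    also have "\<dots> = (\<integral>x. indicator B x * q \<theta> n (x + \<eta> /\<^sub>R Suc n) \<partial>lborel) + (\<integral>x. indicator B x * q \<eta> n x \<partial>lborel)"
      using B qb by (intro Bochner_Integration.integral_add integrable_box_bounded) auto
    finally show ?thesis by (simp only: shift)
  qed
  have "(\<lambda>n. \<integral>x. indicator B x * q (\<theta> + \<eta>) n x \<partial>lborel) \<longlonglongrightarrow> (\<integral>x. indicator B x * dd \<theta> x \<partial>lborel) + (\<integral>x. indicator B x * dd \<eta> x \<partial>lborel)"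
    unfolding split by (intro tendsto_add conv conv2)
  then show ?thesis using conv[of "\<theta> + \<eta>"] LIMSEQ_unique unfolding B_def by blast
qed

text \<open>For a fixed box the integral is linear in the direction, so the defect \<open>G\<close>
  integrates to zero over every box.\<close>

lemma dd_linear_AE: "AE x in lborel. dd \<theta> x = (\<Sum>b\<in>Basis. (\<theta> \<bullet> b) * dd b x)"
proof -
  define G where "G x = dd \<theta> x - (\<Sum>b\<in>Basis. (\<theta> \<bullet> b) * dd b x)" for x
  have "AE x in lborel. G x = 0"
  proof (rule AE_zero_if_integral_boxes_zero)
    show "G \<in> borel_measurable borel" unfolding G_def by measurable
    show "\<bar>G x\<bar> \<le> L * norm \<theta> + (\<Sum>b\<in>Basis. \<bar>\<theta> \<bullet> b\<bar> * L)" for x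
    proof -
      have "\<bar>\<Sum>b\<in>Basis. (\<theta> \<bullet> b) * dd b x\<bar> \<le> (\<Sum>b\<in>Basis. \<bar>(\<theta> \<bullet> b) * dd b x\<bar>)" by (rule sum_abs)
      also have "\<dots> \<le> (\<Sum>b\<in>Basis. \<bar>\<theta> \<bullet> b\<bar> * L)"
      proof (rule sum_mono)
        fix b :: 'a assume "b \<in> Basis"
        then have "\<bar>dd b x\<bar> \<le> L" using dd_bound[of b x] by simp
        then show "\<bar>(\<theta> \<bullet> b) * dd b x\<bar> \<le> \<bar>\<theta> \<bullet> b\<bar> * L"
          unfolding abs_mult by (rule mult_left_mono) simp
      qed
      finally show ?thesis using dd_bound[of \<theta> x] unfolding G_def by linarith
    qed
    fix l u :: 'a
    define I where "I \<theta> = (\<integral>x. indicator (box l u) x * dd \<theta> x \<partial>lborel)" for \<theta>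
    have int: "integrable lborel (\<lambda>x. indicator (box l u) x * dd \<theta> x)" for \<theta>
      by (rule integrable_box_bounded[OF dd_measurable dd_bound]) auto
    have lin: "linear I"
    proof (rule linearI)
      show "I (a + b) = I a + I b" for a b unfolding I_def by (rule integral_dd_additive)
      show "I (c *\<^sub>R a) = c *\<^sub>R I a" for c a
      proof -
        have "I (c *\<^sub>R a) = (\<integral>x. c * (indicator (box l u) x * dd a x) \<partial>lborel)" unfolding I_def
          by (rule integral_cong_AE) (use dd_scale_AE[of c a] in \<open>auto\<close>)
        then show ?thesis by (simp add: I_def)
      qed
    qed
    have "I \<theta> = I (\<Sum>b\<in>Basis. (\<theta> \<bullet> b) *\<^sub>R b)" by (simp add: euclidean_representation)
    also have "\<dots> = (\<Sum>b\<in>Basis. (\<theta> \<bullet> b) * I b)" by (simp add: linear_sum[OF lin] linear_cmul[OF lin])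
    finally have eq: "I \<theta> = (\<Sum>b\<in>Basis. (\<theta> \<bullet> b) * I b)" .
    have "(\<integral>x. indicator (box l u) x * G x \<partial>lborel) = 
      (\<integral>x. indicator (box l u) x * dd \<theta> x - (\<Sum>b\<in>Basis. (\<theta> \<bullet> b) * (indicator (box l u) x * dd b x)) \<partial>lborel)"
      by (rule Bochner_Integration.integral_cong) (auto simp: G_def algebra_simps sum_distrib_left)
    also have "\<dots> = I \<theta> - (\<Sum>b\<in>Basis. (\<theta> \<bullet> b) * I b)"
      unfolding I_def using int by (subst Bochner_Integration.integral_diff) (auto simp: Bochner_Integration.integral_sum)
    finally show "(\<integral>x. indicator (box l u) x * G x \<partial>lborel) = 0" using eq by simp
  qed
  then show ?thesis by (simp add: G_def)
qed

text \<open>Finitely many directions of the dense set approximate all unit vectors within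
  \<open>\<epsilon>\<close>. Along these the convergence is uniform, and the Lipschitz bound pays
  for the change of direction.\<close>

lemma differentiable_if_directionally:
  assumes dense: "\<And>S. open S \<Longrightarrow> S \<noteq> {} \<Longrightarrow> \<exists>d\<in>D. d \<in> S"
    and good: "\<And>\<theta>. \<theta> \<in> D \<Longrightarrow> good \<theta> x"
    and lin: "\<And>\<theta>. \<theta> \<in> D \<Longrightarrow> dd \<theta> x = (\<Sum>b\<in>Basis. (\<theta> \<bullet> b) * dd b x)"
  shows "f differentiable (at x)"
proof -
  define G where "G = (\<Sum>b\<in>Basis. dd b x *\<^sub>R b)"
  have G: "dd \<theta> x = G \<bullet> \<theta>" if "\<theta> \<in> D" for \<theta>
    unfolding lin[OF that] G_def inner_sum_left by (rule sum.cong) (simp_all add: inner_commute mult.commute)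
  have "(f has_derivative (\<lambda>y. G \<bullet> y)) (at x)"
    unfolding has_derivative_at_alt
  proof (intro conjI allI impI)
    show "bounded_linear ((\<bullet>) G)" by (rule bounded_linear_inner_right)
    fix e :: real assume e: "e > 0"
    \<comment> \<open>Three errors arise: \<open>\<epsilon> * h\<close> from the quotient,
      \<open>L\<close> times this from the Lipschitz bound and \<open>norm G\<close> times this from
      the linear part.\<close>
    define \<epsilon> where "\<epsilon> = e / (L + 1 + norm G)"
    have \<epsilon>: "\<epsilon> > 0" using e L_nonneg by (simp add: \<epsilon>_def add_nonneg_pos add_pos_nonneg)
    have "cball 0 1 \<subseteq> (\<Union>\<theta>\<in>D. ball \<theta> \<epsilon>)"
    proof
      fix z :: 'a
      obtain d where "d \<in> D" "d \<in> ball z \<epsilon>" using dense[of "ball z \<epsilon>"] \<epsilon> by auto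
      then show "z \<in> (\<Union>\<theta>\<in>D. ball \<theta> \<epsilon>)" by (auto simp: dist_commute)
    qed
    then obtain D0 where D0: "D0 \<subseteq> D" "finite D0" "cball 0 1 \<subseteq> (\<Union>\<theta>\<in>D0. ball \<theta> \<epsilon>)"
      using compactE_image[OF compact_cball, of D "\<lambda>\<theta>. ball \<theta> \<epsilon>"] by (metis open_ball)
    have "\<forall>\<theta>\<in>D0. \<exists>d>0. \<forall>h. h \<noteq> 0 \<and> \<bar>h\<bar> < d \<longrightarrow> \<bar>dq \<theta> h x - G \<bullet> \<theta>\<bar> < \<epsilon>"
    proof
      fix \<theta> assume "\<theta> \<in> D0"
      then have "((\<lambda>h. dq \<theta> h x) \<longlongrightarrow> G \<bullet> \<theta>) (at 0)" using good_limit(1)[OF good] G D0 by (metis subsetD)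
      from tendstoD[OF this \<epsilon>] show "\<exists>d>0. \<forall>h. h \<noteq> 0 \<and> \<bar>h\<bar> < d \<longrightarrow> \<bar>dq \<theta> h x - G \<bullet> \<theta>\<bar> < \<epsilon>"
        unfolding eventually_at by (auto simp: dist_real_def)
    qed
    then obtain d where d: "\<And>\<theta>. \<theta> \<in> D0 \<Longrightarrow> d \<theta> > 0 \<and> (\<forall>h. h \<noteq> 0 \<and> \<bar>h\<bar> < d \<theta> \<longrightarrow> \<bar>dq \<theta> h x - G \<bullet> \<theta>\<bar> < \<epsilon>)"
      by metis
    define \<delta> where "\<delta> = Min (insert 1 (d ` D0))"
    have \<delta>: "\<delta> > 0" "\<And>\<theta>. \<theta> \<in> D0 \<Longrightarrow> \<delta> \<le> d \<theta>"
      unfolding \<delta>_def using D0(2) d by auto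
    show "\<exists>\<delta>>0. \<forall>y. norm (y - x) < \<delta> \<longrightarrow> norm (f y - f x - G \<bullet> (y - x)) \<le> e * norm (y - x)"
    proof (intro exI[of _ \<delta>] conjI allI impI \<delta>(1))
      fix y assume y: "norm (y - x) < \<delta>"
      show "norm (f y - f x - G \<bullet> (y - x)) \<le> e * norm (y - x)"
      proof (cases "y = x")
        case False
        define h where "h = norm (y - x)"
        define z where "z = (y - x) /\<^sub>R h"
        have h: "h > 0" "h < \<delta>" using False y by (auto simp: h_def)
        have z: "norm z = 1" "y = x + h *\<^sub>R z" using h by (auto simp: z_def h_def)
        obtain \<theta> where \<theta>: "\<theta> \<in> D0" "norm (z - \<theta>) < \<epsilon>"
          using D0(3) z(1) by (force simp: dist_norm norm_minus_commute)
        have "\<bar>dq \<theta> h x - G \<bullet> \<theta>\<bar> < \<epsilon>" using d[OF \<theta>(1)] \<delta>(2)[OF \<theta>(1)] h by auto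
        then have "\<bar>(f (x + h *\<^sub>R \<theta>) - f x) - h * (G \<bullet> \<theta>)\<bar> \<le> \<epsilon> * h"
          using h by (simp add: dq_def abs_le_iff abs_less_iff field_simps)
        moreover have "\<bar>f y - f (x + h *\<^sub>R \<theta>)\<bar> \<le> L * (\<epsilon> * h)"
        proof -
          have "\<bar>f y - f (x + h *\<^sub>R \<theta>)\<bar> \<le> L * norm (h *\<^sub>R (z - \<theta>))"
            using Lip[of y "x + h *\<^sub>R \<theta>"] by (simp add: z(2) scaleR_diff_right)
          also have "\<dots> \<le> L * (\<epsilon> * h)" using \<theta> h L_nonneg by (intro mult_left_mono) (auto simp: mult.commute)
          finally show ?thesis .
        qed
        moreover have "\<bar>h * (G \<bullet> \<theta>) - G \<bullet> (y - x)\<bar> \<le> norm G * (\<epsilon> * h)"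
        proof -
          have "h * (G \<bullet> \<theta>) - G \<bullet> (y - x) = - (G \<bullet> (h *\<^sub>R (z - \<theta>)))"
            by (simp add: z(2) inner_diff_right algebra_simps)
          then have "\<bar>h * (G \<bullet> \<theta>) - G \<bullet> (y - x)\<bar> \<le> norm G * norm (h *\<^sub>R (z - \<theta>))"
            using Cauchy_Schwarz_ineq2 by (metis abs_minus_cancel)
          also have "\<dots> \<le> norm G * (\<epsilon> * h)" using \<theta> h by (intro mult_left_mono) (auto simp: mult.commute)
          finally show ?thesis .
        qed
        ultimately have "\<bar>f y - f x - G \<bullet> (y - x)\<bar> \<le> (L + 1 + norm G) * (\<epsilon> * h)"
          by (simp add: algebra_simps abs_le_iff)
        moreover have "L + 1 + norm G \<noteq> 0" using L_nonneg norm_ge_zero[of G] by linarith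
        then have "(L + 1 + norm G) * (\<epsilon> * h) = e * h" by (simp add: \<epsilon>_def)
        ultimately show ?thesis by (simp only: h_def real_norm_def)
      qed simp
    qed
  qed
  then show ?thesis by (auto simp: differentiable_def)
qed

theorem Rademacher_real: "negligible {x. \<not> f differentiable (at x)}"
proof -
  obtain D :: "'a set" where D: "countable D" "\<And>S. open S \<Longrightarrow> S \<noteq> {} \<Longrightarrow> \<exists>d\<in>D. d \<in> S"
    using countable_dense_setE by blast
  have "AE x in lborel. \<forall>\<theta>\<in>D. good \<theta> x \<and> dd \<theta> x = (\<Sum>b\<in>Basis. (\<theta> \<bullet> b) * dd b x)"
    using D(1) AE_good dd_linear_AE by (intro AE_ball_countable'[rotated]) (auto simp: AE_conj_iff)
  then have "AE x in lborel. f differentiable (at x)"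
    by (rule AE_mp) (auto intro!: AE_I2 differentiable_if_directionally[OF D(2)])
  then obtain N where N: "{x. \<not> f differentiable (at x)} \<subseteq> N" "N \<in> null_sets lborel"
    by (auto elim!: AE_E simp: null_sets_def)
  then show ?thesis
    by (meson negligible_iff_null_sets negligible_subset null_sets_completionI)
qed

end

theorem Rademacher:
  fixes f :: "'a::euclidean_space \<Rightarrow> 'b::euclidean_space"
  assumes Lip: "\<And>x y. norm (f x - f y) \<le> L * norm (x - y)"
  shows "negligible {x. \<not> f differentiable (at x)}"
proof -
  have "negligible (\<Union>b\<in>Basis. {x. \<not> (\<lambda>x. f x \<bullet> b) differentiable (at x)})"
  proof (rule negligible_Union[OF finite_imageI[OF finite_Basis]], clarify)
    fix b :: 'b assume b: "b \<in> Basis"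
    interpret Lipschitz_real "\<lambda>x. f x \<bullet> b" L
    proof
      fix x y
      have "\<bar>f x \<bullet> b - f y \<bullet> b\<bar> \<le> norm (f x - f y)"
        using Basis_le_norm[OF b, of "f x - f y"] by (simp add: inner_diff_left)
      then show "\<bar>f x \<bullet> b - f y \<bullet> b\<bar> \<le> L * norm (x - y)" using Lip[of x y] by linarith
    qed
    show "negligible {x. \<not> (\<lambda>x. f x \<bullet> b) differentiable (at x)}" by (rule Rademacher_real)
  qed
  moreover have "{x. \<not> f differentiable (at x)} \<subseteq> (\<Union>b\<in>Basis. {x. \<not> (\<lambda>x. f x \<bullet> b) differentiable (at x)})"
    by (auto simp: differentiable_componentwise_within[of f])
  ultimately show ?thesis by (rule negligible_subset)
qed

section \<open>Determinants of perturbed resolvents\<close>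

definition selfadjoint :: "('a::real_inner \<Rightarrow> 'a) \<Rightarrow> bool" where
  "selfadjoint M \<longleftrightarrow> linear M \<and> (\<forall>x y. M x \<bullet> y = x \<bullet> M y)"

lemma selfadjointD: "selfadjoint M \<Longrightarrow> linear M" "selfadjoint M \<Longrightarrow> M x \<bullet> y = x \<bullet> M y"
  by (auto simp: selfadjoint_def)

lemma quadratic_nonneg_imp_linear_zero:
  fixes \<beta> \<gamma> :: real
  assumes "\<And>s. 0 \<le> s * \<beta> + s^2 * \<gamma>"
  shows "\<beta> = 0"
proof (rule ccontr)
  assume b: "\<beta> \<noteq> 0"
  \<comment> \<open>The minimiser of the majorant
    \<open>s * \<beta> + s^2 * (|\<gamma>| + 1)\<close>.\<close>
  define s where "s = - \<beta> / (2 * (\<bar>\<gamma>\<bar> + 1))"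
  have "s * \<beta> + s^2 * \<gamma> \<le> s * \<beta> + s^2 * (\<bar>\<gamma>\<bar> + 1)" by (intro add_left_mono mult_left_mono) auto
  also have "\<dots> = - (\<beta>^2) / (4 * (\<bar>\<gamma>\<bar> + 1))"
    unfolding s_def by (simp add: divide_simps power2_eq_square) (simp add: algebra_simps)
  also have "\<dots> < 0" using b by (simp add: field_simps)
  finally show False using assms[of s] by simp
qed

text \<open>A zero of a nonnegative quadratic form is a minimum, so its first variation in every
  direction \<open>y\<close> vanishes.\<close>

lemma selfadjoint_psd_kernel:
  assumes "selfadjoint H" and psd: "\<And>x. 0 \<le> x \<bullet> H x" and "x \<bullet> H x = 0"
  shows "H x = 0"
proof -
  have l: "linear H" using assms selfadjointD by blast
  have "2 * (y \<bullet> H x) = 0" for y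
  proof (rule quadratic_nonneg_imp_linear_zero[of _ "y \<bullet> H y"])
    fix s
    have "(x + s *\<^sub>R y) \<bullet> H (x + s *\<^sub>R y) = s * (2 * (y \<bullet> H x)) + s^2 * (y \<bullet> H y)"
      using assms(3) selfadjointD(2)[OF assms(1), of x y]
      by (simp add: linear_add[OF l] linear_cmul[OF l] inner_add_left inner_add_right power2_eq_square inner_commute algebra_simps)
    then show "0 \<le> s * (2 * (y \<bullet> H x)) + s^2 * (y \<bullet> H y)" using psd by metis
  qed
  from this[of "H x"] show ?thesis by simp
qed

text \<open>A maximiser of the Rayleigh quotient on the unit sphere of \<open>V\<close> is an
  eigenvector: the first variation of \<open>\<mu> |y|^2 - <y, M y>\<close> vanishes along
  \<open>V\<close>, and \<open>M x - \<mu> x\<close> itself lies in \<open>V\<close>.\<close>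

lemma selfadjoint_eigenvector_in_subspace:
  fixes M :: "'a::euclidean_space \<Rightarrow> 'a"
  assumes M: "selfadjoint M" and V: "subspace V" "V \<noteq> {0}" and inv: "M ` V \<subseteq> V"
  obtains x \<mu> where "x \<in> V" "norm x = 1" "M x = \<mu> *\<^sub>R x"
proof -
  have l: "linear M" using M selfadjointD by blast
  define Sp where "Sp = V \<inter> sphere 0 1"
  have "compact Sp" unfolding Sp_def using closed_subspace[OF V(1)] by (simp add: closed_Int_compact)
  moreover obtain a where "a \<in> V" "a \<noteq> 0" using V subspace_0 by blast
  then have "a /\<^sub>R norm a \<in> Sp" using V(1) by (auto simp: Sp_def subspace_scale)
  then have "Sp \<noteq> {}" by auto
  moreover have "continuous_on Sp (\<lambda>x. x \<bullet> M x)"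
    using linear_continuous_on l by (intro continuous_intros) (simp add: linear_conv_bounded_linear linear_continuous_on)
  ultimately obtain x where x: "x \<in> Sp" and mx: "\<And>y. y \<in> Sp \<Longrightarrow> y \<bullet> M y \<le> x \<bullet> M x"
    using continuous_attains_sup by metis
  define \<mu> where "\<mu> = x \<bullet> M x"
  have xV: "x \<in> V" and nx: "norm x = 1" using x by (auto simp: Sp_def)
  have ge: "y \<bullet> M y \<le> \<mu> * (y \<bullet> y)" if "y \<in> V" for y
  proof (cases "y = 0")
    case True then show ?thesis using l by (simp add: linear_0)
  next
    case False
    have "y /\<^sub>R norm y \<in> Sp" using that False V(1) by (auto simp: Sp_def subspace_scale)
    from mx[OF this] have "(y \<bullet> M y) / (norm y)^2 \<le> \<mu>"
      by (simp add: linear_cmul[OF l] \<mu>_def power2_eq_square divide_inverse mult_ac)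
    then show ?thesis using False by (simp add: divide_simps power2_norm_eq_inner split: if_splits)
  qed
  have orth: "y \<bullet> (M x - \<mu> *\<^sub>R x) = 0" if y: "y \<in> V" for y
  proof -
    have "- 2 * (y \<bullet> (M x - \<mu> *\<^sub>R x)) = 0"
    proof (rule quadratic_nonneg_imp_linear_zero[of _ "\<mu> * (y \<bullet> y) - y \<bullet> M y"])
      fix s
      have "x + s *\<^sub>R y \<in> V" using xV y V(1) by (simp add: subspace_add subspace_scale)
      from ge[OF this] show "0 \<le> s * (- 2 * (y \<bullet> (M x - \<mu> *\<^sub>R x))) + s^2 * (\<mu> * (y \<bullet> y) - y \<bullet> M y)"
        using selfadjointD(2)[OF M, of x y] nx
        by (simp add: linear_add[OF l] linear_cmul[OF l] inner_add_left inner_add_right inner_diff_right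
            power2_eq_square inner_commute algebra_simps \<mu>_def[symmetric] norm_eq_1)
    qed
    then show ?thesis by simp
  qed
  have "M x - \<mu> *\<^sub>R x \<in> V" using inv xV V(1) by (simp add: image_subset_iff subspace_diff subspace_scale)
  from orth[OF this] have "M x = \<mu> *\<^sub>R x" by simp
  with that xV nx show ?thesis by blast
qed

lemma selfadjoint_orthonormal_eigenset:
  fixes M :: "'a::euclidean_space \<Rightarrow> 'a"
  assumes M: "selfadjoint M" and V: "subspace V" and inv: "M ` V \<subseteq> V"
  shows "\<exists>B. B \<subseteq> V \<and> pairwise orthogonal B \<and> (\<forall>x\<in>B. norm x = 1 \<and> (\<exists>\<mu>. M x = \<mu> *\<^sub>R x)) \<and> span B = V"
  using V inv
proof (induction "dim V" arbitrary: V rule: less_induct)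
  case less
  show ?case
  proof (cases "V = {0}")
    case True then show ?thesis by (intro exI[of _ "{}"]) auto
  next
    case False
    obtain x \<mu> where x: "x \<in> V" "norm x = 1" "M x = \<mu> *\<^sub>R x"
      using selfadjoint_eigenvector_in_subspace[OF M less.prems(1) False less.prems(2)] by blast
    define W where "W = {y \<in> V. y \<bullet> x = 0}"
    have sW: "subspace W" unfolding W_def using less.prems(1)
      by (auto simp: subspace_def inner_add_left)
    have invW: "M ` W \<subseteq> W" using less.prems(2) x selfadjointD(2)[OF M] by (auto simp: W_def)
    have "x \<notin> W" using x by (auto simp: W_def norm_eq_1)
    moreover have "W \<subseteq> V" by (auto simp: W_def)
    ultimately have "W \<subset> V" using x by blast
    then have "dim W < dim V" using sW less.prems(1) by (metis dim_psubset span_eq_iff)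
    from less.hyps[OF this sW invW] obtain B where B: "B \<subseteq> W" "pairwise orthogonal B"
      "\<forall>x\<in>B. norm x = 1 \<and> (\<exists>\<mu>. M x = \<mu> *\<^sub>R x)" "span B = W" by blast
    show ?thesis
    proof (intro exI[of _ "insert x B"] conjI)
      show "insert x B \<subseteq> V" using B x by (auto simp: W_def)
      show "pairwise orthogonal (insert x B)" using B
        by (intro pairwise_orthogonal_insert) (auto simp: W_def orthogonal_def inner_commute)
      show "\<forall>x\<in>insert x B. norm x = 1 \<and> (\<exists>\<mu>. M x = \<mu> *\<^sub>R x)" using B x by auto
      show "span (insert x B) = V"
      proof
        show "span (insert x B) \<subseteq> V" using \<open>insert x B \<subseteq> V\<close> less.prems(1) by (rule span_minimal)
        show "V \<subseteq> span (insert x B)"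
        proof
          fix y assume y: "y \<in> V"
          have "y - (y \<bullet> x) *\<^sub>R x \<in> W" using y x less.prems(1)
            by (auto simp: W_def subspace_diff subspace_scale inner_diff_left norm_eq_1)
          then show "y \<in> span (insert x B)" unfolding span_insert using B(4) by auto
        qed
      qed
    qed
  qed
qed

section \<open>Orthonormal bases and diagonalisation\<close>

definition orthonormal_family :: "('n::finite \<Rightarrow> real^'n) \<Rightarrow> bool" where
  "orthonormal_family f \<longleftrightarrow> (\<forall>i j. f i \<bullet> f j = (if i = j then 1 else 0))"

lemma orthonormal_familyD:
  fixes f :: "'n::finite \<Rightarrow> real^'n"
  assumes "orthonormal_family f"
  shows "f i \<bullet> f i = 1" "i \<noteq> j \<Longrightarrow> f i \<bullet> f j = 0" "inj f" "independent (range f)" "span (range f) = UNIV"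
proof -
  show 1: "f i \<bullet> f i = 1" and 2: "i \<noteq> j \<Longrightarrow> f i \<bullet> f j = 0" for i j
    using assms by (auto simp: orthonormal_family_def)
  show inj: "inj f" using 1 2 by (metis injI zero_neq_one)
  show ind: "independent (range f)"
  proof (rule pairwise_orthogonal_independent)
    show "pairwise orthogonal (range f)" unfolding pairwise_def orthogonal_def using 2 by (metis rangeE)
    show "0 \<notin> range f" using 1 by (metis imageE inner_zero_left zero_neq_one)
  qed
  have "card (range f) = DIM(real^'n)" using inj by (simp add: card_image)
  then show "span (range f) = UNIV" using ind dim_eq_full[of "range f"] dim_eq_card_independent[OF ind] by simp
qed

lemma orthonormal_expansion:
  fixes f :: "'n::finite \<Rightarrow> real^'n"
  assumes "orthonormal_family f"
  shows "x = (\<Sum>i\<in>UNIV. (f i \<bullet> x) *\<^sub>R f i)"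
proof -
  have "x - (\<Sum>i\<in>UNIV. (f i \<bullet> x) *\<^sub>R f i) = 0" (is "?d = 0")
  proof -
    have o: "y \<bullet> ?d = 0" if "y \<in> span (range f)" for y
      using that
    proof (induction rule: span_induct_alt)
      case (step c z w)
      then obtain j where j: "z = f j" by auto
      have "f j \<bullet> ?d = f j \<bullet> x - (\<Sum>i\<in>UNIV. (f i \<bullet> x) * (f j \<bullet> f i))"
        by (simp add: inner_diff_right inner_sum_right)
      also have "(\<Sum>i\<in>UNIV. (f i \<bullet> x) * (f j \<bullet> f i)) = (\<Sum>i\<in>UNIV. if i = j then f j \<bullet> x else 0)"
        using orthonormal_familyD[OF assms] by (intro sum.cong) auto
      finally show ?case using step j by (simp add: inner_add_left)
    qed simp
    show ?thesis using o[of ?d] orthonormal_familyD(5)[OF assms] by simp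
  qed
  then show ?thesis by simp
qed

theorem selfadjoint_diagonalizable:
  fixes M :: "real^'n \<Rightarrow> real^'n"
  assumes M: "selfadjoint M"
  obtains f :: "'n \<Rightarrow> real^'n" and \<mu> where "orthonormal_family f" "\<And>i. M (f i) = \<mu> i *\<^sub>R f i"
proof -
  obtain B where B: "pairwise orthogonal B" "\<forall>x\<in>B. norm x = 1 \<and> (\<exists>\<mu>. M x = \<mu> *\<^sub>R x)" "span B = (UNIV :: (real^'n) set)"
    using selfadjoint_orthonormal_eigenset[OF M subspace_UNIV] by auto
  have ind: "independent B" using B by (intro pairwise_orthogonal_independent) auto
  have "card B = CARD('n)" using ind B(3) by (metis dim_UNIV dim_span indep_card_eq_dim_span DIM_cart DIM_real mult.right_neutral)
  then obtain f where f: "bij_betw f (UNIV :: 'n set) B"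
    using finite_same_card_bij[of "UNIV :: 'n set" B] independent_imp_finite[OF ind] by auto
  have "\<exists>\<mu>. \<forall>i. M (f i) = \<mu> i *\<^sub>R f i" using B(2) f by (intro choice) (auto simp: bij_betw_def)
  then obtain \<mu> where "\<And>i. M (f i) = \<mu> i *\<^sub>R f i" by blast
  moreover have "orthonormal_family f"
    unfolding orthonormal_family_def
  proof (intro allI)
    fix i j
    have in_B: "f i \<in> B" "f j \<in> B" using f by (auto simp: bij_betw_def)
    show "f i \<bullet> f j = (if i = j then 1 else 0)"
    proof (cases "i = j")
      case True then show ?thesis using B(2) in_B by (simp add: norm_eq_1)
    next
      case False
      then have "f i \<noteq> f j" using f by (auto simp: bij_betw_def inj_on_def)
      then show ?thesis using B(1) in_B False by (auto simp: pairwise_def orthogonal_def)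
    qed
  qed
  ultimately show ?thesis using that by blast
qed

lemma det_matrix_orthonormal:
  fixes L :: "real^'n \<Rightarrow> real^'n"
  assumes f: "orthonormal_family f" and L: "linear L"
  shows "det (matrix L) = det (\<chi> i j. f i \<bullet> L (f j))"
proof -
  define Q :: "real^'n^'n" where "Q = (\<chi> i j. f j $ i)"
  have QtQ: "transpose Q ** Q = mat 1"
    using f by (simp add: vec_eq_iff Q_def transpose_def matrix_matrix_mult_def mat_def orthonormal_family_def inner_vec_def)
  have col: "Q *v axis j 1 = f j" for j
    by (simp add: vec_eq_iff Q_def matrix_vector_mult_basis column_def)
  have "(\<chi> i j. f i \<bullet> L (f j)) = transpose Q ** (matrix L ** Q)"
  proof -
    have "f i \<bullet> L (f j) = (transpose Q ** (matrix L ** Q)) $ i $ j" for i j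
    proof -
      have "(matrix L ** Q) *v axis j 1 = L (f j)"
        using L by (simp add: matrix_vector_mul_assoc[symmetric] col matrix_works)
      then have "column j (matrix L ** Q) = L (f j)" by (simp add: matrix_vector_mult_basis)
      then have "(matrix L ** Q) $ k $ j = L (f j) $ k" for k by (auto simp: column_def vec_eq_iff)
      moreover have "(transpose Q ** X) $ i $ j = (\<Sum>k\<in>UNIV. f i $ k * X $ k $ j)" for X :: "real^'n^'n"
        by (simp add: matrix_matrix_mult_def transpose_def Q_def)
      ultimately show ?thesis by (simp add: inner_vec_def)
    qed
    then show ?thesis by (simp add: vec_eq_iff)
  qed
  then have "det (\<chi> i j. f i \<bullet> L (f j)) = det (transpose Q ** Q) * det (matrix L)"
    by (simp add: det_mul)
  then show ?thesis by (simp add: QtQ)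
qed

text \<open>As \<open>A\<close> may fail to be symmetric, eigenvalues are avoided: the segment from
  the identity to \<open>A\<close> consists of positive definite, hence invertible, matrices, and
  the determinant cannot change sign along it.\<close>

lemma det_pos_def_pos:
  fixes A :: "real^'n^'n"
  assumes pd: "\<And>x. x \<noteq> 0 \<Longrightarrow> 0 < x \<bullet> (A *v x)"
  shows "0 < det A"
proof -
  define B where "B s = (1 - s) *\<^sub>R mat 1 + s *\<^sub>R A" for s :: real
  have nz: "det (B s) \<noteq> 0" if "0 \<le> s" "s \<le> 1" for s
  proof -
    have "inj ((*v) (B s))"
    proof (rule vec.inj_iff_eq_0[THEN iffD2, rule_format])
      fix x assume x: "B s *v x = 0"
      have "x \<bullet> (B s *v x) = (1 - s) * (x \<bullet> x) + s * (x \<bullet> (A *v x))"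
        by (simp add: B_def matrix_vector_mult_add_rdistrib scaleR_matrix_vector_assoc[symmetric] inner_add_right)
      then have eq: "(1 - s) * (x \<bullet> x) + s * (x \<bullet> (A *v x)) = 0" using x by simp
      show "x = 0"
      proof (rule ccontr)
        assume "x \<noteq> 0"
        then have "0 < x \<bullet> x" "0 < x \<bullet> (A *v x)" using pd by auto
        then show False using eq that
          by (smt (verit) mult_nonneg_nonneg mult_pos_pos)
      qed
    qed
    then show ?thesis using det_nz_iff_inj[of "(*v) (B s)"] by (simp add: matrix_of_matrix_vector_mul)
  qed
  have cont: "continuous_on {0..1} (\<lambda>s. det (B s))"
    unfolding det_def B_def by (intro continuous_intros)
  show ?thesis
  proof (rule ccontr)
    assume "\<not> 0 < det A"
    moreover have "det (B 0) = 1" "B 1 = A" by (auto simp: B_def)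
    ultimately have "\<exists>s. 0 \<le> s \<and> s \<le> 1 \<and> det (B s) = 0"
      using IVT2'[of "\<lambda>s. det (B s)" 1 0 0] cont by auto
    then show False using nz by blast
  qed
qed

section \<open>Principal minors and the expansion of the Jacobian determinant\<close>

lemma det_add_rows:
  fixes a b :: "'n::finite \<Rightarrow> 'n \<Rightarrow> real"
  shows "det (\<chi> i j. a i j + b i j) = (\<Sum>S\<in>UNIV. det (\<chi> i j. if i \<in> S then a i j else b i j))"
proof -
  have "det (\<chi> i j. a i j + b i j) = (\<Sum>p | p permutes UNIV. \<Sum>S\<in>UNIV. of_int (sign p) * (\<Prod>i\<in>UNIV. if i \<in> S then a i (p i) else b i (p i)))"
  proof -
    have "(\<Prod>i\<in>UNIV. a i (p i) + b i (p i)) = (\<Sum>S\<in>UNIV. \<Prod>i\<in>UNIV. if i \<in> S then a i (p i) else b i (p i))" for p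
    proof -
      have "(\<Prod>i\<in>UNIV. a i (p i) + b i (p i)) = (\<Sum>S\<in>Pow UNIV. (\<Prod>i\<in>S. a i (p i)) * (\<Prod>i\<in>UNIV - S. b i (p i)))"
        by (rule prod_add) simp
      also have "\<dots> = (\<Sum>S\<in>UNIV. \<Prod>i\<in>UNIV. if i \<in> S then a i (p i) else b i (p i))"
        by (intro sum.cong) (auto simp: prod.If_cases Compl_eq_Diff_UNIV)
      finally show ?thesis .
    qed
    then show ?thesis by (simp add: det_def sum_distrib_left)
  qed
  also have "\<dots> = (\<Sum>S\<in>UNIV. det (\<chi> i j. if i \<in> S then a i j else b i j))"
    by (subst sum.swap) (simp add: det_def)
  finally show ?thesis .
qed

text \<open>The principal minor of \<open>H\<close> in the basis \<open>f\<close> with index set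
  \<open>S\<close>. Filling the other rows with those of the identity keeps the matrix at full size
  without changing the determinant of the block.\<close>

definition gram_minor :: "('n::finite \<Rightarrow> real^'n) \<Rightarrow> (real^'n \<Rightarrow> real^'n) \<Rightarrow> 'n set \<Rightarrow> real" where
  "gram_minor f H S = det (\<chi> i j. if i \<in> S then f i \<bullet> H (f j) else if i = j then 1 else 0)"

text \<open>Multilinearity in the rows: \<open>S\<close> records the rows taken from the Gram
  matrix. The expansion separates \<open>H\<close> from the numbers \<open>\<sigma>\<close> and
  \<open>\<tau>\<close>.\<close>

lemma det_diagonal_plus_gram:
  "det (\<chi> i j. (if i = j then \<sigma> i else 0) + \<tau> i * (f i \<bullet> H (f j))) =
     (\<Sum>S\<in>UNIV. (\<Prod>i\<in>S. \<tau> i) * (\<Prod>i\<in>-S. \<sigma> i) * gram_minor f H S)"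
proof -
  have "det (\<chi> i j. (if i = j then \<sigma> i else 0) + \<tau> i * (f i \<bullet> H (f j))) =
    det (\<chi> i j. \<tau> i * (f i \<bullet> H (f j)) + (if i = j then \<sigma> i else 0))"
    by (simp add: add.commute)
  also have "\<dots> = (\<Sum>S\<in>UNIV. det (\<chi> i j. if i \<in> S then \<tau> i * (f i \<bullet> H (f j)) else if i = j then \<sigma> i else 0))"
    by (rule det_add_rows)
  also have "\<dots> = (\<Sum>S\<in>UNIV. (\<Prod>i\<in>S. \<tau> i) * (\<Prod>i\<in>-S. \<sigma> i) * gram_minor f H S)"
  proof (rule sum.cong[OF refl])
    fix S
    have "det (\<chi> i j. if i \<in> S then \<tau> i * (f i \<bullet> H (f j)) else if i = j then \<sigma> i else 0) =
      det (\<chi> i. (if i \<in> S then \<tau> i else \<sigma> i) *s (\<chi> j. if i \<in> S then f i \<bullet> H (f j) else if i = j then 1 else 0))"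
      by (rule arg_cong[of _ _ det]) (simp add: vec_eq_iff)
    also have "\<dots> = (\<Prod>i\<in>UNIV. if i \<in> S then \<tau> i else \<sigma> i) * gram_minor f H S"
      unfolding gram_minor_def by (rule det_rows_mul)
    finally show "det (\<chi> i j. if i \<in> S then \<tau> i * (f i \<bullet> H (f j)) else if i = j then \<sigma> i else 0) =
       (\<Prod>i\<in>S. \<tau> i) * (\<Prod>i\<in>-S. \<sigma> i) * gram_minor f H S"
      by (simp add: prod.If_cases)
  qed
  finally show ?thesis .
qed

lemma gram_matrix_mult:
  assumes "linear H"
  shows "(\<chi> i j. f i \<bullet> H (f j)) *v x = (\<chi> i. f i \<bullet> H (\<Sum>j\<in>UNIV. x $ j *\<^sub>R f j))"
  by (simp add: vec_eq_iff matrix_vector_mult_def linear_sum[OF assms] linear_cmul[OF assms] inner_sum_right mult.commute)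

text \<open>The matrix of the minor is a limit of matrices that are positive definite up to positive
  row factors.\<close>

lemma gram_minor_nonneg:
  fixes f :: "'n::finite \<Rightarrow> real^'n"
  assumes H: "linear H" and psd: "\<And>x. 0 \<le> x \<bullet> H x"
  shows "0 \<le> gram_minor f H S"
proof -
  define A :: "real \<Rightarrow> real^'n^'n" where
    "A \<epsilon> = (\<chi> i j. if i \<in> S then f i \<bullet> H (f j) + \<epsilon> * (if i = j then 1 else 0) else (if i = j then 1 else 0) + \<epsilon> * (f i \<bullet> H (f j)))" for \<epsilon>
  have "((\<lambda>\<epsilon>. det (A \<epsilon>)) \<longlongrightarrow> det (A 0)) (at_right 0)"
  proof -
    have "continuous_on UNIV (\<lambda>\<epsilon>. det (A \<epsilon>))"
    proof -
      have "continuous_on UNIV (\<lambda>\<epsilon>. A \<epsilon> $ i $ j)" for i j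
        by (cases "i \<in> S") (auto simp: A_def intro!: continuous_intros)
      then show ?thesis unfolding det_def by (intro continuous_on_sum continuous_on_mult continuous_on_prod continuous_on_const)
    qed
    then show ?thesis by (simp add: continuous_on_def filterlim_at_split)
  qed
  moreover have "\<forall>\<^sub>F \<epsilon> in at_right 0. 0 \<le> det (A \<epsilon>)"
    unfolding eventually_at_filter
  proof (rule always_eventually, intro allI impI)
    fix \<epsilon> :: real assume "\<epsilon> \<in> {0<..}"
    then have e: "\<epsilon> > 0" by simp
    \<comment> \<open>Row \<open>i\<close> of \<open>A \<epsilon>\<close> is row \<open>i\<close> of
      \<open>B\<close> times 1 for \<open>i\<close> in \<open>S\<close> and times
      \<open>\<epsilon>\<close> otherwise; the large diagonal entries \<open>1 / \<epsilon>\<close>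
      turn into those of the identity in the limit.\<close>
    define B :: "real^'n^'n" where "B = (\<chi> i j. f i \<bullet> H (f j) + (if i = j then if i \<in> S then \<epsilon> else 1/\<epsilon> else 0))"
    have "A \<epsilon> = (\<chi> i. (if i \<in> S then 1 else \<epsilon>) *s (B $ i))"
      using e by (auto simp: A_def B_def vec_eq_iff algebra_simps)
    then have "det (A \<epsilon>) = (\<Prod>i\<in>UNIV. if i \<in> S then 1 else \<epsilon>) * det B"
      using det_rows_mul[of "\<lambda>i. if i \<in> S then 1 else \<epsilon>" "\<lambda>i. B $ i"] by simp
    moreover have "0 < det B"
    proof (rule det_pos_def_pos)
      fix x :: "real^'n" assume x: "x \<noteq> 0"
      define y where "y = (\<Sum>j\<in>UNIV. x $ j *\<^sub>R f j)"
      define D where "D i = (if i \<in> S then \<epsilon> else 1/\<epsilon>)" for i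
      have "B *v x = (\<chi> i. f i \<bullet> H y) + (\<chi> i. D i * x $ i)"
      proof -
        have "B = (\<chi> i j. f i \<bullet> H (f j)) + (\<chi> i j. if i = j then D i else 0)"
          by (simp add: B_def D_def vec_eq_iff)
        moreover have "(\<chi> i j. if i = j then D i else 0) *v x = (\<chi> i. D i * x $ i)"
          by (simp add: vec_eq_iff matrix_vector_mult_def if_distrib[of "\<lambda>c. c * _"] cong: if_cong)
        ultimately show ?thesis
          by (simp only: matrix_vector_mult_add_rdistrib gram_matrix_mult[OF H] y_def)
      qed
      then have "x \<bullet> (B *v x) = (\<Sum>i\<in>UNIV. x $ i * (f i \<bullet> H y)) + (\<Sum>i\<in>UNIV. D i * (x $ i)^2)"
        by (simp add: inner_vec_def sum.distrib[symmetric] power2_eq_square algebra_simps)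
      also have "(\<Sum>i\<in>UNIV. x $ i * (f i \<bullet> H y)) = y \<bullet> H y"
        by (subst (2) y_def) (simp add: inner_sum_left)
      finally have eq: "x \<bullet> (B *v x) = y \<bullet> H y + (\<Sum>i\<in>UNIV. D i * (x $ i)^2)" .
      obtain k where "x $ k \<noteq> 0" using x by (auto simp: vec_eq_iff)
      then have "0 < (\<Sum>i\<in>UNIV. D i * (x $ i)^2)"
        using e by (intro sum_pos2[of _ k]) (auto simp: D_def)
      then show "0 < x \<bullet> (B *v x)" using eq psd[of y] by simp
    qed
    ultimately show "0 \<le> det (A \<epsilon>)" using e by (auto intro!: mult_nonneg_nonneg prod_nonneg)
  qed
  ultimately have "0 \<le> det (A 0)" by (rule tendsto_lowerbound) simp
  moreover have "det (A 0) = gram_minor f H S"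
    unfolding gram_minor_def A_def by (rule arg_cong[of _ _ det]) (simp add: vec_eq_iff)
  ultimately show ?thesis by simp
qed

text \<open>A kernel vector of the matrix has no coordinates outside \<open>S\<close>, and the form
  of \<open>H\<close> vanishes on the vector it represents. Conversely, such a vector lies in the
  kernel of \<open>H\<close>, as the form is nonnegative.\<close>

lemma gram_minor_pos_iff:
  fixes f :: "'n::finite \<Rightarrow> real^'n"
  assumes f: "orthonormal_family f" and H: "selfadjoint H" and psd: "\<And>x. 0 \<le> x \<bullet> H x"
  shows "0 < gram_minor f H S \<longleftrightarrow> (\<forall>a\<in>span (f ` S). a \<noteq> 0 \<longrightarrow> 0 < a \<bullet> H a)"
proof -
  have l: "linear H" using H selfadjointD by blast
  define A :: "real^'n^'n" where "A = (\<chi> i j. if i \<in> S then f i \<bullet> H (f j) else if i = j then 1 else 0)"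
  define e where "e x = (\<Sum>j\<in>UNIV. x $ j *\<^sub>R f j)" for x :: "real^'n"
  have fe: "f i \<bullet> e x = x $ i" for i x
  proof -
    have "f i \<bullet> e x = (\<Sum>j\<in>UNIV. x $ j * (f i \<bullet> f j))" by (simp add: e_def inner_sum_right)
    also have "\<dots> = (\<Sum>j\<in>UNIV. if j = i then x $ i else 0)"
      using orthonormal_familyD[OF f] by (intro sum.cong) auto
    finally show ?thesis by simp
  qed
  have e0: "e x = 0 \<longleftrightarrow> x = 0" for x proof
    assume "e x = 0"
    then show "x = 0" using fe[of _ x] by (simp add: vec_eq_iff[of x])
  qed (simp add: e_def)
  have Ax: "(A *v x) $ i = (if i \<in> S then f i \<bullet> H (e x) else x $ i)" for x i
    using gram_matrix_mult[OF l, of f x] 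
    by (auto simp: vec_eq_iff A_def e_def matrix_vector_mult_def if_distrib[of "\<lambda>c. c * _"] cong: if_cong)
  have nz: "gram_minor f H S \<noteq> 0 \<longleftrightarrow> (\<forall>x. A *v x = 0 \<longrightarrow> x = 0)"
    using det_nz_iff_inj[of "(*v) A"] vec.inj_iff_eq_0[of A]
    by (simp add: gram_minor_def A_def[symmetric] matrix_of_matrix_vector_mul)
  have "0 < gram_minor f H S \<longleftrightarrow> (\<forall>x. A *v x = 0 \<longrightarrow> x = 0)"
    using gram_minor_nonneg[OF l psd, of f S] nz by auto
  also have "\<dots> \<longleftrightarrow> (\<forall>a\<in>span (f ` S). a \<noteq> 0 \<longrightarrow> 0 < a \<bullet> H a)"
  proof (intro iffI ballI impI allI)
    fix a assume inj: "\<forall>x. A *v x = 0 \<longrightarrow> x = 0" and a: "a \<in> span (f ` S)" "a \<noteq> 0"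
    define x :: "real^'n" where "x = (\<chi> i. f i \<bullet> a)"
    have ex: "e x = a" using orthonormal_expansion[OF f, of a] by (simp add: e_def x_def)
    show "0 < a \<bullet> H a"
    proof (rule ccontr)
      assume "\<not> 0 < a \<bullet> H a"
      then have "H a = 0" using selfadjoint_psd_kernel[OF H psd] psd[of a] by simp
      have orth: "f i \<bullet> a = 0" if i: "i \<notin> S" for i
        using a(1)
      proof (induction rule: span_induct_alt)
        case (step c z w)
        then obtain j where "z = f j" "i \<noteq> j" using i by auto
        then show ?case using orthonormal_familyD(2)[OF f] step by (simp add: inner_add_right)
      qed simp
      have "(A *v x) $ i = 0" for i
      proof (cases "i \<in> S")
        case True with \<open>H a = 0\<close> show ?thesis by (simp only: Ax ex if_True inner_zero_right)
      next
        case False then have "f i \<bullet> a = 0" by (rule orth)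
        then show ?thesis using False by (simp add: Ax) (simp add: x_def)
      qed
      then have "A *v x = 0" by (simp add: vec_eq_iff)
      then show False using inj e0[of x] ex a by auto
    qed
  next
    fix x assume pos: "\<forall>a\<in>span (f ` S). a \<noteq> 0 \<longrightarrow> 0 < a \<bullet> H a" and x: "A *v x = 0"
    have zero: "x $ i = 0" if "i \<notin> S" for i using Ax[of x i] x that by simp
    have zero': "f i \<bullet> H (e x) = 0" if "i \<in> S" for i using Ax[of x i] x that by simp
    have eS: "e x = (\<Sum>j\<in>S. x $ j *\<^sub>R f j)" unfolding e_def
      by (rule sum.mono_neutral_right) (auto simp: zero)
    have "e x \<in> span (f ` S)" unfolding eS by (intro span_sum span_scale span_base) auto
    moreover have "e x \<bullet> H (e x) = 0" by (subst eS) (simp add: inner_sum_left zero')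
    ultimately have "e x = 0" using pos by force
    then show "x = 0" using e0 by simp
  qed
  finally show ?thesis .
qed

text \<open>Firmness puts the eigenvalues \<open>\<mu> i\<close> of \<open>M\<close> into
  \<open>[0, 1]\<close>; \<open>w S\<close> is the product of \<open>\<mu> i\<close> over
  \<open>S\<close> and of \<open>1 - \<mu> i\<close> off \<open>S\<close>. A positive weight
  excludes the eigenvalue 1 off \<open>S\<close>, which confines the fixed vectors of
  \<open>M\<close> to the span of the \<open>f i\<close> with \<open>i\<close> in \<open>S\<close>.
  Basis and weights do not depend on \<open>H\<close>, so that two Hessians can be compared in one
  frame.\<close>

lemma resolvent_det_expansion:
  fixes M :: "real^'n \<Rightarrow> real^'n"
  assumes M: "selfadjoint M" and firm: "\<And>x. M x \<bullet> M x \<le> M x \<bullet> x"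
  obtains f :: "'n \<Rightarrow> real^'n" and w :: "'n set \<Rightarrow> real" where "orthonormal_family f"
    "\<And>S. 0 \<le> w S" "\<And>S a. 0 < w S \<Longrightarrow> M a = a \<Longrightarrow> a \<in> span (f ` S)"
    "\<And>H t. selfadjoint H \<Longrightarrow> det (matrix (\<lambda>a. a - M a + t *\<^sub>R H (M a))) =
       (\<Sum>d\<le>CARD('n). (\<Sum>S | card S = d. w S * gram_minor f H S) * t ^ d)"
proof -
  obtain f :: "'n \<Rightarrow> real^'n" and \<mu> where f: "orthonormal_family f" and \<mu>: "\<And>i. M (f i) = \<mu> i *\<^sub>R f i"
    using selfadjoint_diagonalizable[OF M] by blast
  have l: "linear M" using M selfadjointD by blast
  have \<mu>01: "0 \<le> \<mu> i \<and> \<mu> i \<le> 1" for i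
  proof -
    have "\<mu> i * \<mu> i \<le> \<mu> i" using firm[of "f i"] orthonormal_familyD(1)[OF f, of i] by (simp add: \<mu>)
    then show ?thesis
      by (metis mult_le_cancel_left1 mult_le_cancel_right2 order.trans not_le linorder_linear zero_le_square)
  qed
  define w where "w S = (\<Prod>i\<in>S. \<mu> i) * (\<Prod>i\<in>-S. 1 - \<mu> i)" for S
  show ?thesis
  proof (rule that[OF f])
    show "0 \<le> w S" for S unfolding w_def using \<mu>01 by (auto intro!: mult_nonneg_nonneg prod_nonneg)
    show "a \<in> span (f ` S)" if w: "0 < w S" and a: "M a = a" for S a
    proof -
      have "f i \<bullet> a = 0" if i: "i \<notin> S" for i
      proof -
        have "(\<Prod>i\<in>-S. 1 - \<mu> i) \<noteq> 0" using w unfolding w_def by (metis less_irrefl mult_zero_right)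
        then have "\<mu> i \<noteq> 1" using i by auto
        moreover have "f i \<bullet> a = \<mu> i * (f i \<bullet> a)"
          using selfadjointD(2)[OF M, of "f i" a] by (simp add: a \<mu>)
        ultimately show ?thesis by simp
      qed
      then have "a = (\<Sum>i\<in>S. (f i \<bullet> a) *\<^sub>R f i)"
        by (subst orthonormal_expansion[OF f, of a], intro sum.mono_neutral_right) auto
      also have "\<dots> \<in> span (f ` S)" by (intro span_sum span_scale span_base) auto
      finally show ?thesis .
    qed
    show "det (matrix (\<lambda>a. a - M a + t *\<^sub>R H (M a))) =
       (\<Sum>d\<le>CARD('n). (\<Sum>S | card S = d. w S * gram_minor f H S) * t ^ d)" if H: "selfadjoint H" for H t
    proof -
      have lH: "linear H" using H selfadjointD by blast
      have lin: "linear (\<lambda>a. a - M a + t *\<^sub>R H (M a))"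
        using l lH by (auto intro!: linear_compose_add linear_compose_sub linear_compose_scale_right linear_compose[of M H, unfolded o_def] linear_id[unfolded id_def])
      have "det (matrix (\<lambda>a. a - M a + t *\<^sub>R H (M a))) = det (\<chi> i j. f i \<bullet> (f j - M (f j) + t *\<^sub>R H (M (f j))))"
        by (rule det_matrix_orthonormal[OF f lin])
      \<comment> \<open>The factors \<open>t * \<mu> j\<close> sit on columns; transposing moves
        them to the rows, as in the expansion above.\<close>
      also have "\<dots> = det (transpose (\<chi> i j. f i \<bullet> (f j - M (f j) + t *\<^sub>R H (M (f j)))))" by simp
      also have "transpose (\<chi> i j. f i \<bullet> (f j - M (f j) + t *\<^sub>R H (M (f j)))) =
        (\<chi> i j. (if i = j then 1 - \<mu> i else 0) + (t * \<mu> i) * (f i \<bullet> H (f j)))"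
        using orthonormal_familyD(1,2)[OF f] selfadjointD(2)[OF H]
        by (auto simp: transpose_def vec_eq_iff \<mu> linear_cmul[OF lH] inner_diff_right inner_add_right inner_commute algebra_simps)
      also have "det \<dots> = (\<Sum>S\<in>UNIV. (\<Prod>i\<in>S. t * \<mu> i) * (\<Prod>i\<in>-S. 1 - \<mu> i) * gram_minor f H S)"
        by (rule det_diagonal_plus_gram)
      also have "\<dots> = (\<Sum>S\<in>UNIV. (w S * gram_minor f H S) * t ^ card S)"
        by (intro sum.cong) (auto simp: w_def prod.distrib algebra_simps)
      also have "\<dots> = (\<Sum>d\<le>CARD('n). \<Sum>S | card S = d. (w S * gram_minor f H S) * t ^ card S)"
        by (subst sum.group[symmetric, where g = card and T = "{..CARD('n)}"]) (auto intro: card_mono)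
      finally show ?thesis by (simp add: sum_distrib_right)
    qed
  qed
qed

text \<open>Coefficient extraction by Lagrange interpolation at the nodes $1, \dots, n+1$.\<close>
lemma interpolation_coefficients:
  obtains lam :: "nat \<Rightarrow> nat \<Rightarrow> real" where
    "\<And>c d. d \<le> n \<Longrightarrow> c d = (\<Sum>i\<le>n. lam d i * (\<Sum>e\<le>n. c e * real (Suc i) ^ e))"
proof -
  define L :: "nat \<Rightarrow> real poly" where "L i = (\<Prod>m\<in>{..n} - {i}. smult (1 / (real i - real m)) [:- real (Suc m), 1:])" for i
  have Lval: "poly (L i) (real (Suc k)) = (if i = k then 1 else 0)" if "i \<le> n" "k \<le> n" for i k
  proof (cases "i = k")
    case True
    have "(\<Prod>m\<in>{..n} - {i}. 1 / (real i - real m) * (real (Suc i) - real (Suc m))) = (\<Prod>m\<in>{..n} - {i}. 1)"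
      by (intro prod.cong) auto
    moreover have "poly (L i) (real (Suc i)) = (\<Prod>m\<in>{..n} - {i}. 1 / (real i - real m) * (real (Suc i) - real (Suc m)))"
      by (simp add: L_def poly_prod diff_divide_distrib del: of_nat_Suc)
    ultimately show ?thesis using True by simp
  next
    case False then show ?thesis using that by (auto simp: L_def poly_prod field_simps intro!: bexI[of _ k])
  qed
  have degL: "degree (L i) \<le> n" if "i \<le> n" for i
  proof -
    have "degree (L i) \<le> (\<Sum>m\<in>{..n} - {i}. degree (smult (1 / (real i - real m)) [:- real (Suc m), 1:]))"
      unfolding L_def by (rule degree_prod_sum_le[unfolded o_def]) simp
    also have "\<dots> \<le> (\<Sum>m\<in>{..n} - {i}. 1)" by (intro sum_mono) simp
    also have "\<dots> = n" using that by simp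
    finally show ?thesis .
  qed
  show ?thesis
  proof (rule that[of "\<lambda>d i. coeff (L i) d"])
    fix c :: "nat \<Rightarrow> real" and d assume d: "d \<le> n"
    define p where "p = (\<Sum>e\<le>n. monom (c e) e)"
    define q where "q = (\<Sum>i\<le>n. smult (poly p (real (Suc i))) (L i))"
    have "p = q"
    proof (rule poly_eqI_degree[of "(\<lambda>i. real (Suc i)) ` {..n}"])
      show "poly p x = poly q x" if x: "x \<in> (\<lambda>i. real (Suc i)) ` {..n}" for x
      proof -
        obtain k where k: "k \<le> n" "x = real (Suc k)" using x by auto
        have "poly q x = (\<Sum>i\<le>n. poly p (real (Suc i)) * (if i = k then 1 else 0))"
          unfolding q_def poly_sum k by (intro sum.cong) (simp_all add: Lval k del: of_nat_Suc)
        then show ?thesis using k by (simp add: if_distrib[of "\<lambda>c. _ * c"] cong: if_cong del: of_nat_Suc)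
      qed
      have card: "card ((\<lambda>i. real (Suc i)) ` {..n}) = Suc n" by (subst card_image) (auto simp: inj_on_def)
      have "degree p \<le> n" unfolding p_def
        by (intro degree_sum_le) (auto intro: order_trans[OF degree_monom_le])
      then show "degree p < card ((\<lambda>i. real (Suc i)) ` {..n})" using card by simp
      have "degree q \<le> n" unfolding q_def
        by (intro degree_sum_le) (auto intro: order_trans[OF degree_smult_le] degL)
      then show "degree q < card ((\<lambda>i. real (Suc i)) ` {..n})" using card by simp
    qed
    moreover have "coeff p d = c d" using d by (simp add: p_def coeff_sum)
    moreover have "poly p x = (\<Sum>e\<le>n. c e * x ^ e)" for x by (simp add: p_def poly_sum poly_monom)
    ultimately show "c d = (\<Sum>i\<le>n. coeff (L i) d * (\<Sum>e\<le>n. c e * real (Suc i) ^ e))"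
      by (simp add: q_def coeff_sum mult.commute del: of_nat_Suc)
  qed
qed

section \<open>Subgradients and the proximal map\<close>

lemma subdiffI: "(\<And>z. v b + y \<bullet> (z - b) \<le> v z) \<Longrightarrow> y \<in> subdiff v b"
  by (simp add: subdiff_def)

lemma subdiffD: "y \<in> subdiff v b \<Longrightarrow> v b + y \<bullet> (z - b) \<le> v z"
  by (simp add: subdiff_def)

lemma has_derivative_directional:
  fixes f :: "'a::euclidean_space \<Rightarrow> 'b::real_normed_vector"
  assumes "(f has_derivative D) (at p)"
  shows "((\<lambda>s. (f (p + s *\<^sub>R h) - f p) /\<^sub>R s) \<longlongrightarrow> D h) (at (0::real))"
proof -
  interpret bounded_linear D using assms by (rule has_derivative_bounded_linear)
  have "((\<lambda>s. f (p + s *\<^sub>R h)) has_derivative (\<lambda>s. D (s *\<^sub>R h))) (at 0)"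
    by (rule has_derivative_compose[of "\<lambda>s. p + s *\<^sub>R h" "\<lambda>s. s *\<^sub>R h" 0 UNIV f D])
      (use assms in \<open>auto intro!: derivative_eq_intros\<close>)
  then have lim: "(\<lambda>s. norm (f (p + s *\<^sub>R h) - f p - s *\<^sub>R D h) / norm s) \<midarrow>0\<rightarrow> 0"
    by (simp add: has_derivative_at scale)
  show ?thesis
  proof (rule Lim_null[THEN iffD2], rule tendsto_norm_zero_cancel, rule tendsto_cong[THEN iffD1, OF _ lim])
    show "\<forall>\<^sub>F s in at 0. norm (f (p + s *\<^sub>R h) - f p - s *\<^sub>R D h) / norm s = norm ((f (p + s *\<^sub>R h) - f p) /\<^sub>R s - D h)"
      unfolding eventually_at_filter
    proof (rule always_eventually, intro allI impI)
      fix s :: real assume "s \<noteq> 0"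
      then have "(f (p + s *\<^sub>R h) - f p) /\<^sub>R s - D h = (f (p + s *\<^sub>R h) - f p - s *\<^sub>R D h) /\<^sub>R s"
        by (simp add: scaleR_diff_right)
      then show "norm (f (p + s *\<^sub>R h) - f p - s *\<^sub>R D h) / norm s = norm ((f (p + s *\<^sub>R h) - f p) /\<^sub>R s - D h)"
        by (simp add: divide_inverse mult.commute)
    qed
  qed
qed

text \<open>Local minimality suffices, since convexity bounds the increment of \<open>v\<close>
  along the segment to \<open>z\<close> by its share of \<open>v z - v b\<close>. \<open>G\<close>
  may be nonconvex: it is also used with the negative of a convex function and with tilted
  penalties.\<close>

lemma subdiff_of_local_min:
  fixes v :: "'a::euclidean_space \<Rightarrow> real"
  assumes v: "convex_on UNIV v" and G: "(G has_derivative (\<lambda>h. g \<bullet> h)) (at b)"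
    and min: "\<forall>\<^sub>F z in nhds b. v b + G b \<le> v z + G z"
  shows "- g \<in> subdiff v b"
proof (rule subdiffI)
  fix z
  define d where "d = z - b"
  have lim: "((\<lambda>s. (G (b + s *\<^sub>R d) - G b) /\<^sub>R s) \<longlongrightarrow> g \<bullet> d) (at_right 0)"
    using has_derivative_directional[OF G, of d] by (rule filterlim_mono) (simp_all add: at_le)
  have "((\<lambda>s. b + s *\<^sub>R d) \<longlongrightarrow> b + 0 *\<^sub>R d) (at_right 0)" by (intro tendsto_intros)
  then have "filterlim (\<lambda>s. b + s *\<^sub>R d) (nhds b) (at_right 0)" by simp
  from eventually_compose_filterlim[OF min this]
  have "\<forall>\<^sub>F s in at_right 0. v b + G b \<le> v (b + s *\<^sub>R d) + G (b + s *\<^sub>R d)" .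
  moreover have "\<forall>\<^sub>F s in at_right (0::real). 0 < s \<and> s < 1"
    unfolding eventually_at_right_field by (intro exI[of _ 1]) auto
  ultimately have "\<forall>\<^sub>F s in at_right 0. v b - v z \<le> (G (b + s *\<^sub>R d) - G b) /\<^sub>R s"
  proof eventually_elim
    case (elim s)
    have "b + s *\<^sub>R d = (1 - s) *\<^sub>R b + s *\<^sub>R z" by (simp add: d_def algebra_simps)
    then have "v (b + s *\<^sub>R d) \<le> (1 - s) * v b + s * v z" using convex_onD[OF v, of s b z] elim by simp
    then have "s * (v b - v z) \<le> G (b + s *\<^sub>R d) - G b" using elim by (simp add: algebra_simps)
    then show ?case using elim by (simp add: field_simps)
  qed
  then have "v b - v z \<le> g \<bullet> d" by (rule tendsto_lowerbound[OF lim]) simp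
  then show "v b + - g \<bullet> (z - b) \<le> v z" by (simp add: d_def)
qed

lemma gradient_in_subdiff:
  fixes G :: "'a::euclidean_space \<Rightarrow> real"
  assumes "convex_on UNIV G" "(G has_derivative (\<lambda>h. g \<bullet> h)) (at b)"
  shows "g \<in> subdiff G b"
  using subdiff_of_local_min[OF assms(1), of "\<lambda>z. - G z" "- g" b] assms(2)
  by (auto intro!: derivative_eq_intros)

text \<open>The sum rule for a summand differentiable at \<open>b\<close>. The substantial direction
  reads the subgradient inequality for \<open>w\<close> as minimality at \<open>b\<close>.\<close>

lemma subdiff_add_smooth:
  fixes v :: "'a::euclidean_space \<Rightarrow> real"
  assumes v: "convex_on UNIV v" and G: "convex_on UNIV G" "(G has_derivative (\<lambda>h. g \<bullet> h)) (at b)" and t: "0 \<le> t"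
  shows "w \<in> subdiff (\<lambda>x. v x + t * G x) b \<longleftrightarrow> w - t *\<^sub>R g \<in> subdiff v b"
proof
  assume w: "w \<in> subdiff (\<lambda>x. v x + t * G x) b"
  have "- (t *\<^sub>R g - w) \<in> subdiff v b"
  proof (rule subdiff_of_local_min[OF v, where G = "\<lambda>z. t * G z - w \<bullet> z"])
    show "((\<lambda>z. t * G z - w \<bullet> z) has_derivative (\<lambda>h. (t *\<^sub>R g - w) \<bullet> h)) (at b)"
      using G(2) by (auto intro!: derivative_eq_intros simp: inner_diff_left)
    show "\<forall>\<^sub>F z in nhds b. v b + (t * G b - w \<bullet> b) \<le> v z + (t * G z - w \<bullet> z)"
      using subdiffD[OF w] by (intro always_eventually) (simp add: inner_diff_right algebra_simps)
  qed
  then show "w - t *\<^sub>R g \<in> subdiff v b" by simp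
next
  assume w: "w - t *\<^sub>R g \<in> subdiff v b"
  show "w \<in> subdiff (\<lambda>x. v x + t * G x) b"
  proof (rule subdiffI)
    fix z
    have "G b + g \<bullet> (z - b) \<le> G z" using gradient_in_subdiff[OF G] by (rule subdiffD)
    then have "t * (G b + g \<bullet> (z - b)) \<le> t * G z" using t by (rule mult_left_mono)
    then show "v b + t * G b + w \<bullet> (z - b) \<le> v z + t * G z"
      using subdiffD[OF w, of z] by (simp add: inner_diff_left algebra_simps)
  qed
qed

lemma subdiff_monotone: "y1 \<in> subdiff v b1 \<Longrightarrow> y2 \<in> subdiff v b2 \<Longrightarrow> 0 \<le> (y1 - y2) \<bullet> (b1 - b2)"
  using subdiffD[of y1 v b1 b2] subdiffD[of y2 v b2 b1] by (simp add: inner_diff_left inner_diff_right)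

text \<open>Moving from \<open>z\<close> by one unit in the direction of a subgradient
  \<open>y\<close> raises \<open>v\<close> by at least \<open>norm y\<close>, and \<open>v\<close>
  is bounded on a slightly larger ball.\<close>

lemma subdiff_bounded_image:
  fixes v :: "'a::euclidean_space \<Rightarrow> real"
  assumes v: "convex_on UNIV v" and U: "bounded U"
  shows "bounded (\<Union>z\<in>U. subdiff v z)"
proof -
  obtain R where R: "\<And>z. z \<in> U \<Longrightarrow> norm z \<le> R" using U by (auto simp: bounded_iff)
  have "continuous_on UNIV v" using v by (intro convex_on_continuous) auto
  then have "compact (v ` cball 0 (R + 1))"
    by (intro compact_continuous_image) (auto intro: continuous_on_subset)
  then obtain K where "\<forall>x\<in>v ` cball 0 (R + 1). norm x \<le> K"
    using compact_imp_bounded[of "v ` cball 0 (R + 1)"] unfolding bounded_iff by blast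
  then have K: "\<And>z. norm z \<le> R + 1 \<Longrightarrow> \<bar>v z\<bar> \<le> K" by auto
  show ?thesis
  proof (rule boundedI[of _ "2 * K"])
    fix y assume "y \<in> (\<Union>z\<in>U. subdiff v z)"
    then obtain z where z: "z \<in> U" "y \<in> subdiff v z" by auto
    show "norm y \<le> 2 * K"
    proof (cases "y = 0")
      case True then show ?thesis using K[of z] R[OF z(1)] by simp
    next
      case False
      define z' where "z' = z + y /\<^sub>R norm y"
      have "norm z' \<le> R + 1" unfolding z'_def using R[OF z(1)] norm_triangle_ineq[of z "y /\<^sub>R norm y"] False by simp
      moreover have "v z + norm y \<le> v z'" using subdiffD[OF z(2), of z'] False
        by (simp add: z'_def dot_square_norm power2_eq_square mult.assoc[symmetric])
      ultimately show ?thesis using K[of z] K[of z'] R[OF z(1)] by (simp add: abs_le_iff)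
    qed
  qed
qed

text \<open>The point \<open>b\<close> minimises \<open>v + |. - p|^2 / 2\<close>. A minimiser
  exists because a convex function falls at most linearly away from \<open>p\<close>, at a rate read
  off on the unit ball around \<open>p\<close>.\<close>

lemma convex_proximal_point_exists:
  fixes v :: "'a::euclidean_space \<Rightarrow> real"
  assumes v: "convex_on UNIV v"
  shows "\<exists>b. p - b \<in> subdiff v b"
proof -
  have cont: "continuous_on A v" for A using v convex_on_continuous continuous_on_subset by blast
  have "cball p 1 \<noteq> {}" by simp
  from continuous_attains_inf[OF compact_cball this cont]
  obtain u0 where u0: "\<And>u. u \<in> cball p 1 \<Longrightarrow> v u0 \<le> v u" by blast
  define m where "m = v u0"
  have mp: "m \<le> v p" unfolding m_def by (rule u0) simp
  define \<phi> where "\<phi> z = v z + (norm (z - p))\<^sup>2 / 2" for z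
  \<comment> \<open>For \<open>r \<ge> R\<close> the linear loss \<open>r * (v p - m)\<close> stays
    below the quadratic gain \<open>r^2 / 2\<close>.\<close>
  define R where "R = 2 * (v p - m) + 1"
  have R1: "R \<ge> 1" using mp by (simp add: R_def)
  have far: "\<phi> p < \<phi> z" if z: "norm (z - p) \<ge> R" for z
  proof -
    define r where "r = norm (z - p)"
    have r: "r \<ge> 1" "r \<ge> R" using z R1 by (auto simp: r_def)
    define u where "u = (1 - 1/r) *\<^sub>R p + (1/r) *\<^sub>R z"
    have "u - p = (1/r) *\<^sub>R (z - p)" by (simp add: u_def algebra_simps)
    then have "norm (u - p) = 1" using r by (auto simp: r_def)
    then have "m \<le> v u" unfolding m_def using u0[of u] by (simp add: dist_norm norm_minus_commute)
    also have "v u \<le> (1 - 1/r) * v p + (1/r) * v z"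
      unfolding u_def using r by (intro convex_onD[OF v]) auto
    finally have "r * m \<le> r * ((1 - 1/r) * v p + (1/r) * v z)" using r by simp
    moreover have "r * (1 - 1/r) = r - 1" "r * (1/r) = 1" using r by (auto simp: field_simps)
    then have "r * ((1 - 1/r) * v p + (1/r) * v z) = (r - 1) * v p + v z"
      unfolding distrib_left mult.assoc[symmetric] by simp
    ultimately have "r * m \<le> (r - 1) * v p + v z" by simp
    then have "v p - r * (v p - m) \<le> v z" by (simp add: algebra_simps)
    moreover have "r * (v p - m) < r\<^sup>2 / 2"
    proof -
      have "v p - m < r / 2" using r by (simp add: R_def)
      then have "r * (v p - m) < r * (r/2)" using r by (intro mult_strict_left_mono) auto
      then show ?thesis by (simp add: power2_eq_square)
    qed
    ultimately show ?thesis by (simp add: \<phi>_def r_def[symmetric])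
  qed
  have "continuous_on (cball p R) \<phi>" unfolding \<phi>_def by (intro continuous_intros cont) simp
  then obtain b where b: "b \<in> cball p R" "\<And>z. z \<in> cball p R \<Longrightarrow> \<phi> b \<le> \<phi> z"
    using continuous_attains_inf[OF compact_cball, of p R \<phi>] R1 by auto
  have min: "\<phi> b \<le> \<phi> z" for z
  proof (cases "z \<in> cball p R")
    case True then show ?thesis by (rule b)
  next
    case False
    then have "\<phi> p < \<phi> z" by (intro far) (simp add: dist_norm norm_minus_commute)
    moreover have "\<phi> b \<le> \<phi> p" using R1 by (intro b) simp
    ultimately show ?thesis by simp
  qed
  have "- (b - p) \<in> subdiff v b"
  proof (rule subdiff_of_local_min[OF v, where G = "\<lambda>z. (norm (z - p))\<^sup>2 / 2"])
    show "((\<lambda>z. (norm (z - p))\<^sup>2 / 2) has_derivative (\<bullet>) (b - p)) (at b)"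
      unfolding power2_norm_eq_inner
      by (rule derivative_eq_intros refl | simp add: inner_commute fun_eq_iff)+
    show "\<forall>\<^sub>F z in nhds b. v b + (norm (b - p))\<^sup>2 / 2 \<le> v z + (norm (z - p))\<^sup>2 / 2"
      using min by (intro always_eventually) (simp add: \<phi>_def)
  qed
  then show ?thesis by auto
qed

section \<open>Symmetry of the derivative of a gradient\<close>

text \<open>The gradient is differentiable at the single point \<open>p\<close> only. The mean value
  theorem is therefore applied once, in direction \<open>a\<close>, and the resulting increment of
  the gradient in direction \<open>b\<close> is expanded at \<open>p\<close>.\<close>

lemma gradient_second_difference:
  fixes f :: "'a::euclidean_space \<Rightarrow> real"
  assumes f: "\<And>x. (f has_derivative (\<lambda>h. y x \<bullet> h)) (at x)"
    and y: "(y has_derivative N) (at p)" and e: "\<epsilon> > 0"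
  shows "\<exists>\<delta>>0. \<forall>s. 0 < s \<and> s < \<delta> \<longrightarrow>
     \<bar>f (p + s *\<^sub>R a + s *\<^sub>R b) - f (p + s *\<^sub>R a) - f (p + s *\<^sub>R b) + f p - s\<^sup>2 * (a \<bullet> N b)\<bar> \<le> \<epsilon> * s\<^sup>2"
proof -
  interpret N: bounded_linear N using y by (rule has_derivative_bounded_linear)
  define K where "K = norm a + norm b + 1"
  have K: "K > 0" by (simp add: K_def add_nonneg_pos)
  \<comment> \<open>Two remainders of size \<open>\<eta> * (s * K)\<close>, paired with
    \<open>a\<close> of norm at most \<open>K\<close>, add up to
    \<open>\<epsilon> * s\<close>.\<close>
  define \<eta> where "\<eta> = \<epsilon> / (2 * K * K)"
  have \<eta>: "\<eta> > 0" using e K by (simp add: \<eta>_def)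
  obtain d where d: "d > 0" "\<And>x. norm (x - p) < d \<Longrightarrow> norm (y x - y p - N (x - p)) \<le> \<eta> * norm (x - p)"
    using y \<eta> unfolding has_derivative_at_alt by blast
  show ?thesis
  proof (intro exI[of _ "d / K"] conjI allI impI)
    show "d / K > 0" using d K by simp
    fix s :: real assume "0 < s \<and> s < d / K"
    then have s: "0 < s" "s < d / K" by auto
    define \<phi> where "\<phi> \<tau> = f (p + \<tau> *\<^sub>R a + s *\<^sub>R b) - f (p + \<tau> *\<^sub>R a)" for \<tau>
    have der: "(\<phi> has_real_derivative (a \<bullet> (y (p + \<tau> *\<^sub>R a + s *\<^sub>R b) - y (p + \<tau> *\<^sub>R a)))) (at \<tau>)" for \<tau>
    proof -
      have "((\<lambda>\<tau>. f (p + \<tau> *\<^sub>R a + s *\<^sub>R b)) has_derivative (\<lambda>h. y (p + \<tau> *\<^sub>R a + s *\<^sub>R b) \<bullet> (h *\<^sub>R a))) (at \<tau>)"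
        by (rule has_derivative_compose[of "\<lambda>\<tau>. p + \<tau> *\<^sub>R a + s *\<^sub>R b" "\<lambda>h. h *\<^sub>R a" \<tau> UNIV f])
          (auto intro!: derivative_eq_intros f)
      moreover have "((\<lambda>\<tau>. f (p + \<tau> *\<^sub>R a)) has_derivative (\<lambda>h. y (p + \<tau> *\<^sub>R a) \<bullet> (h *\<^sub>R a))) (at \<tau>)"
        by (rule has_derivative_compose[of "\<lambda>\<tau>. p + \<tau> *\<^sub>R a" "\<lambda>h. h *\<^sub>R a" \<tau> UNIV f])
          (auto intro!: derivative_eq_intros f)
      ultimately have "(\<phi> has_derivative (\<lambda>h. y (p + \<tau> *\<^sub>R a + s *\<^sub>R b) \<bullet> (h *\<^sub>R a) - y (p + \<tau> *\<^sub>R a) \<bullet> (h *\<^sub>R a))) (at \<tau>)"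
        unfolding \<phi>_def by (rule has_derivative_diff)
      then show ?thesis
        unfolding has_field_derivative_def
        by (rule has_derivative_eq_rhs) (auto simp: inner_diff_right inner_commute algebra_simps)
    qed
    obtain \<tau> where \<tau>: "0 < \<tau>" "\<tau> < s" "\<phi> s - \<phi> 0 = (s - 0) * (a \<bullet> (y (p + \<tau> *\<^sub>R a + s *\<^sub>R b) - y (p + \<tau> *\<^sub>R a)))"
      using MVT2[OF s(1) der] by blast
    define r where "r x = y x - y p - N (x - p)" for x
    have small: "norm (r (p + z)) \<le> \<eta> * (s * K)" if "norm z \<le> s * (norm a + norm b)" for z
    proof -
      have "norm z \<le> s * K" using that s by (simp add: K_def algebra_simps)
      also have "s * K < d" using s K by (simp add: field_simps)
      finally have "norm (r (p + z)) \<le> \<eta> * norm z" using d(2)[of "p + z"] by (simp add: r_def)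
      also have "\<dots> \<le> \<eta> * (s * K)" using \<open>norm z \<le> s * K\<close> \<eta> by simp
      finally show ?thesis .
    qed
    have n1: "norm (\<tau> *\<^sub>R a + s *\<^sub>R b) \<le> s * (norm a + norm b)"
    proof -
      have "norm (\<tau> *\<^sub>R a + s *\<^sub>R b) \<le> \<tau> * norm a + s * norm b"
        using norm_triangle_ineq[of "\<tau> *\<^sub>R a" "s *\<^sub>R b"] \<tau> s by simp
      also have "\<dots> \<le> s * norm a + s * norm b" using \<tau> by (intro add_right_mono mult_right_mono) auto
      finally show ?thesis by (simp add: distrib_left)
    qed
    have n2: "norm (\<tau> *\<^sub>R a) \<le> s * (norm a + norm b)"
    proof -
      have "norm (\<tau> *\<^sub>R a) \<le> s * norm a" using \<tau> by (auto intro: mult_right_mono)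
      also have "\<dots> \<le> s * (norm a + norm b)" using s by (intro mult_left_mono) auto
      finally show ?thesis .
    qed
    have eq: "y (p + \<tau> *\<^sub>R a + s *\<^sub>R b) - y (p + \<tau> *\<^sub>R a) = s *\<^sub>R N b + (r (p + (\<tau> *\<^sub>R a + s *\<^sub>R b)) - r (p + \<tau> *\<^sub>R a))"
      by (simp add: r_def N.add N.scaleR add.assoc)
    have "\<bar>a \<bullet> (r (p + (\<tau> *\<^sub>R a + s *\<^sub>R b)) - r (p + \<tau> *\<^sub>R a))\<bar> \<le> norm a * norm (r (p + (\<tau> *\<^sub>R a + s *\<^sub>R b)) - r (p + \<tau> *\<^sub>R a))"
      by (rule Cauchy_Schwarz_ineq2)
    also have "\<dots> \<le> K * (2 * (\<eta> * (s * K)))"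
    proof (rule mult_mono)
      show "norm (r (p + (\<tau> *\<^sub>R a + s *\<^sub>R b)) - r (p + \<tau> *\<^sub>R a)) \<le> 2 * (\<eta> * (s * K))"
        using norm_triangle_ineq4[of "r (p + (\<tau> *\<^sub>R a + s *\<^sub>R b))" "r (p + \<tau> *\<^sub>R a)"] small[OF n1] small[OF n2] by linarith
    qed (use K in \<open>auto simp: K_def\<close>)
    also have "\<dots> = \<epsilon> * s" using K by (simp add: \<eta>_def)
    finally have bd: "\<bar>a \<bullet> (r (p + (\<tau> *\<^sub>R a + s *\<^sub>R b)) - r (p + \<tau> *\<^sub>R a))\<bar> \<le> \<epsilon> * s" .
    have "f (p + s *\<^sub>R a + s *\<^sub>R b) - f (p + s *\<^sub>R a) - f (p + s *\<^sub>R b) + f p = \<phi> s - \<phi> 0"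
      by (simp add: \<phi>_def)
    also have "\<dots> = s\<^sup>2 * (a \<bullet> N b) + s * (a \<bullet> (r (p + (\<tau> *\<^sub>R a + s *\<^sub>R b)) - r (p + \<tau> *\<^sub>R a)))"
      unfolding \<tau>(3) eq by (simp add: inner_add_right power2_eq_square algebra_simps)
    finally have "\<bar>f (p + s *\<^sub>R a + s *\<^sub>R b) - f (p + s *\<^sub>R a) - f (p + s *\<^sub>R b) + f p - s\<^sup>2 * (a \<bullet> N b)\<bar> =
      s * \<bar>a \<bullet> (r (p + (\<tau> *\<^sub>R a + s *\<^sub>R b)) - r (p + \<tau> *\<^sub>R a))\<bar>" using s by (simp add: abs_mult)
    also have "\<dots> \<le> s * (\<epsilon> * s)" using bd s by (intro mult_left_mono) auto
    finally show "\<bar>f (p + s *\<^sub>R a + s *\<^sub>R b) - f (p + s *\<^sub>R a) - f (p + s *\<^sub>R b) + f p - s\<^sup>2 * (a \<bullet> N b)\<bar> \<le> \<epsilon> * s\<^sup>2"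
      by (simp add: power2_eq_square mult_ac)
  qed
qed

text \<open>The second difference over a parallelogram does not depend on the order of its sides;
  its two expansions must agree.\<close>

lemma gradient_derivative_symmetric:
  fixes f :: "'a::euclidean_space \<Rightarrow> real"
  assumes f: "\<And>x. (f has_derivative (\<lambda>h. y x \<bullet> h)) (at x)" and y: "(y has_derivative N) (at p)"
  shows "a \<bullet> N b = b \<bullet> N a"
proof (rule ccontr)
  assume ne: "a \<bullet> N b \<noteq> b \<bullet> N a"
  define \<epsilon> where "\<epsilon> = \<bar>a \<bullet> N b - b \<bullet> N a\<bar> / 4"
  have \<epsilon>: "\<epsilon> > 0" using ne by (simp add: \<epsilon>_def)
  obtain d1 where d1: "d1 > 0" "\<And>s. 0 < s \<and> s < d1 \<Longrightarrow>
     \<bar>f (p + s *\<^sub>R a + s *\<^sub>R b) - f (p + s *\<^sub>R a) - f (p + s *\<^sub>R b) + f p - s\<^sup>2 * (a \<bullet> N b)\<bar> \<le> \<epsilon> * s\<^sup>2"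
    using gradient_second_difference[OF f y \<epsilon>, of a b] by blast
  obtain d2 where d2: "d2 > 0" "\<And>s. 0 < s \<and> s < d2 \<Longrightarrow>
     \<bar>f (p + s *\<^sub>R b + s *\<^sub>R a) - f (p + s *\<^sub>R b) - f (p + s *\<^sub>R a) + f p - s\<^sup>2 * (b \<bullet> N a)\<bar> \<le> \<epsilon> * s\<^sup>2"
    using gradient_second_difference[OF f y \<epsilon>, of b a] by blast
  define s where "s = min d1 d2 / 2"
  have s: "0 < s" "s < d1" "s < d2" using d1 d2 by (auto simp: s_def)
  have c: "p + s *\<^sub>R b + s *\<^sub>R a = p + s *\<^sub>R a + s *\<^sub>R b" by simp
  have "\<bar>s\<^sup>2 * (a \<bullet> N b) - s\<^sup>2 * (b \<bullet> N a)\<bar> \<le> 2 * (\<epsilon> * s\<^sup>2)"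
    using d1(2)[of s] d2(2)[of s] s unfolding c by (simp add: abs_le_iff)
  then have "s\<^sup>2 * \<bar>a \<bullet> N b - b \<bullet> N a\<bar> \<le> s\<^sup>2 * (2 * \<epsilon>)"
    unfolding right_diff_distrib[symmetric] abs_mult by (simp add: mult_ac)
  then have "\<bar>a \<bullet> N b - b \<bullet> N a\<bar> \<le> 2 * \<epsilon>" using s by simp
  then show False using \<epsilon> by (simp add: \<epsilon>_def)
qed

section \<open>The proximal map and the Moreau envelope\<close>

locale convex_fun =
  fixes v :: "'a::euclidean_space \<Rightarrow> real"
  assumes convex: "convex_on UNIV v"
begin

definition prox :: "'a \<Rightarrow> 'a" where "prox p = (SOME b. p - b \<in> subdiff v b)"

lemma prox_subdiff: "p - prox p \<in> subdiff v (prox p)"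
  unfolding prox_def by (rule someI_ex) (rule convex_proximal_point_exists[OF convex])

lemma prox_unique: "p - b \<in> subdiff v b \<Longrightarrow> prox p = b"
proof -
  assume "p - b \<in> subdiff v b"
  from subdiff_monotone[OF this prox_subdiff[of p]] have "0 \<le> - ((b - prox p) \<bullet> (b - prox p))"
    by (simp add: inner_diff_left inner_diff_right inner_commute)
  then have "b - prox p = 0" by (metis inner_ge_zero inner_eq_zero_iff neg_0_le_iff_le order_antisym)
  then show "prox p = b" by simp
qed

lemma prox_firm: "(prox p - prox q) \<bullet> (prox p - prox q) \<le> (prox p - prox q) \<bullet> (p - q)"
  using subdiff_monotone[OF prox_subdiff[of p] prox_subdiff[of q]]
  by (simp add: inner_diff_left inner_diff_right inner_commute algebra_simps)

lemma prox_nonexpansive: "norm (prox p - prox q) \<le> norm (p - q)"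
proof (cases "prox p = prox q")
  case False
  have "norm (prox p - prox q) * norm (prox p - prox q) \<le> norm (prox p - prox q) * norm (p - q)"
    using prox_firm[of p q] norm_cauchy_schwarz[of "prox p - prox q" "p - q"]
    by (simp add: dot_square_norm power2_eq_square)
  then show ?thesis using False by simp
qed simp

lemma prox_continuous: "continuous_on A prox"
proof -
  have "1-lipschitz_on A prox" using prox_nonexpansive by (auto simp: lipschitz_on_def dist_norm)
  then show ?thesis by (rule lipschitz_on_continuous_on)
qed

text \<open>The Moreau envelope of \<open>v\<close>. Its gradient is \<open>p - prox p\<close>,
  which makes the derivative of \<open>prox\<close> symmetric wherever it exists.\<close>

definition envelope :: "'a \<Rightarrow> real" where
  "envelope p = v (prox p) + (norm (prox p - p))\<^sup>2 / 2"

text \<open>The subgradient inequality at \<open>prox q\<close>, tested at \<open>prox p\<close>,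
  after completing squares; the discarded term is half the squared distance of the two proximal
  points.\<close>

lemma envelope_upper: "envelope q \<le> envelope p + (p - prox p) \<bullet> (q - p) + (norm (q - p))\<^sup>2 / 2"
proof -
  have "v (prox q) + (q - prox q) \<bullet> (prox p - prox q) \<le> v (prox p)" by (rule subdiffD[OF prox_subdiff])
  moreover have "0 \<le> (prox p - prox q) \<bullet> (prox p - prox q)" by simp
  ultimately have "v (prox q) + (q - prox q) \<bullet> (prox p - prox q) - (prox p - prox q) \<bullet> (prox p - prox q) / 2 \<le> v (prox p)"
    by linarith
  moreover have "(norm (prox q - q))\<^sup>2 / 2 = (norm (prox p - p))\<^sup>2 / 2 + (p - prox p) \<bullet> (q - p) + (norm (q - p))\<^sup>2 / 2
      + (q - prox q) \<bullet> (prox p - prox q) - (prox p - prox q) \<bullet> (prox p - prox q) / 2"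
    unfolding power2_norm_eq_inner
    by (simp add: inner_diff_left inner_diff_right inner_commute field_simps)
  ultimately show ?thesis unfolding envelope_def by linarith
qed

text \<open>The quadratic upper bounds for \<open>q\<close> around \<open>p\<close> and for
  \<open>p\<close> around \<open>q\<close>, together with the monotonicity of
  \<open>p - prox p\<close>, bound the remainder by \<open>|q - p|^2 / 2\<close>.\<close>

lemma envelope_has_derivative: "(envelope has_derivative (\<lambda>h. (p - prox p) \<bullet> h)) (at p)"
  unfolding has_derivative_at_alt
proof (intro conjI allI impI)
  show "bounded_linear ((\<bullet>) (p - prox p))" by (rule bounded_linear_inner_right)
  fix e :: real assume e: "0 < e"
  have main: "\<bar>envelope q - envelope p - (p - prox p) \<bullet> (q - p)\<bar> \<le> (norm (q - p))\<^sup>2 / 2" for q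
  proof -
    have "0 \<le> ((q - prox q) - (p - prox p)) \<bullet> (q - p)"
    proof -
      have "(prox q - prox p) \<bullet> (q - p) \<le> norm (prox q - prox p) * norm (q - p)" by (rule norm_cauchy_schwarz)
      also have "\<dots> \<le> norm (q - p) * norm (q - p)" by (intro mult_right_mono prox_nonexpansive) simp
      finally show ?thesis by (simp add: dot_square_norm[symmetric] power2_eq_square[symmetric])
          (simp add: inner_diff_left inner_diff_right)
    qed
    moreover have "(q - prox q) \<bullet> (p - q) = - ((q - prox q) \<bullet> (q - p))"
      by (metis inner_minus_right minus_diff_eq)
    ultimately have "(p - prox p) \<bullet> (q - p) \<le> - ((q - prox q) \<bullet> (p - q))" by (simp add: inner_diff_left)
    then show ?thesis using envelope_upper[of q p] envelope_upper[of p q, unfolded norm_minus_commute[of p q]]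
      unfolding abs_le_iff by linarith
  qed
  show "\<exists>d>0. \<forall>q. norm (q - p) < d \<longrightarrow> norm (envelope q - envelope p - (p - prox p) \<bullet> (q - p)) \<le> e * norm (q - p)"
  proof (intro exI[of _ e] conjI allI impI e)
    fix q assume q: "norm (q - p) < e"
    have "(norm (q - p))\<^sup>2 / 2 \<le> norm (q - p) * norm (q - p)" by (simp add: power2_eq_square)
    also have "\<dots> \<le> e * norm (q - p)" using q by (intro mult_right_mono) auto
    finally show "norm (envelope q - envelope p - (p - prox p) \<bullet> (q - p)) \<le> e * norm (q - p)"
      using main[of q] by simp
  qed
qed

lemma prox_derivative_selfadjoint:
  assumes M: "(prox has_derivative M) (at p)"
  shows "M a \<bullet> b = a \<bullet> M b"
proof -
  have "((\<lambda>p. p - prox p) has_derivative (\<lambda>h. h - M h)) (at p)"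
    using M by (auto intro!: derivative_eq_intros)
  from gradient_derivative_symmetric[OF envelope_has_derivative this, of a b]
  show ?thesis by (simp add: inner_diff_right inner_commute)
qed

lemma prox_derivative_firm:
  assumes M: "(prox has_derivative M) (at p)"
  shows "M a \<bullet> M a \<le> M a \<bullet> a"
proof -
  define D where "D s = (prox (p + s *\<^sub>R a) - prox p) /\<^sub>R s" for s
  have lim: "(D \<longlongrightarrow> M a) (at 0)" unfolding D_def by (rule has_derivative_directional[OF M])
  have "\<forall>\<^sub>F s in at 0. D s \<bullet> D s \<le> D s \<bullet> a"
    unfolding eventually_at_filter
  proof (rule always_eventually, intro allI impI)
    fix s :: real assume s: "s \<noteq> 0"
    have "(s *\<^sub>R D s) \<bullet> (s *\<^sub>R D s) \<le> (s *\<^sub>R D s) \<bullet> (s *\<^sub>R a)"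
      using prox_firm[of "p + s *\<^sub>R a" p] s by (simp add: D_def)
    then have "s\<^sup>2 * (D s \<bullet> D s) \<le> s\<^sup>2 * (D s \<bullet> a)" by (simp add: power2_eq_square mult_ac)
    then show "D s \<bullet> D s \<le> D s \<bullet> a" using s by simp
  qed
  then show ?thesis by (rule tendsto_le[OF _ _ _, rotated -1]) (auto intro!: tendsto_intros lim)
qed

end

section \<open>Area formula for perturbed subdifferentials\<close>

lemma has_integral_nonneg_pos_iff:
  fixes f :: "'a::euclidean_space \<Rightarrow> real"
  assumes f: "(f has_integral C) S" and nn: "\<And>x. x \<in> S \<Longrightarrow> 0 \<le> f x"
  shows "0 \<le> C" "0 < C \<longleftrightarrow> \<not> negligible {x\<in>S. f x \<noteq> 0}"
proof -
  show C: "0 \<le> C" using has_integral_nonneg[OF f nn] .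
  have "C = 0 \<longleftrightarrow> negligible {x\<in>S. f x \<noteq> 0}"
  proof
    assume neg: "negligible {x\<in>S. f x \<noteq> 0}"
    have "(f has_integral 0) S"
      by (rule has_integral_spike[OF neg _ has_integral_is_0]) auto
    then show "C = 0" using f has_integral_unique by blast
  next
    assume C0: "C = 0"
    have "f absolutely_integrable_on S"
      using f nn by (intro nonnegative_absolutely_integrable_1) auto
    then have int: "integrable lebesgue (\<lambda>x. indicator S x *\<^sub>R f x)" by (simp add: set_integrable_def)
    have "(\<integral>x. indicator S x *\<^sub>R f x \<partial>lebesgue) = C"
      using set_lebesgue_integral_eq_integral(2)[OF \<open>f absolutely_integrable_on S\<close>] f
      by (simp add: set_lebesgue_integral_def integral_unique)
    then have "AE x in lebesgue. indicator S x *\<^sub>R f x = 0"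
      using integral_nonneg_eq_0_iff_AE[OF int] nn C0 by (auto simp: indicator_def)
    then obtain N where "{x. \<not> indicator S x *\<^sub>R f x = 0} \<subseteq> N" "N \<in> null_sets lebesgue"
      by (auto elim!: AE_E simp: null_sets_def)
    then show "negligible {x\<in>S. f x \<noteq> 0}"
      by (intro negligible_subset[of N "{x\<in>S. f x \<noteq> 0}"]) (simp_all add: negligible_iff_null_sets indicator_def subset_iff)
  qed
  then show "0 < C \<longleftrightarrow> \<not> negligible {x\<in>S. f x \<noteq> 0}" using C by linarith
qed

text \<open>A common subgradient at both ends makes \<open>v + t G\<close> affine on the segment.
  Each summand stays above its own supporting affine function, and these add up to the one of the
  sum, so equality holds for both.\<close>

lemma affine_on_segment_of_common_slope:
  fixes v G :: "'a::euclidean_space \<Rightarrow> real"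
  assumes v: "convex_on UNIV v" and G: "convex_on UNIV G" and t: "t > 0"
    and w: "w \<in> subdiff (\<lambda>x. v x + t * G x) z1" "w \<in> subdiff (\<lambda>x. v x + t * G x) z2"
    and y: "y \<in> subdiff v z1" and g: "g \<in> subdiff G z1" and wyg: "w = y + t *\<^sub>R g"
    and s: "0 \<le> s" "s \<le> 1"
  shows "v (z1 + s *\<^sub>R (z2 - z1)) = v z1 + s * (y \<bullet> (z2 - z1))"
    "G (z1 + s *\<^sub>R (z2 - z1)) = G z1 + s * (g \<bullet> (z2 - z1))"
proof -
  define a where "a = z2 - z1"
  define zs where "zs = z1 + s *\<^sub>R a"
  have zs: "zs = (1 - s) *\<^sub>R z1 + s *\<^sub>R z2" by (simp add: zs_def a_def algebra_simps)
  have A: "v zs \<le> (1 - s) * v z1 + s * v z2" "G zs \<le> (1 - s) * G z1 + s * G z2"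
    unfolding zs using s by (auto intro: convex_onD[OF v] convex_onD[OF G])
  have "v z1 + t * G z1 + w \<bullet> a \<le> v z2 + t * G z2" "v z2 + t * G z2 - w \<bullet> a \<le> v z1 + t * G z1"
    using subdiffD[OF w(1), of z2] subdiffD[OF w(2), of z1]
    by (auto simp: a_def inner_diff_right)
  then have eq: "v z2 + t * G z2 = v z1 + t * G z1 + (y \<bullet> a + t * (g \<bullet> a))"
    by (simp add: wyg inner_add_left)
  have lo: "v z1 + s * (y \<bullet> a) \<le> v zs" "G z1 + s * (g \<bullet> a) \<le> G zs"
    using subdiffD[OF y, of zs] subdiffD[OF g, of zs] by (auto simp: zs_def)
  have "t * G zs \<le> t * ((1 - s) * G z1 + s * G z2)" using A t by simp
  then have "v zs + t * G zs \<le> (1 - s) * (v z1 + t * G z1) + s * (v z2 + t * G z2)"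
    using A(1) by (simp add: algebra_simps)
  then have "v zs + t * G zs \<le> v z1 + s * (y \<bullet> a) + t * (G z1 + s * (g \<bullet> a))"
    unfolding eq by (simp add: algebra_simps)
  moreover have "t * (G z1 + s * (g \<bullet> a)) \<le> t * G zs" using lo t by simp
  ultimately have "v zs = v z1 + s * (y \<bullet> a)" "t * G zs = t * (G z1 + s * (g \<bullet> a))"
    using lo by linarith+
  then show "v (z1 + s *\<^sub>R (z2 - z1)) = v z1 + s * (y \<bullet> (z2 - z1))"
    "G (z1 + s *\<^sub>R (z2 - z1)) = G z1 + s * (g \<bullet> (z2 - z1))"
    using t by (auto simp: zs_def a_def)
qed

text \<open>Fixes one choice of the weights, so that the coefficients of Jacobians and those of
  measures are formed by the same linear combination.\<close>

definition interp :: "nat \<Rightarrow> nat \<Rightarrow> nat \<Rightarrow> real" where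
  "interp n = (SOME lam. \<forall>c d. d \<le> n \<longrightarrow> c d = (\<Sum>i\<le>n. lam d i * (\<Sum>e\<le>n. c e * real (Suc i) ^ e)))"

lemma interp: "d \<le> n \<Longrightarrow> c d = (\<Sum>i\<le>n. interp n d i * (\<Sum>e\<le>n. c e * real (Suc i) ^ e))"
proof -
  have "\<exists>lam. \<forall>c d. d \<le> n \<longrightarrow> c d = (\<Sum>i\<le>n. lam d i * (\<Sum>e\<le>n. c e * real (Suc i) ^ e))"
    using interpolation_coefficients[of n] by metis
  from someI_ex[OF this] show "d \<le> n \<Longrightarrow> c d = (\<Sum>i\<le>n. interp n d i * (\<Sum>e\<le>n. c e * real (Suc i) ^ e))"
    unfolding interp_def[symmetric] by blast
qed

section \<open>The Jacobian of the perturbed subgradient map\<close>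

locale proximal_derivative = convex_fun v for v :: "real^'n::{finite,wellorder} \<Rightarrow> real"
begin

definition Dprox :: "real^'n::_ \<Rightarrow> real^'n::_ \<Rightarrow> real^'n::_" where "Dprox p = frechet_derivative prox (at p)"

lemma Dprox: "prox differentiable (at p) \<Longrightarrow> (prox has_derivative Dprox p) (at p)"
  unfolding Dprox_def by (simp add: frechet_derivative_works)

lemma Dprox_selfadjoint: "prox differentiable (at p) \<Longrightarrow> selfadjoint (Dprox p)"
  unfolding selfadjoint_def using Dprox has_derivative_linear prox_derivative_selfadjoint by blast

lemma Dprox_firm: "prox differentiable (at p) \<Longrightarrow> Dprox p a \<bullet> Dprox p a \<le> Dprox p a \<bullet> a"
  using prox_derivative_firm Dprox by blast

lemma negligible_not_differentiable: "negligible {p. \<not> prox differentiable (at p)}"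
  by (rule Rademacher[of prox 1]) (use prox_nonexpansive in auto)

definition regular_points :: "(real^'n::_) set \<Rightarrow> (real^'n::_) set" where
  "regular_points U = {p. prox differentiable (at p) \<and> prox p \<in> U}"

lemma sets_prox_vimage: "U \<in> sets borel \<Longrightarrow> prox -` U \<in> sets borel"
  using measurable_sets[OF borel_measurable_continuous_onI[OF prox_continuous], of U] by simp

lemma sets_regular_points: "U \<in> sets borel \<Longrightarrow> regular_points U \<in> sets lebesgue"
proof -
  assume U: "U \<in> sets borel"
  have "prox -` U \<in> sets lebesgue" using sets_prox_vimage[OF U] by auto
  moreover have "negligible ((prox -` U - regular_points U) \<union> (regular_points U - prox -` U))"
    by (rule negligible_subset[OF negligible_not_differentiable]) (auto simp: regular_points_def)
  ultimately show ?thesis by (rule sets_negligible_symdiff)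
qed

text \<open>Along a segment on which \<open>v\<close> is affine with slope
  \<open>p - prox p\<close>, this slope remains a subgradient, so \<open>prox\<close> translates
  together with \<open>p\<close>.\<close>

lemma Dprox_segment:
  assumes diff: "prox differentiable (at p)" and y: "p - prox p \<in> subdiff v (prox p)"
    and aff: "\<And>s. 0 \<le> s \<Longrightarrow> s \<le> 1 \<Longrightarrow> v (prox p + s *\<^sub>R a) = v (prox p) + s * ((p - prox p) \<bullet> a)"
  shows "Dprox p a = a"
proof -
  have px: "prox (p + s *\<^sub>R a) = prox p + s *\<^sub>R a" if s: "0 \<le> s" "s \<le> 1" for s
  proof (rule prox_unique, rule subdiffI)
    fix z
    have "v (prox p) + (p - prox p) \<bullet> (z - prox p) \<le> v z" by (rule subdiffD[OF y])
    then show "v (prox p + s *\<^sub>R a) + (p + s *\<^sub>R a - (prox p + s *\<^sub>R a)) \<bullet> (z - (prox p + s *\<^sub>R a)) \<le> v z"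
      unfolding aff[OF s] by (simp add: inner_diff_right inner_add_right algebra_simps)
  qed
  have lim: "((\<lambda>s. (prox (p + s *\<^sub>R a) - prox p) /\<^sub>R s) \<longlongrightarrow> Dprox p a) (at_right 0)"
    using has_derivative_directional[OF Dprox[OF diff], of a] by (rule filterlim_mono) (simp_all add: at_le)
  have "\<forall>\<^sub>F s in at_right (0::real). 0 < s \<and> s < 1"
    unfolding eventually_at_right_field by (intro exI[of _ 1]) auto
  then have "\<forall>\<^sub>F s in at_right 0. (prox (p + s *\<^sub>R a) - prox p) /\<^sub>R s = a"
    by eventually_elim (simp add: px)
  then have "((\<lambda>s. (prox (p + s *\<^sub>R a) - prox p) /\<^sub>R s) \<longlongrightarrow> a) (at_right 0)" by (rule tendsto_eventually)
  then show ?thesis using lim tendsto_unique by force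
qed

text \<open>With \<open>b = prox p\<close> and \<open>y = p - b\<close>, this is the subgradient
  \<open>y + t g(b)\<close> of \<open>v + t G\<close> at \<open>b\<close>, for \<open>g\<close> the
  gradient of \<open>G\<close>.\<close>

definition shift :: "(real^'n::_ \<Rightarrow> real^'n::_) \<Rightarrow> real \<Rightarrow> real^'n::_ \<Rightarrow> real^'n::_" where
  "shift g t p = p - prox p + t *\<^sub>R g (prox p)"

definition Dshift :: "(real^'n::_ \<Rightarrow> real^'n::_ \<Rightarrow> real^'n::_) \<Rightarrow> real \<Rightarrow> real^'n::_ \<Rightarrow> real^'n::_ \<Rightarrow> real^'n::_" where
  "Dshift H t p = (\<lambda>a. a - Dprox p a + t *\<^sub>R H (prox p) (Dprox p a))"

definition jac :: "(real^'n::_ \<Rightarrow> real^'n::_ \<Rightarrow> real^'n::_) \<Rightarrow> real \<Rightarrow> real^'n::_ \<Rightarrow> real" where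
  "jac H t p = det (matrix (Dshift H t p))"

lemma shift_derivative:
  assumes "prox differentiable (at p)" "(g has_derivative H (prox p)) (at (prox p))"
  shows "(shift g t has_derivative Dshift H t p) (at p)"
proof -
  have "((\<lambda>p. g (prox p)) has_derivative (\<lambda>a. H (prox p) (Dprox p a))) (at p)"
    using has_derivative_compose[OF Dprox[OF assms(1)] assms(2)] .
  then show ?thesis unfolding shift_def[abs_def] Dshift_def
    using Dprox[OF assms(1)] by (auto intro!: derivative_eq_intros)
qed

text \<open>Differentiability of \<open>g\<close> at \<open>prox p\<close> bounds its increments
  from that point; with \<open>prox\<close> nonexpansive, this local estimate is enough for null
  sets to have null images.\<close>

lemma negligible_shift_nondifferentiable:
  assumes "\<And>z. z \<in> U \<Longrightarrow> (g has_derivative H z) (at z)"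
  shows "negligible (shift g t ` (prox -` U - regular_points U))"
proof (rule negligible_locally_Lipschitz_image)
  show "negligible (prox -` U - regular_points U)"
    by (rule negligible_subset[OF negligible_not_differentiable]) (auto simp: regular_points_def)
  fix p assume "p \<in> prox -` U - regular_points U"
  then have U: "prox p \<in> U" by auto
  let ?z = "prox p"
  interpret bounded_linear "H ?z" using assms[OF U] by (rule has_derivative_bounded_linear)
  obtain K where K: "\<And>x. norm (H ?z x) \<le> norm x * K" "0 < K" using pos_bounded by blast
  obtain d where d: "d > 0" "\<And>z. norm (z - ?z) < d \<Longrightarrow> norm (g z - g ?z - H ?z (z - ?z)) \<le> 1 * norm (z - ?z)"
    using assms[OF U] unfolding has_derivative_at_alt by (metis zero_less_one)
  have gl: "norm (g z - g ?z) \<le> (1 + K) * norm (z - ?z)" if "norm (z - ?z) < d" for z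
  proof -
    have "norm (g z - g ?z) \<le> norm (g z - g ?z - H ?z (z - ?z)) + norm (H ?z (z - ?z))"
      by (metis diff_add_cancel norm_triangle_ineq)
    then show ?thesis using d(2)[OF that] K(1)[of "z - ?z"] by (simp add: algebra_simps)
  qed
  show "\<exists>T B. open T \<and> p \<in> T \<and> (\<forall>q \<in> (prox -` U - regular_points U) \<inter> T. norm (shift g t q - shift g t p) \<le> B * norm (q - p))"
  proof (intro exI[of _ "ball p d"] exI[of _ "2 + \<bar>t\<bar> * (1 + K)"] conjI ballI)
    fix q assume "q \<in> (prox -` U - regular_points U) \<inter> ball p d"
    then have q: "norm (q - p) < d" by (auto simp: dist_norm norm_minus_commute)
    have "norm (prox q - ?z) \<le> norm (q - p)" by (rule prox_nonexpansive)
    then have "norm (g (prox q) - g ?z) \<le> (1 + K) * norm (prox q - ?z)" using q by (intro gl) auto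
    also have "\<dots> \<le> (1 + K) * norm (q - p)" using K(2) prox_nonexpansive by (intro mult_left_mono) auto
    finally have g1: "norm (t *\<^sub>R (g (prox q) - g ?z)) \<le> \<bar>t\<bar> * ((1 + K) * norm (q - p))"
      by (auto intro: mult_left_mono)
    have "shift g t q - shift g t p = (q - p) - (prox q - ?z) + t *\<^sub>R (g (prox q) - g ?z)"
      by (simp add: shift_def scaleR_diff_right)
    then have "norm (shift g t q - shift g t p) \<le> norm (q - p) + norm (prox q - ?z) + norm (t *\<^sub>R (g (prox q) - g ?z))"
      using norm_triangle_ineq[of "(q - p) - (prox q - ?z)" "t *\<^sub>R (g (prox q) - g ?z)"]
        norm_triangle_ineq4[of "q - p" "prox q - ?z"] by simp
    then show "norm (shift g t q - shift g t p) \<le> (2 + \<bar>t\<bar> * (1 + K)) * norm (q - p)"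
      using g1 prox_nonexpansive[of q p] by (simp add: algebra_simps)
  qed (use d in auto)
qed simp

text \<open>Interpolation defines this for every \<open>p\<close>; where \<open>prox\<close> is
  differentiable and the Hessian is selfadjoint, it is the coefficient of \<open>t^d\<close> in the
  Jacobian.\<close>

definition jac_coeff :: "(real^'n::_ \<Rightarrow> real^'n::_ \<Rightarrow> real^'n::_) \<Rightarrow> nat \<Rightarrow> real^'n::_ \<Rightarrow> real" where
  "jac_coeff H d p = (\<Sum>i\<le>CARD('n). interp CARD('n) d i * jac H (real (Suc i)) p)"

text \<open>The frame \<open>f\<close> and the weights \<open>w\<close> belong to \<open>p\<close>
  alone, and the Hessian field \<open>H\<close> is quantified inside, so that one frame serves two
  Hessian fields at once.\<close>

definition jac_frame :: "('n \<Rightarrow> real^'n::_) \<Rightarrow> ('n set \<Rightarrow> real) \<Rightarrow> real^'n::_ \<Rightarrow> bool" where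
  "jac_frame f w p \<longleftrightarrow> orthonormal_family f \<and> (\<forall>S. 0 \<le> w S) \<and>
     (\<forall>S a. 0 < w S \<longrightarrow> Dprox p a = a \<longrightarrow> a \<in> span (f ` S)) \<and>
     (\<forall>H d. selfadjoint (H (prox p)) \<longrightarrow> d \<le> CARD('n) \<longrightarrow>
        jac_coeff H d p = (\<Sum>S | card S = d. w S * gram_minor f (H (prox p)) S)) \<and>
     (\<forall>H t. selfadjoint (H (prox p)) \<longrightarrow> jac H t p = (\<Sum>d\<le>CARD('n). jac_coeff H d p * t ^ d))"

lemma jac_frame_exists:
  assumes diff: "prox differentiable (at p)"
  shows "\<exists>f w. jac_frame f w p"
proof -
  obtain f :: "'n \<Rightarrow> real^'n::_" and w where f: "orthonormal_family f"
    "\<And>S. 0 \<le> w S" "\<And>S a. 0 < w S \<Longrightarrow> Dprox p a = a \<Longrightarrow> a \<in> span (f ` S)"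
    "\<And>H t. selfadjoint H \<Longrightarrow> det (matrix (\<lambda>a. a - Dprox p a + t *\<^sub>R H (Dprox p a))) =
       (\<Sum>d\<le>CARD('n). (\<Sum>S | card S = d. w S * gram_minor f H S) * t ^ d)"
    by (rule resolvent_det_expansion[OF Dprox_selfadjoint[OF diff] Dprox_firm[OF diff]]) (rule that; assumption)
  have coeff: "jac_coeff H d p = (\<Sum>S | card S = d. w S * gram_minor f (H (prox p)) S)"
    if "selfadjoint (H (prox p))" "d \<le> CARD('n)" for H d
    unfolding jac_coeff_def jac_def Dshift_def f(4)[OF that(1)]
    by (rule interp[OF that(2), symmetric])
  have "jac H t p = (\<Sum>d\<le>CARD('n). jac_coeff H d p * t ^ d)" if "selfadjoint (H (prox p))" for H t
    unfolding jac_def Dshift_def f(4)[OF that] by (intro sum.cong) (auto simp: coeff[where H = H, OF that])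
  with f(1-3) coeff show ?thesis unfolding jac_frame_def by blast
qed

lemma jac_frameD:
  assumes "jac_frame f w p"
  shows "orthonormal_family f" "0 \<le> w S" "0 < w S \<Longrightarrow> Dprox p a = a \<Longrightarrow> a \<in> span (f ` S)"
    "selfadjoint (H (prox p)) \<Longrightarrow> d \<le> CARD('n) \<Longrightarrow>
        jac_coeff H d p = (\<Sum>S | card S = d. w S * gram_minor f (H (prox p)) S)"
    "selfadjoint (H (prox p)) \<Longrightarrow> jac H t p = (\<Sum>d\<le>CARD('n). jac_coeff H d p * t ^ d)"
  using assms unfolding jac_frame_def by blast+

end

text \<open>\<open>G\<close> is convex everywhere but smooth only on \<open>\<Omega>\<close>, which
  leaves room for the kink of the norm.\<close>

locale smooth_perturbation = proximal_derivative v for v :: "real^'n::{finite,wellorder} \<Rightarrow> real" +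
  fixes G :: "real^'n::_ \<Rightarrow> real" and g :: "real^'n::_ \<Rightarrow> real^'n::_" and H :: "real^'n::_ \<Rightarrow> real^'n::_ \<Rightarrow> real^'n::_"
    and \<Omega> U :: "(real^'n::_) set"
  assumes G: "convex_on UNIV G" and \<Omega>: "open \<Omega>" "U \<subseteq> \<Omega>" and U: "U \<in> sets borel" "bounded U"
    and g: "\<And>z. z \<in> \<Omega> \<Longrightarrow> (G has_derivative (\<lambda>h. g z \<bullet> h)) (at z)"
    and H: "\<And>z. z \<in> \<Omega> \<Longrightarrow> (g has_derivative H z) (at z)"
    and H_selfadjoint: "\<And>z. z \<in> \<Omega> \<Longrightarrow> selfadjoint (H z)"
    and H_psd: "\<And>z a. z \<in> \<Omega> \<Longrightarrow> 0 \<le> a \<bullet> H z a"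
begin

lemma jac_coeff_nonneg: "p \<in> regular_points U \<Longrightarrow> d \<le> CARD('n) \<Longrightarrow> 0 \<le> jac_coeff H d p"
proof -
  assume p: "p \<in> regular_points U" "d \<le> CARD('n)"
  then have diff: "prox differentiable (at p)" and O: "prox p \<in> \<Omega>" using \<Omega> by (auto simp: regular_points_def)
  obtain f w where f: "jac_frame f w p" using jac_frame_exists[OF diff] by blast
  then show ?thesis unfolding jac_frameD(4)[OF f, of H, OF H_selfadjoint[OF O] p(2)]
    using jac_frameD(2)[OF f] gram_minor_nonneg[OF selfadjointD(1)[OF H_selfadjoint[OF O]] H_psd[OF O]]
    by (auto intro!: sum_nonneg mult_nonneg_nonneg)
qed

lemma jac_nonneg: "p \<in> regular_points U \<Longrightarrow> 0 \<le> t \<Longrightarrow> 0 \<le> jac H t p"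
proof -
  assume p: "p \<in> regular_points U" "0 \<le> t"
  then have diff: "prox differentiable (at p)" and O: "prox p \<in> \<Omega>" using \<Omega> by (auto simp: regular_points_def)
  have "jac H t p = (\<Sum>d\<le>CARD('n). jac_coeff H d p * t ^ d)"
    using jac_frame_exists[OF diff] jac_frameD(5) H_selfadjoint[OF O] by blast
  then show ?thesis using p jac_coeff_nonneg by (auto intro!: sum_nonneg mult_nonneg_nonneg)
qed

lemma image_shift:
  assumes "0 \<le> t"
  shows "(\<Union>z\<in>U. subdiff (\<lambda>x. v x + t * G x) z) = shift g t ` (prox -` U)"
proof (intro equalityI subsetI)
  fix w assume "w \<in> (\<Union>z\<in>U. subdiff (\<lambda>x. v x + t * G x) z)"
  then obtain z where z: "z \<in> U" "w \<in> subdiff (\<lambda>x. v x + t * G x) z" by auto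
  then have y: "w - t *\<^sub>R g z \<in> subdiff v z"
    using subdiff_add_smooth[OF convex G g assms] \<Omega> by blast
  define p where "p = z + (w - t *\<^sub>R g z)"
  have "prox p = z" using y by (intro prox_unique) (simp add: p_def)
  then show "w \<in> shift g t ` (prox -` U)" using z
    by (intro image_eqI[of _ _ p]) (auto simp: shift_def p_def)
next
  fix w assume "w \<in> shift g t ` (prox -` U)"
  then obtain p where p: "prox p \<in> U" "w = shift g t p" by auto
  then have "w - t *\<^sub>R g (prox p) \<in> subdiff v (prox p)" using prox_subdiff[of p] by (simp add: shift_def)
  then have "w \<in> subdiff (\<lambda>x. v x + t * G x) (prox p)"
    using subdiff_add_smooth[OF convex G g assms, of "prox p"] p \<Omega> by blast
  then show "w \<in> (\<Union>z\<in>U. subdiff (\<lambda>x. v x + t * G x) z)" using p by blast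
qed

text \<open>A second point \<open>z'\<close> with the same slope makes \<open>v\<close> and
  \<open>G\<close> affine along \<open>a = z' - z\<close>. Then \<open>Dprox p a = a\<close> and
  \<open>H z a = 0\<close>, so the Jacobian kills \<open>a\<close>. This is the source of
  injectivity off the critical set.\<close>

lemma jac_zero_if_not_unique:
  assumes p: "p \<in> regular_points U" and t: "t > 0" and w: "shift g t p \<in> subdiff (\<lambda>x. v x + t * G x) z'" and ne: "z' \<noteq> prox p"
  shows "jac H t p = 0"
proof -
  define z a y where "z = prox p" and "a = z' - z" and "y = p - prox p"
  have diff: "prox differentiable (at p)" and zU: "z \<in> U" and O: "z \<in> \<Omega>" using p \<Omega> by (auto simp: regular_points_def z_def)
  have y: "y \<in> subdiff v z" unfolding y_def z_def by (rule prox_subdiff)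
  have gz: "g z \<in> subdiff G z" by (rule gradient_in_subdiff[OF G g[OF O]])
  have weq: "shift g t p = y + t *\<^sub>R g z" by (simp add: shift_def y_def z_def)
  have wz: "shift g t p \<in> subdiff (\<lambda>x. v x + t * G x) z"
    using subdiff_add_smooth[OF convex G g[OF O], of t "shift g t p"] t y by (simp add: weq)
  note seg = affine_on_segment_of_common_slope[OF convex G t wz w y gz weq, folded a_def]
  have Ma: "Dprox p a = a"
    by (rule Dprox_segment[OF diff prox_subdiff]) (use seg(1) in \<open>auto simp: y_def z_def\<close>)
  have lim: "((\<lambda>s. (g (z + s *\<^sub>R a) - g z) /\<^sub>R s) \<longlongrightarrow> H z a) (at_right 0)"
    using has_derivative_directional[OF H[OF O], of a] by (rule filterlim_mono) (simp_all add: at_le)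
  then have lim2: "((\<lambda>s. a \<bullet> ((g (z + s *\<^sub>R a) - g z) /\<^sub>R s)) \<longlongrightarrow> a \<bullet> H z a) (at_right 0)"
    by (intro tendsto_intros)
  have "((\<lambda>s. z + s *\<^sub>R a) \<longlongrightarrow> z + 0 *\<^sub>R a) (at_right 0)" by (intro tendsto_intros)
  then have "\<forall>\<^sub>F s in at_right 0. z + s *\<^sub>R a \<in> \<Omega>"
    using topological_tendstoD \<Omega>(1) O by fastforce
  moreover have "\<forall>\<^sub>F s in at_right (0::real). 0 < s \<and> s < 1"
    unfolding eventually_at_right_field by (intro exI[of _ 1]) auto
  \<comment> \<open>Along a segment on which \<open>G\<close> is affine, the supporting inequalities
    towards both ends force the gradient to have constant pairing with \<open>a\<close>.\<close>
  ultimately have "\<forall>\<^sub>F s in at_right 0. a \<bullet> ((g (z + s *\<^sub>R a) - g z) /\<^sub>R s) = 0"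
  proof eventually_elim
    case (elim s)
    let ?zs = "z + s *\<^sub>R a"
    have gs: "g ?zs \<in> subdiff G ?zs" by (rule gradient_in_subdiff[OF G g[OF elim(1)]])
    have Gs: "G ?zs = G z + s * (g z \<bullet> a)" "G (z + a) = G z + g z \<bullet> a"
      using seg(2)[of s] seg(2)[of 1] elim by auto
    have "G ?zs - s * (g ?zs \<bullet> a) \<le> G z" using subdiffD[OF gs, of z] by simp
    then have "s * (g z \<bullet> a) \<le> s * (g ?zs \<bullet> a)" using Gs by simp
    then have 1: "g z \<bullet> a \<le> g ?zs \<bullet> a" using elim by simp
    have "z + a - ?zs = (1 - s) *\<^sub>R a" by (simp add: algebra_simps)
    then have "G ?zs + (1 - s) * (g ?zs \<bullet> a) \<le> G (z + a)" using subdiffD[OF gs, of "z + a"] by simp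
    then have "(1 - s) * (g ?zs \<bullet> a) \<le> (1 - s) * (g z \<bullet> a)" using Gs by (simp add: algebra_simps)
    then have "g ?zs \<bullet> a \<le> g z \<bullet> a" using elim by simp
    with 1 show ?case by (simp add: inner_diff_right inner_commute)
  qed
  then have "((\<lambda>s. a \<bullet> ((g (z + s *\<^sub>R a) - g z) /\<^sub>R s)) \<longlongrightarrow> 0) (at_right 0)" by (rule tendsto_eventually)
  then have "a \<bullet> H z a = 0" using lim2 tendsto_unique by force
  then have Ha: "H z a = 0" using selfadjoint_psd_kernel[OF H_selfadjoint[OF O] H_psd[OF O]] by blast
  have "Dshift H t p a = 0" unfolding Dshift_def Ma using Ha by (simp add: z_def)
  moreover have lin: "linear (Dshift H t p)"
    using has_derivative_linear[OF shift_derivative[where H = H, OF diff H[OF O[unfolded z_def]]]] .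
  moreover have "a \<noteq> 0" using ne by (simp add: a_def z_def)
  ultimately have "\<not> inj (Dshift H t p)" using linear_injective_0 by blast
  then show ?thesis using det_nz_iff_inj[OF lin] by (simp add: jac_def)
qed

lemma shift_has_derivative: "p \<in> regular_points U \<Longrightarrow> (shift g t has_derivative Dshift H t p) (at p within S)"
  by (rule has_derivative_at_withinI, rule shift_derivative, simp add: regular_points_def, rule H) (use \<Omega> in \<open>auto simp: regular_points_def\<close>)

lemma negligible_image_jac_zero: "negligible (shift g t ` {p \<in> regular_points U. jac H t p = 0})"
proof (rule baby_Sard[where f' = "Dshift H t"])
  fix p assume p: "p \<in> {p \<in> regular_points U. jac H t p = 0}"
  show "(shift g t has_derivative Dshift H t p) (at p within {p \<in> regular_points U. jac H t p = 0})"
    using p shift_has_derivative by blast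
  show "rank (matrix (Dshift H t p)) < CARD('n)" using p by (simp add: jac_def det_eq_0_rank)
qed simp

text \<open>The image splits into that of \<open>S1\<close>, where the Jacobian is nonzero and the
  map therefore injective, and two null pieces: the critical values, by Sard's theorem, and the
  image of the points without derivative. The change of variables formula is applied on
  \<open>S1\<close>.\<close>

lemma
  assumes t: "t > 0"
  shows jac_has_integral: "(jac H t has_integral MA (\<lambda>x. v x + t * G x) U) (regular_points U)"
    and lmeasurable_subdiff_image: "(\<Union>z\<in>U. subdiff (\<lambda>x. v x + t * G x) z) \<in> lmeasurable"
proof -
  define S1 where "S1 = {p \<in> regular_points U. jac H t p \<noteq> 0}"
  have "jac H t \<in> borel_measurable (lebesgue_on (regular_points U))"
    unfolding jac_def[abs_def] by (rule borel_measurable_det_Jacobian[OF sets_regular_points[OF U(1)] shift_has_derivative])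
  then have "\<forall>T. T \<in> sets borel \<longrightarrow> {p \<in> regular_points U. jac H t p \<in> T} \<in> sets lebesgue"
    by (rule borel_measurable_lebesgue_on_preimage_borel[OF sets_regular_points[OF U(1)], THEN iffD1])
  then have "{p \<in> regular_points U. jac H t p \<in> - {0}} \<in> sets lebesgue" by (rule allE[of _ "- {0}"]) simp
  then have S1: "S1 \<in> sets lebesgue" by (simp add: S1_def)
  have split: "shift g t ` (prox -` U) = shift g t ` S1 \<union> (shift g t ` {p \<in> regular_points U. jac H t p = 0} \<union> shift g t ` (prox -` U - regular_points U))"
    by (auto simp: S1_def regular_points_def)
  have neg: "negligible (shift g t ` {p \<in> regular_points U. jac H t p = 0} \<union> shift g t ` (prox -` U - regular_points U))"
    using negligible_image_jac_zero negligible_shift_nondifferentiable[of U g H t] H \<Omega> by (auto simp: negligible_Un_eq)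
  have inj: "inj_on (shift g t) S1"
  proof (rule inj_onI)
    fix p q assume pq: "p \<in> S1" "q \<in> S1" "shift g t p = shift g t q"
    show "p = q"
    proof (cases "prox p = prox q")
      case True then show ?thesis using pq(3) by (simp add: shift_def)
    next
      case False
      have q: "prox q \<in> \<Omega>" using pq(2) \<Omega> by (auto simp: S1_def regular_points_def)
      have "shift g t q \<in> subdiff (\<lambda>x. v x + t * G x) (prox q)"
        using subdiff_add_smooth[OF convex G g[OF q], of t "shift g t q"] t prox_subdiff[of q] by (simp add: shift_def)
      then have "jac H t p = 0" using jac_zero_if_not_unique[of p t "prox q"] pq t False by (auto simp: S1_def)
      then show ?thesis using pq by (simp add: S1_def)
    qed
  qed
  have der: "(shift g t has_derivative Dshift H t p) (at p within S1)" if "p \<in> S1" for p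
    using that shift_has_derivative by (auto simp: S1_def)
  have bd: "bounded (shift g t ` (prox -` U))"
    unfolding image_shift[OF less_imp_le[OF t], symmetric]
    by (intro subdiff_bounded_image U(2) convex_on_add convex convex_on_cmul G) (use t in auto)
  have "shift g t ` S1 \<in> lmeasurable"
  proof (rule bounded_set_imp_lmeasurable)
    show "bounded (shift g t ` S1)" using bd by (rule bounded_subset) (auto simp: split)
    show "shift g t ` S1 \<in> sets lebesgue"
      by (rule differentiable_image_in_sets_lebesgue[OF S1]) (use der in \<open>auto simp: differentiable_on_def differentiable_def\<close>)
  qed
  then have int: "((\<lambda>p. \<bar>jac H t p\<bar>) has_integral measure lebesgue (shift g t ` S1)) S1"
    using has_measure_differentiable_image[OF S1 der inj, of "measure lebesgue (shift g t ` S1)"] by (simp add: jac_def)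
  have sym: "negligible (shift g t ` S1 - shift g t ` (prox -` U) \<union> (shift g t ` (prox -` U) - shift g t ` S1))"
    by (rule negligible_subset[OF neg]) (auto simp: split)
  show "(\<Union>z\<in>U. subdiff (\<lambda>x. v x + t * G x) z) \<in> lmeasurable"
    unfolding image_shift[OF less_imp_le[OF t]]
    by (rule lmeasurable_negligible_symdiff[OF \<open>shift g t ` S1 \<in> lmeasurable\<close> sym])
  have "MA (\<lambda>x. v x + t * G x) U = measure lebesgue (shift g t ` S1)"
    unfolding MA_def image_shift[OF less_imp_le[OF t]]
    by (rule measure_negligible_symdiff[OF \<open>shift g t ` S1 \<in> lmeasurable\<close> sym])
  with int have "((\<lambda>p. if p \<in> S1 then \<bar>jac H t p\<bar> else 0) has_integral MA (\<lambda>x. v x + t * G x) U) (regular_points U)"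
    by (subst has_integral_restrict) (auto simp: S1_def)
  then show "(jac H t has_integral MA (\<lambda>x. v x + t * G x) U) (regular_points U)"
    by (rule has_integral_eq[rotated]) (use jac_nonneg t in \<open>auto simp: S1_def\<close>)
qed

text \<open>Lets the measures of subgradient images of disjoint sets be added: slopes that also
  belong to another point come from critical or nondifferentiable \<open>p\<close>.\<close>

lemma negligible_not_unique:
  assumes t: "t > 0"
  shows "negligible {w. \<exists>z\<in>U. \<exists>z'. z' \<noteq> z \<and> w \<in> subdiff (\<lambda>x. v x + t * G x) z \<and> w \<in> subdiff (\<lambda>x. v x + t * G x) z'}"
proof (rule negligible_subset)
  show "negligible (shift g t ` {p \<in> regular_points U. jac H t p = 0} \<union> shift g t ` (prox -` U - regular_points U))"
    using negligible_image_jac_zero negligible_shift_nondifferentiable[of U g H t] H \<Omega> by (auto simp: negligible_Un_eq)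
  show "{w. \<exists>z\<in>U. \<exists>z'. z' \<noteq> z \<and> w \<in> subdiff (\<lambda>x. v x + t * G x) z \<and> w \<in> subdiff (\<lambda>x. v x + t * G x) z'} \<subseteq>
    shift g t ` {p \<in> regular_points U. jac H t p = 0} \<union> shift g t ` (prox -` U - regular_points U)"
  proof clarify
    fix w z z' assume z: "z \<in> U" "z' \<noteq> z" "w \<in> subdiff (\<lambda>x. v x + t * G x) z" "w \<in> subdiff (\<lambda>x. v x + t * G x) z'"
      and notin: "w \<notin> shift g t ` (prox -` U - regular_points U)"
    have y: "w - t *\<^sub>R g z \<in> subdiff v z"
      using subdiff_add_smooth[OF convex G g, of z t w] \<Omega> z t by auto
    define p where "p = z + (w - t *\<^sub>R g z)"
    have pz: "prox p = z" using y by (intro prox_unique) (simp add: p_def)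
    have w: "w = shift g t p" using pz by (simp add: shift_def p_def)
    have "p \<in> regular_points U" using notin w pz z by auto
    moreover from this have "jac H t p = 0" using jac_zero_if_not_unique[of p t z'] t z w pz by auto
    ultimately show "w \<in> shift g t ` {p \<in> regular_points U. jac H t p = 0}" using w by auto
  qed
qed

text \<open>The weights of \<open>jac_coeff\<close> applied to the measures, so that this is the
  integral of \<open>jac_coeff\<close>.\<close>

definition MA_coeff :: "nat \<Rightarrow> real" where
  "MA_coeff d = (\<Sum>i\<le>CARD('n). interp CARD('n) d i * MA (\<lambda>x. v x + real (Suc i) * G x) U)"

lemma jac_coeff_has_integral: "(jac_coeff H d has_integral MA_coeff d) (regular_points U)"
  unfolding jac_coeff_def[abs_def] MA_coeff_def
  by (intro has_integral_sum has_integral_mult_right jac_has_integral) auto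

lemma MA_coeff:
  assumes "d \<le> CARD('n)"
  shows "0 \<le> MA_coeff d" "0 < MA_coeff d \<longleftrightarrow> \<not> negligible {p \<in> regular_points U. jac_coeff H d p \<noteq> 0}"
  using has_integral_nonneg_pos_iff[OF jac_coeff_has_integral jac_coeff_nonneg] assms by blast+

end

section \<open>Touching sets and positivity of coefficients\<close>

text \<open>A grid in \<open>W\<close> with spacing of order \<open>1 / t\<close> is mapped by
  \<open>t * q\<close> to points at distance at least \<open>2 * \<delta>\<close>; counting the
  disjoint balls around them gives a volume of order \<open>t ^ dim W\<close>.\<close>

lemma lattice_packing_volume:
  fixes q :: "'a::euclidean_space \<Rightarrow> 'a" and W :: "'a set"
  assumes W: "subspace W" and r: "r > 0" and \<delta>: "\<delta> > 0" and \<kappa>: "\<kappa> > 0"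
    and sep: "\<And>\<omega> \<omega>'. \<omega> \<in> W \<Longrightarrow> \<omega>' \<in> W \<Longrightarrow> norm \<omega> < r \<Longrightarrow> norm \<omega>' < r \<Longrightarrow> \<kappa> * norm (\<omega> - \<omega>') \<le> norm (q \<omega> - q \<omega>')"
  obtains c t1 where "c > 0" "\<And>t T. t \<ge> t1 \<Longrightarrow> T \<in> lmeasurable \<Longrightarrow>
     (\<And>\<omega>. \<omega> \<in> W \<Longrightarrow> norm \<omega> < r \<Longrightarrow> ball (y + t *\<^sub>R q \<omega>) \<delta> \<subseteq> T) \<Longrightarrow> c * t ^ dim W \<le> measure lebesgue T"
proof -
  obtain Bs where Bs: "Bs \<subseteq> W" "pairwise orthogonal Bs" "\<And>x. x \<in> Bs \<Longrightarrow> norm x = 1" "independent Bs" "card Bs = dim W" "span Bs = W"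
    using orthonormal_basis_subspace[OF W] by metis
  have fin: "finite Bs" using Bs(4) independent_imp_finite by blast
  define m where "m = dim W"
  define M where "M = real m + 1"
  have M: "M > 0" by (simp add: M_def)
  \<comment> \<open>Makes \<open>r / (\<tau> * M)\<close> equal to \<open>2 * (\<eta> * t)\<close>;
    with that many grid steps in each of the \<open>m < M\<close> directions, the grid stays inside
    radius \<open>r\<close>.\<close>
  define \<eta> where "\<eta> = r * \<kappa> / (4 * \<delta> * M)"
  have \<eta>: "\<eta> > 0" using r \<kappa> \<delta> M by (simp add: \<eta>_def)
  define V where "V = measure lebesgue (ball (0::'a) \<delta>)"
  have V: "V > 0" unfolding V_def using \<delta> by (simp add: content_ball_pos)
  show ?thesis
  proof (rule that[of "\<eta> ^ m * V" "1 / \<eta>"])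
    show "0 < \<eta> ^ m * V" using \<eta> V by simp
    fix t T assume t: "1 / \<eta> \<le> t" and T: "T \<in> lmeasurable"
      and sub: "\<And>\<omega>. \<omega> \<in> W \<Longrightarrow> norm \<omega> < r \<Longrightarrow> ball (y + t *\<^sub>R q \<omega>) \<delta> \<subseteq> T"
    have tp: "t > 0" using t \<eta> by (smt (verit) divide_pos_pos)
    have \<eta>t: "1 \<le> \<eta> * t" using t \<eta> by (simp add: field_simps)
    \<comment> \<open>The smallest spacing for which the separation constant \<open>\<kappa>\<close>
      keeps the images \<open>2 * \<delta>\<close> apart.\<close>
    define \<tau> where "\<tau> = 2 * \<delta> / (\<kappa> * t)"
    have \<tau>: "\<tau> > 0" using \<delta> \<kappa> tp by (simp add: \<tau>_def)
    have quot: "r / (\<tau> * M) = 2 * (\<eta> * t)"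
      using \<delta> \<kappa> tp M by (simp add: \<tau>_def \<eta>_def field_simps)
    \<comment> \<open>The factor 2 absorbs the rounding: \<open>\<eta> * t \<le> N\<close> since
      \<open>\<eta> * t \<ge> 1\<close>.\<close>
    define N where "N = nat \<lfloor>2 * (\<eta> * t)\<rfloor>"
    have N1: "real N \<le> 2 * (\<eta> * t)" and N2: "\<eta> * t \<le> real N"
      using \<eta>t unfolding N_def by linarith+
    define \<omega> where "\<omega> k = \<tau> *\<^sub>R (\<Sum>i\<in>Bs. real (k i) *\<^sub>R i)" for k :: "'a \<Rightarrow> nat"
    define I where "I = Bs \<rightarrow>\<^sub>E {..<N}"
    have finI: "finite I" unfolding I_def using fin by (intro finite_PiE) auto
    have cardI: "card I = N ^ m" unfolding I_def m_def using fin Bs(5) by (simp add: card_PiE)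
    have \<omega>W: "\<omega> k \<in> W" for k unfolding \<omega>_def
      using Bs(1) W by (intro subspace_scale subspace_sum) auto
    have \<omega>r: "norm (\<omega> k) < r" if "k \<in> I" for k
    proof -
      have "norm (\<Sum>i\<in>Bs. real (k i) *\<^sub>R i) \<le> (\<Sum>i\<in>Bs. norm (real (k i) *\<^sub>R i))" by (rule norm_sum)
      also have "\<dots> \<le> (\<Sum>i\<in>Bs. real N)"
        using that Bs(3) by (intro sum_mono) (auto simp: I_def PiE_def Pi_def less_imp_le)
      also have "\<dots> = real m * real N" using Bs(5) by (simp add: m_def)
      finally have "norm (\<omega> k) \<le> \<tau> * (real m * real N)" using \<tau> by (simp add: \<omega>_def)
      also have "\<dots> \<le> \<tau> * (real m * (2 * (\<eta> * t)))" using N1 \<tau> by (intro mult_left_mono) auto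
      also have "\<dots> = \<tau> * (real m * (r / (\<tau> * M)))" by (simp only: quot)
      also have "\<dots> = r * (real m / M)" using \<tau> M by (simp add: field_simps)
      also have "\<dots> < r" using r by (simp add: M_def field_simps)
      finally show ?thesis .
    qed
    have disj: "ball (y + t *\<^sub>R q (\<omega> k)) \<delta> \<inter> ball (y + t *\<^sub>R q (\<omega> k')) \<delta> = {}" if kk: "k \<in> I" "k' \<in> I" "k \<noteq> k'" for k k'
    proof -
      obtain i where i: "i \<in> Bs" "k i \<noteq> k' i"
        using kk unfolding I_def by (metis PiE_ext)
      have coord: "(\<Sum>j\<in>Bs. real (h j) *\<^sub>R j) \<bullet> i = real (h i)" for h :: "'a \<Rightarrow> nat"
      proof -
        have "(\<Sum>j\<in>Bs. real (h j) *\<^sub>R j) \<bullet> i = (\<Sum>j\<in>Bs. if j = i then real (h i) else 0)"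
          unfolding inner_sum_left using Bs(2,3) i
          by (intro sum.cong) (auto simp: pairwise_def orthogonal_def norm_eq_1)
        then show ?thesis using i fin by simp
      qed
      have "(\<omega> k - \<omega> k') \<bullet> i = \<tau> * (real (k i) - real (k' i))"
        by (simp add: \<omega>_def inner_diff_left coord right_diff_distrib)
      moreover have "1 \<le> \<bar>real (k i) - real (k' i)\<bar>" using i by linarith
      ultimately have "\<tau> \<le> \<bar>(\<omega> k - \<omega> k') \<bullet> i\<bar>" using \<tau> by (simp add: abs_mult)
      also have "\<dots> \<le> norm (\<omega> k - \<omega> k') * norm i" by (rule Cauchy_Schwarz_ineq2)
      finally have "\<kappa> * \<tau> \<le> \<kappa> * norm (\<omega> k - \<omega> k')" using Bs(3)[OF i(1)] \<kappa> by simp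
      also have "\<dots> \<le> norm (q (\<omega> k) - q (\<omega> k'))" using kk by (intro sep \<omega>W \<omega>r)
      finally have "t * (\<kappa> * \<tau>) \<le> t * norm (q (\<omega> k) - q (\<omega> k'))" using tp by simp
      moreover have "t * (\<kappa> * \<tau>) = 2 * \<delta>" using tp \<kappa> by (simp add: \<tau>_def)
      moreover have "dist (y + t *\<^sub>R q (\<omega> k)) (y + t *\<^sub>R q (\<omega> k')) = t * norm (q (\<omega> k) - q (\<omega> k'))"
        using tp by (simp add: dist_norm scaleR_diff_right[symmetric])
      ultimately show ?thesis by (intro disjoint_ballI) simp
    qed
    have "measure lebesgue (\<Union>k\<in>I. ball (y + t *\<^sub>R q (\<omega> k)) \<delta>) = (\<Sum>k\<in>I. measure lebesgue (ball (y + t *\<^sub>R q (\<omega> k)) \<delta>))"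
      by (rule measure_UNION'[OF finI]) (use disj in \<open>auto simp: pairwise_def disjnt_def\<close>)
    also have "\<dots> = (\<Sum>k\<in>I. V)" unfolding V_def using \<delta> by (intro sum.cong refl) (simp add: content_ball)
    also have "\<dots> = real N ^ m * V" by (simp add: cardI)
    finally have eq: "measure lebesgue (\<Union>k\<in>I. ball (y + t *\<^sub>R q (\<omega> k)) \<delta>) = real N ^ m * V" .
    have "\<eta> ^ m * V * t ^ m = (\<eta> * t) ^ m * V" by (simp add: power_mult_distrib)
    also have "\<dots> \<le> real N ^ m * V" using N2 \<eta>t V by (intro mult_right_mono power_mono) auto
    also have "\<dots> \<le> measure lebesgue T" unfolding eq[symmetric]
      by (rule measure_mono_fmeasurable) (use sub \<omega>W \<omega>r T finI in \<open>auto intro!: sets.finite_UN\<close>)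
    finally show "\<eta> ^ m * V * t ^ dim W \<le> measure lebesgue T" by (simp add: m_def)
  qed
qed

lemma compact_closed_subset:
  fixes S :: "'a::heine_borel set"
  shows "closed S \<Longrightarrow> S \<subseteq> K \<Longrightarrow> compact K \<Longrightarrow> compact S"
  by (metis bounded_subset compact_eq_bounded_closed)

lemma det_le_fact:
  fixes A :: "real^'n^'n"
  assumes "\<And>i j. \<bar>A $ i $ j\<bar> \<le> B"
  shows "\<bar>det A\<bar> \<le> fact CARD('n) * B ^ CARD('n)"
proof -
  have B: "0 \<le> B" using assms[of undefined undefined] by linarith
  have "\<bar>det A\<bar> \<le> (\<Sum>p | p permutes UNIV. \<bar>of_int (sign p) * (\<Prod>i\<in>UNIV. A $ i $ p i)\<bar>)"
    unfolding det_def by (rule sum_abs)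
  also have "\<dots> \<le> (\<Sum>p | p permutes (UNIV :: 'n set). B ^ CARD('n))"
  proof (rule sum_mono)
    fix p :: "'n \<Rightarrow> 'n"
    have "\<bar>\<Prod>i\<in>UNIV. A $ i $ p i\<bar> \<le> (\<Prod>i\<in>(UNIV::'n set). B)"
      unfolding abs_prod by (intro prod_mono) (use assms in auto)
    then show "\<bar>of_int (sign p) * (\<Prod>i\<in>UNIV. A $ i $ p i)\<bar> \<le> B ^ CARD('n)"
      by (simp add: abs_mult sign_def)
  qed
  also have "\<dots> = fact CARD('n) * B ^ CARD('n)"
    by (simp add: card_permutations)
  finally show ?thesis .
qed

text \<open>Since the touching set of the slope \<open>y\<close> at \<open>b\<close> meets the leaf \<open>\<sigma> = \<sigma> b\<close> only in \<open>b\<close>, slopes near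
  \<open>y + t \<nabla>\<gamma>(b')\<close> are attained close to \<open>b\<close> once \<open>t\<close> penalises leaving the leaf of \<open>b'\<close>.\<close>
lemma attained_slopes_near_leaf:
  fixes v \<gamma> :: "'a::euclidean_space \<Rightarrow> real" and \<sigma> :: "'a \<Rightarrow> 'b::real_normed_vector"
  assumes v: "convex_on UNIV v" and y: "y \<in> subdiff v b" and \<rho>: "\<rho> > 0"
    and \<gamma>: "\<And>z. z \<in> cball b \<rho> \<Longrightarrow> (\<gamma> has_derivative (\<lambda>h. g z \<bullet> h)) (at z)"
    and cB: "cB > 0" and Bregman: "\<And>z z'. z \<in> cball b \<rho> \<Longrightarrow> z' \<in> cball b \<rho> \<Longrightarrow>
       cB * (norm (\<sigma> z - \<sigma> z'))\<^sup>2 \<le> \<gamma> z - \<gamma> z' - g z' \<bullet> (z - z')"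
    and \<sigma>: "continuous_on (cball b \<rho>) \<sigma>"
    and exposed: "\<And>z. z \<in> cball b \<rho> \<Longrightarrow> z \<noteq> b \<Longrightarrow> \<sigma> z = \<sigma> b \<Longrightarrow> v z \<noteq> v b + y \<bullet> (z - b)"
  obtains r \<delta> t0 where "0 < r" "r < \<rho>" "0 < \<delta>" "\<And>b' e t. b' \<in> ball b r \<Longrightarrow> norm e < \<delta> \<Longrightarrow> t0 \<le> t \<Longrightarrow>
     \<exists>z\<in>ball b \<rho>. y + t *\<^sub>R g b' + e - t *\<^sub>R g z \<in> subdiff v z"
proof -
  define f where "f z = v z - v b - y \<bullet> (z - b)" for z
  have f0: "0 \<le> f z" for z using subdiffD[OF y, of z] by (simp add: f_def)
  have contv: "continuous_on A v" for A using v convex_on_continuous continuous_on_subset by blast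
  have contf: "continuous_on A f" for A unfolding f_def by (intro continuous_intros contv)
  have fb: "f b = 0" by (simp add: f_def)
  have cont\<sigma>: "continuous_on (sphere b \<rho>) \<sigma>" using \<sigma> continuous_on_subset sphere_cball by blast
  have attains: "\<exists>c>0. \<forall>z\<in>K. c \<le> h z" if "compact K" "continuous_on K h" "\<And>z. z \<in> K \<Longrightarrow> 0 < h z" for K and h :: "'a \<Rightarrow> real"
  proof (cases "K = {}")
    case False then show ?thesis using continuous_attains_inf[OF that(1) False that(2)] that(3) by blast
  qed (auto intro: exI[of _ 1])
  \<comment> \<open>The part of the sphere on the leaf of \<open>b\<close>, where \<open>v\<close>
    exceeds its supporting function by a positive amount.\<close>
  define Z where "Z = {z \<in> sphere b \<rho>. norm (\<sigma> z - \<sigma> b) \<le> 0}"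
  have "closed {z \<in> sphere b \<rho>. norm (\<sigma> z - \<sigma> b) \<le> 0}"
    by (intro continuous_on_closed_Collect_le closed_sphere continuous_on_norm continuous_on_diff continuous_on_const cont\<sigma>)
  then have Zc: "compact Z" unfolding Z_def
    by (rule compact_closed_subset[OF _ _ compact_sphere[of b \<rho>]]) auto
  have "0 < f z" if "z \<in> Z" for z
  proof -
    have "z \<in> cball b \<rho>" "z \<noteq> b" "\<sigma> z = \<sigma> b" using that \<rho> by (auto simp: Z_def)
    from exposed[OF this] show ?thesis using f0[of z] by (simp add: f_def)
  qed
  from attains[OF Zc contf this] obtain c' where c': "c' > 0" "\<And>z. z \<in> Z \<Longrightarrow> c' \<le> f z" by blast
  \<comment> \<open>A quarter of the gap: out of the gain \<open>3 * c\<close>, the later estimate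
    spends up to \<open>c\<close> on \<open>f b'\<close> and up to \<open>c\<close> on the
    perturbation \<open>e\<close>.\<close>
  define c where "c = c' / 4"
  have c: "c > 0" "\<And>z. z \<in> Z \<Longrightarrow> 3 * c < f z" using c' by (force simp: c_def)+
  \<comment> \<open>Where \<open>f\<close> is not large enough on the sphere,
    \<open>\<sigma>\<close> stays away from \<open>\<sigma> b\<close>, and the penalty has to
    win.\<close>
  define A2 where "A2 = {z \<in> sphere b \<rho>. f z \<le> 3 * c}"
  have "closed {z \<in> sphere b \<rho>. f z \<le> 3 * c}"
    by (intro continuous_on_closed_Collect_le closed_sphere continuous_on_const contf)
  then have A2c: "compact A2" unfolding A2_def
    by (rule compact_closed_subset[OF _ _ compact_sphere[of b \<rho>]]) auto
  have "0 < norm (\<sigma> z - \<sigma> b)" if "z \<in> A2" for z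
    using c(2)[of z] that by (auto simp: A2_def Z_def)
  moreover have "continuous_on A2 (\<lambda>z. norm (\<sigma> z - \<sigma> b))"
    by (intro continuous_intros continuous_on_subset[OF cont\<sigma>]) (auto simp: A2_def)
  ultimately obtain \<eta>' where \<eta>': "\<eta>' > 0" "\<And>z. z \<in> A2 \<Longrightarrow> \<eta>' \<le> norm (\<sigma> z - \<sigma> b)"
    using attains[OF A2c, of "\<lambda>z. norm (\<sigma> z - \<sigma> b)"] by blast
  define \<eta> where "\<eta> = \<eta>' / 2"
  have \<eta>: "\<eta> > 0" using \<eta>' by (simp add: \<eta>_def)
  obtain d1 where d1: "d1 > 0" "\<And>z. z \<in> cball b \<rho> \<Longrightarrow> dist z b < d1 \<Longrightarrow> dist (\<sigma> z) (\<sigma> b) < \<eta>"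
    using \<sigma> \<eta> \<rho> unfolding continuous_on_iff by (metis centre_in_cball less_imp_le)
  obtain d2 where d2: "d2 > 0" "\<And>z. dist z b < d2 \<Longrightarrow> dist (f z) (f b) < c"
    using contf[of UNIV] c(1) unfolding continuous_on_iff by (metis UNIV_I)
  define r where "r = Min {d1, d2, \<rho> / 2}"
  have r: "0 < r" "r < \<rho>" "r \<le> d1" "r \<le> d2" using d1 d2 \<rho> by (auto simp: r_def)
  define \<delta> where "\<delta> = c / (2 * \<rho>)"
  have \<delta>: "\<delta> > 0" using c \<rho> by (simp add: \<delta>_def)
  \<comment> \<open>For \<open>t \<ge> t0\<close> the penalty \<open>t * cB * \<eta>^2\<close> is at
    least \<open>3 * c\<close>.\<close>
  define t0 where "t0 = 3 * c / (cB * \<eta>\<^sup>2)"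
  have t0: "t0 > 0" using c cB \<eta> by (simp add: t0_def)
  show ?thesis
  proof (rule that[OF r(1,2) \<delta>, of t0])
    fix b' e :: 'a and t :: real assume b': "b' \<in> ball b r" and e: "norm e < \<delta>" and t: "t0 \<le> t"
    have tp: "t > 0" using t t0 by simp
    have b'in: "b' \<in> cball b \<rho>" using b' r by auto
    have \<sigma>b': "norm (\<sigma> b' - \<sigma> b) < \<eta>" using d1(2)[OF b'in] b' r by (simp add: dist_norm norm_minus_commute)
    have fb': "f b' < c" using d2(2)[of b'] b' r fb by (simp add: dist_real_def dist_commute)
    define w where "w = t *\<^sub>R g b' + e"
    \<comment> \<open>A minimiser of \<open>\<Phi>\<close> over the closed ball is the required
      point: \<open>\<Phi>\<close> is larger on the sphere than at \<open>b'\<close>, so the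
      minimiser is interior.\<close>
    define \<Phi> where "\<Phi> z = f z + t * \<gamma> z - w \<bullet> z" for z
    have diff: "\<Phi> z - \<Phi> b' = f z - f b' + t * (\<gamma> z - \<gamma> b' - g b' \<bullet> (z - b')) - e \<bullet> (z - b')" for z
      by (simp add: \<Phi>_def w_def inner_add_left inner_diff_right algebra_simps)
    have bdry: "\<Phi> b' < \<Phi> z" if z: "z \<in> sphere b \<rho>" for z
    proof -
      have zin: "z \<in> cball b \<rho>" using z by auto
      let ?D = "\<gamma> z - \<gamma> b' - g b' \<bullet> (z - b')"
      have D: "cB * (norm (\<sigma> z - \<sigma> b'))\<^sup>2 \<le> ?D" by (rule Bregman[OF zin b'in])
      have D0: "0 \<le> t * ?D" using D cB tp by (meson less_imp_le mult_nonneg_nonneg order_trans zero_le_power2)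
      have "norm (z - b') \<le> 2 * \<rho>"
        using zin b'in dist_triangle[of z b' b] by (simp add: dist_norm norm_minus_commute)
      then have "norm e * norm (z - b') \<le> \<delta> * (2 * \<rho>)" using e \<delta> by (intro mult_mono) auto
      then have ec: "e \<bullet> (z - b') \<le> c" using norm_cauchy_schwarz[of e "z - b'"] \<rho> by (simp add: \<delta>_def)
      show ?thesis
      proof (cases "z \<in> A2")
        case True
        have "2 * \<eta> \<le> norm (\<sigma> z - \<sigma> b)" using \<eta>'(2)[OF True] by (simp add: \<eta>_def)
        then have "\<eta> \<le> norm (\<sigma> z - \<sigma> b')"
          using \<sigma>b' norm_triangle_ineq[of "\<sigma> z - \<sigma> b'" "\<sigma> b' - \<sigma> b"] by simp
        then have "\<eta>\<^sup>2 \<le> (norm (\<sigma> z - \<sigma> b'))\<^sup>2" using \<eta> by (intro power_mono) auto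
        then have "cB * \<eta>\<^sup>2 \<le> ?D" using D cB by (meson less_imp_le mult_left_mono order_trans)
        then have "t0 * (cB * \<eta>\<^sup>2) \<le> t * ?D" using t t0 cB by (intro mult_mono) auto
        moreover have "t0 * (cB * \<eta>\<^sup>2) = 3 * c" using cB \<eta> by (simp add: t0_def)
        ultimately have "3 * c \<le> t * ?D" by simp
        then show ?thesis using diff[of z] f0[of z] fb' ec c(1) by linarith
      next
        case False
        then have "3 * c < f z" using z by (simp add: A2_def)
        then show ?thesis using diff[of z] fb' ec c(1) D0 by linarith
      qed
    qed
    have cont\<gamma>: "continuous_on (cball b \<rho>) \<gamma>"
      using \<gamma> has_derivative_continuous by (intro continuous_at_imp_continuous_on) blast
    have "continuous_on (cball b \<rho>) \<Phi>" unfolding \<Phi>_def by (intro continuous_intros contf cont\<gamma>)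
    then obtain z where z: "z \<in> cball b \<rho>" "\<And>x. x \<in> cball b \<rho> \<Longrightarrow> \<Phi> z \<le> \<Phi> x"
      using continuous_attains_inf[OF compact_cball, of b \<rho> \<Phi>] \<rho> by (metis cball_eq_empty less_imp_not_less)
    have "z \<notin> sphere b \<rho>" using bdry[of z] z(2)[OF b'in] by auto
    then have zb: "z \<in> ball b \<rho>" using z(1) by auto
    have "- (t *\<^sub>R g z - w - y) \<in> subdiff v z"
    proof (rule subdiff_of_local_min[OF v, where G = "\<lambda>x. t * \<gamma> x - w \<bullet> x - y \<bullet> x"])
      show "((\<lambda>x. t * \<gamma> x - w \<bullet> x - y \<bullet> x) has_derivative (\<bullet>) (t *\<^sub>R g z - w - y)) (at z)"
        using \<gamma>[OF z(1)] by (auto intro!: derivative_eq_intros simp: inner_diff_left)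
      have "\<forall>\<^sub>F x in nhds z. x \<in> ball b \<rho>" using zb by (intro eventually_nhds_in_open) auto
      then show "\<forall>\<^sub>F x in nhds z. v z + (t * \<gamma> z - w \<bullet> z - y \<bullet> z) \<le> v x + (t * \<gamma> x - w \<bullet> x - y \<bullet> x)"
      proof eventually_elim
        case (elim x)
        then have "\<Phi> z \<le> \<Phi> x" by (intro z(2)) auto
        then show ?case by (simp add: \<Phi>_def f_def inner_diff_right)
      qed
    qed
    then show "\<exists>z\<in>ball b \<rho>. y + t *\<^sub>R g b' + e - t *\<^sub>R g z \<in> subdiff v z"
      using zb by (intro bexI[of _ z]) (simp_all add: w_def algebra_simps)
  qed
qed

section \<open>From positive coefficients to touching sets and back\<close>

context smooth_perturbation begin

text \<open>A nonzero coefficient at some \<open>p\<close> comes from a set \<open>S\<close> of size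
  \<open>d\<close> with positive weight and positive minor, and \<open>V\<close> is spanned by the
  corresponding eigenvectors. Convexity makes \<open>v\<close> affine on the segment to any contact
  point; the derivative of \<open>prox\<close> fixes its direction, which the weight then confines
  to \<open>V\<close>.\<close>

lemma MA_coeff_pos_contact:
  assumes d: "d \<le> CARD('n)" and pos: "0 < MA_coeff d"
  obtains z y V where "z \<in> U" "y \<in> subdiff v z" "subspace V" "dim V = d"
    "\<And>a. a \<in> V \<Longrightarrow> a \<noteq> 0 \<Longrightarrow> 0 < a \<bullet> H z a" "\<And>x. v x = v z + y \<bullet> (x - z) \<Longrightarrow> x - z \<in> V"
proof -
  have "\<not> negligible {p \<in> regular_points U. jac_coeff H d p \<noteq> 0}" using MA_coeff(2)[OF d] pos by blast
  then obtain p where p: "p \<in> regular_points U" "jac_coeff H d p \<noteq> 0" using negligible_empty by (metis (mono_tags, lifting) Collect_empty_eq)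
  then have diff: "prox differentiable (at p)" and O: "prox p \<in> \<Omega>" and pU: "prox p \<in> U" using \<Omega> by (auto simp: regular_points_def)
  obtain f w where fr: "jac_frame f w p" using jac_frame_exists[OF diff] by blast
  note f = jac_frameD[OF fr]
  have "(\<Sum>S | card S = d. w S * gram_minor f (H (prox p)) S) \<noteq> 0"
    using p(2) f(4)[of H d] H_selfadjoint[OF O] d by simp
  then obtain S where S: "card S = d" "w S * gram_minor f (H (prox p)) S \<noteq> 0"
    by (metis (mono_tags, lifting) mem_Collect_eq sum.neutral)
  then have "w S > 0" "gram_minor f (H (prox p)) S > 0"
    using f(2)[of S] gram_minor_nonneg[OF selfadjointD(1)[OF H_selfadjoint[OF O]] H_psd[OF O], of f S] by auto
  note wS = this
  have ind: "independent (f ` S)" using orthonormal_familyD(4)[OF f(1)] by (rule independent_mono) auto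
  show ?thesis
  proof (rule that[OF pU prox_subdiff subspace_span])
    show "dim (span (f ` S)) = d"
      using dim_span_eq_card_independent[OF ind] orthonormal_familyD(3)[OF f(1)] S(1)
      by (simp add: card_image inj_on_subset)
    show "0 < a \<bullet> H (prox p) a" if "a \<in> span (f ` S)" "a \<noteq> 0" for a
      using gram_minor_pos_iff[OF f(1) H_selfadjoint[OF O] H_psd[OF O]] wS(2) that by blast
    show "x - prox p \<in> span (f ` S)" if x: "v x = v (prox p) + (p - prox p) \<bullet> (x - prox p)" for x
    proof (rule f(3)[OF wS(1)], rule Dprox_segment[OF diff prox_subdiff])
      fix s :: real assume s: "0 \<le> s" "s \<le> 1"
      let ?x = "prox p + s *\<^sub>R (x - prox p)"
      have "?x = (1 - s) *\<^sub>R prox p + s *\<^sub>R x" by (simp add: algebra_simps)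
      then have "v ?x \<le> (1 - s) * v (prox p) + s * v x" using convex_onD[OF convex, of s "prox p" x] s by simp
      then have "v ?x \<le> v (prox p) + s * ((p - prox p) \<bullet> (x - prox p))" unfolding x by (simp add: algebra_simps)
      moreover have "v (prox p) + (p - prox p) \<bullet> (?x - prox p) \<le> v ?x" by (rule subdiffD[OF prox_subdiff])
      ultimately show "v ?x = v (prox p) + s * ((p - prox p) \<bullet> (x - prox p))" by simp
    qed
  qed
qed

text \<open>Suppose the coefficient vanishes. At almost every \<open>p\<close>, all minors of
  \<open>H\<close> of size \<open>m = dim W\<close> with positive weight vanish; so do those of
  \<open>H'\<close>, by \<open>dominated\<close>, and the larger ones of \<open>H'\<close> vanish by
  \<open>rank\<close>. The Jacobian of \<open>shift g' t\<close> is then of order at most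
  \<open>t^(m - 1)\<close>, whereas the attained slopes contain balls of total volume of order
  \<open>t^m\<close>. As \<open>\<gamma>\<close> is given only near \<open>b\<close>, an upper area
  estimate takes the place of the formula for \<open>MA\<close>.\<close>

lemma MA_coeff_pos_if_exposed_on_leaf:
  fixes \<gamma> :: "real^'n::_ \<Rightarrow> real" and \<sigma> :: "real^'n::_ \<Rightarrow> real^'n::_"
  assumes y: "y \<in> subdiff v b" and \<rho>: "\<rho> > 0" "cball b \<rho> \<subseteq> U"
    and \<gamma>: "\<And>z. z \<in> cball b \<rho> \<Longrightarrow> (\<gamma> has_derivative (\<lambda>h. g' z \<bullet> h)) (at z)"
    and g': "\<And>z. z \<in> cball b \<rho> \<Longrightarrow> (g' has_derivative H' z) (at z)"
    and H': "\<And>z. z \<in> cball b \<rho> \<Longrightarrow> selfadjoint (H' z)" "\<And>z a. z \<in> cball b \<rho> \<Longrightarrow> 0 \<le> a \<bullet> H' z a"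
    and bound: "\<And>z a. z \<in> cball b \<rho> \<Longrightarrow> norm (H' z a) \<le> K * norm a"
    and dominated: "\<And>z a. z \<in> cball b \<rho> \<Longrightarrow> 0 < a \<bullet> H' z a \<Longrightarrow> 0 < a \<bullet> H z a"
    and W: "subspace W"
    and rank: "\<And>z V. z \<in> cball b \<rho> \<Longrightarrow> subspace V \<Longrightarrow> (\<And>a. a \<in> V \<Longrightarrow> a \<noteq> 0 \<Longrightarrow> 0 < a \<bullet> H' z a) \<Longrightarrow> dim V \<le> dim W"
    and cB: "cB > 0" and Bregman: "\<And>z z'. z \<in> cball b \<rho> \<Longrightarrow> z' \<in> cball b \<rho> \<Longrightarrow>
       cB * (norm (\<sigma> z - \<sigma> z'))\<^sup>2 \<le> \<gamma> z - \<gamma> z' - g' z' \<bullet> (z - z')"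
    and \<sigma>: "continuous_on (cball b \<rho>) \<sigma>"
    and exposed: "\<And>z. z \<in> cball b \<rho> \<Longrightarrow> z \<noteq> b \<Longrightarrow> \<sigma> z = \<sigma> b \<Longrightarrow> v z \<noteq> v b + y \<bullet> (z - b)"
    and \<kappa>: "\<kappa> > 0" and sep: "\<And>\<omega> \<omega>'. \<omega> \<in> W \<Longrightarrow> \<omega>' \<in> W \<Longrightarrow> norm \<omega> < \<rho> \<Longrightarrow> norm \<omega>' < \<rho> \<Longrightarrow>
       \<kappa> * norm (\<omega> - \<omega>') \<le> norm (g' (b + \<omega>) - g' (b + \<omega>'))"
  shows "0 < MA_coeff (dim W)"
proof (rule ccontr)
  define m where "m = dim W"
  have mn: "m \<le> CARD('n)" unfolding m_def using dim_subset_UNIV[of W] by simp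
  assume "\<not> 0 < MA_coeff (dim W)"
  then have neg0: "negligible {p \<in> regular_points U. jac_coeff H m p \<noteq> 0}" using MA_coeff(2)[OF mn] by (simp add: m_def)
  define B where "B = ball b \<rho>"
  have BU: "B \<subseteq> U" "B \<subseteq> cball b \<rho>" using \<rho> by (auto simp: B_def)
  define D where "D = {p \<in> regular_points B. jac_coeff H m p = 0}"
  \<comment> \<open>Bounds the Jacobian at \<open>t = 1\<close>: \<open>Dprox\<close> does not
    increase norms, so the matrix entries are at most \<open>2 + |K|\<close>.\<close>
  define C0 where "C0 = fact CARD('n) * (2 + \<bar>K\<bar>) ^ CARD('n)"
  have C0: "C0 \<ge> 0" by (simp add: C0_def)
  \<comment> \<open>The factor \<open>t\<close> on the left stands for the exponent
    \<open>m - 1\<close> and also covers \<open>m = 0\<close>.\<close>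
  have jac1: "0 \<le> jac H' t p \<and> t * jac H' t p \<le> t ^ m * C0" if p: "p \<in> D" and t: "t \<ge> 1" for p t
  proof -
    have diff: "prox differentiable (at p)" and zB: "prox p \<in> cball b \<rho>" and O: "prox p \<in> \<Omega>" 
      using p BU \<Omega> by (auto simp: D_def regular_points_def)
    obtain f w where fr: "jac_frame f w p" using jac_frame_exists[OF diff] by blast
    note f = jac_frameD[OF fr]
    note minor = gram_minor_nonneg[OF selfadjointD(1)[OF H_selfadjoint[OF O]] H_psd[OF O], of f]
    note minor' = gram_minor_nonneg[OF selfadjointD(1)[OF H'(1)[OF zB]] H'(2)[OF zB], of f]
    note pos = gram_minor_pos_iff[OF f(1) H_selfadjoint[OF O] H_psd[OF O]]
    note pos' = gram_minor_pos_iff[OF f(1) H'(1)[OF zB] H'(2)[OF zB]]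
    have nn: "0 \<le> jac_coeff H' d p" if "d \<le> CARD('n)" for d
      unfolding f(4)[of H', OF H'(1)[OF zB] that] using f(2) minor' by (auto intro!: sum_nonneg)
    have zero: "jac_coeff H' d p = 0" if d: "d \<le> CARD('n)" "m \<le> d" for d
    proof -
      have "w S * gram_minor f (H' (prox p)) S = 0" if S: "card S = d" for S
      proof (cases "gram_minor f (H' (prox p)) S = 0")
        case False
        then have p': "\<And>a. a \<in> span (f ` S) \<Longrightarrow> a \<noteq> 0 \<Longrightarrow> 0 < a \<bullet> H' (prox p) a"
          using minor'[of S] pos'[of S] by force
        have ind: "independent (f ` S)" using orthonormal_familyD(4)[OF f(1)] by (rule independent_mono) auto
        have "dim (span (f ` S)) = d"
          using dim_span_eq_card_independent[OF ind] orthonormal_familyD(3)[OF f(1)] S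
          by (simp add: card_image inj_on_subset)
        moreover have "dim (span (f ` S)) \<le> dim W" by (rule rank[OF zB subspace_span]) (rule p')
        ultimately have "d = m" using d by (simp add: m_def)
        have "\<forall>a\<in>span (f ` S). a \<noteq> 0 \<longrightarrow> 0 < a \<bullet> H (prox p) a" using p' dominated[OF zB] by blast
        then have "0 < gram_minor f (H (prox p)) S" using pos by blast
        moreover have "(\<Sum>S | card S = m. w S * gram_minor f (H (prox p)) S) = 0"
          using p f(4)[of H, OF H_selfadjoint[OF O] mn] by (simp add: D_def)
        then have "\<forall>S\<in>{S. card S = m}. w S * gram_minor f (H (prox p)) S = 0"
          using f(2) minor by (subst (asm) sum_nonneg_eq_0_iff) auto
        then have "w S * gram_minor f (H (prox p)) S = 0" using S \<open>d = m\<close> by blast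
        ultimately show ?thesis by simp
      qed simp
      then show ?thesis unfolding f(4)[of H', OF H'(1)[OF zB] d(1)] by (intro sum.neutral) auto
    qed
    have exp: "jac H' s p = (\<Sum>d\<le>CARD('n). jac_coeff H' d p * s ^ d)" for s
      by (rule f(5)[of H', OF H'(1)[OF zB]])
    have "t * jac H' t p = (\<Sum>d\<le>CARD('n). jac_coeff H' d p * t ^ Suc d)"
      by (simp add: exp sum_distrib_left mult_ac)
    also have "\<dots> \<le> (\<Sum>d\<le>CARD('n). jac_coeff H' d p * t ^ m)"
    proof (rule sum_mono)
      fix d assume d: "d \<in> {..CARD('n)}"
      show "jac_coeff H' d p * t ^ Suc d \<le> jac_coeff H' d p * t ^ m"
      proof (cases "m \<le> d")
        case True then show ?thesis using zero d by simp
      next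
        case False
        then have "t ^ Suc d \<le> t ^ m" using t by (intro power_increasing) auto
        then show ?thesis using nn d by (intro mult_left_mono) auto
      qed
    qed
    also have "\<dots> = t ^ m * jac H' 1 p" by (simp add: exp sum_distrib_left mult_ac)
    also have "\<dots> \<le> t ^ m * C0"
    proof (rule mult_left_mono)
      have "\<bar>jac H' 1 p\<bar> \<le> C0" unfolding jac_def C0_def
      proof (rule det_le_fact)
        fix i j
        let ?a = "axis j 1 :: real^'n::_"
        have Ma: "norm (Dprox p ?a) \<le> 1"
        proof -
          have "Dprox p ?a \<bullet> Dprox p ?a \<le> norm (Dprox p ?a) * norm ?a"
            using Dprox_firm[OF diff, of ?a] norm_cauchy_schwarz[of "Dprox p ?a" ?a] by simp
          then have "norm (Dprox p ?a) * norm (Dprox p ?a) \<le> norm (Dprox p ?a) * 1"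
            by (simp add: dot_square_norm power2_eq_square)
          then show ?thesis by (cases "norm (Dprox p ?a) = 0") auto
        qed
        have "\<bar>matrix (Dshift H' 1 p) $ i $ j\<bar> = \<bar>Dshift H' 1 p ?a $ i\<bar>" by (simp add: matrix_def)
        also have "\<dots> \<le> norm (Dshift H' 1 p ?a)" by (rule component_le_norm_cart)
        also have "\<dots> \<le> norm ?a + norm (Dprox p ?a) + norm (H' (prox p) (Dprox p ?a))"
          unfolding Dshift_def using norm_triangle_ineq[of "?a - Dprox p ?a" "H' (prox p) (Dprox p ?a)"]
            norm_triangle_ineq4[of ?a "Dprox p ?a"] by simp
        also have "\<dots> \<le> 1 + 1 + \<bar>K\<bar> * 1"
        proof (intro add_mono)
          have "norm (H' (prox p) (Dprox p ?a)) \<le> K * norm (Dprox p ?a)" by (rule bound[OF zB])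
          also have "\<dots> \<le> \<bar>K\<bar> * 1" using Ma by (intro mult_mono) auto
          finally show "norm (H' (prox p) (Dprox p ?a)) \<le> \<bar>K\<bar> * 1" .
        qed (use Ma in auto)
        finally show "\<bar>matrix (Dshift H' 1 p) $ i $ j\<bar> \<le> 2 + \<bar>K\<bar>" by simp
      qed
      then show "jac H' 1 p \<le> C0" by simp
    qed (use t in auto)
    finally show ?thesis using nn t unfolding exp by (auto intro!: sum_nonneg)
  qed
  have Bb: "B \<in> sets borel" by (simp add: B_def)
  have negD: "negligible (regular_points B - D)"
    by (rule negligible_subset[OF neg0]) (use BU in \<open>auto simp: D_def regular_points_def\<close>)
  have "D = regular_points B - (regular_points B - D)" by (auto simp: D_def)
  then have Dsets: "D \<in> sets lebesgue"
    by (metis sets.Diff negligible_imp_sets negD sets_regular_points[OF Bb])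
  have Dbd: "bounded D"
  proof -
    have "bounded B" by (simp add: B_def)
    then have "bounded (\<Union>z\<in>B. subdiff v z)" "bounded B" using subdiff_bounded_image[OF convex] by auto
    then have "bounded ((\<lambda>(x, y). x + y) ` (B \<times> (\<Union>z\<in>B. subdiff v z)))" by (rule bounded_plus[OF _ , rotated])
    moreover have "D \<subseteq> (\<lambda>(x, y). x + y) ` (B \<times> (\<Union>z\<in>B. subdiff v z))"
    proof
      fix p assume "p \<in> D"
      then have "prox p \<in> B" "p - prox p \<in> subdiff v (prox p)" using prox_subdiff by (auto simp: D_def regular_points_def)
      then show "p \<in> (\<lambda>(x, y). x + y) ` (B \<times> (\<Union>z\<in>B. subdiff v z))"
        by (intro image_eqI[of _ _ "(prox p, p - prox p)"]) auto
    qed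
    ultimately show ?thesis using bounded_subset by blast
  qed
  have Dm: "D \<in> lmeasurable" using Dbd Dsets by (rule bounded_set_imp_lmeasurable)
  \<comment> \<open>The slopes \<open>y + t g'(z)\<close> with \<open>z\<close> in the ball and
    \<open>y\<close> a subgradient of \<open>v\<close> at \<open>z\<close>.\<close>
  define T where "T t = shift g' t ` (prox -` B)" for t
  have upper: "T t \<in> lmeasurable \<and> t * measure lebesgue (T t) \<le> t ^ m * (C0 * measure lebesgue D)" if t: "t \<ge> 1" for t
  proof -
    have der: "(shift g' t has_derivative Dshift H' t p) (at p within D)" if "p \<in> D" for p
      by (rule has_derivative_at_withinI, rule shift_derivative) (use that g' BU in \<open>auto simp: D_def regular_points_def\<close>)
    have le: "\<bar>jac H' t p\<bar> \<le> t ^ m * C0 / t" if "p \<in> D" for p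
      using jac1[OF that t] t by (simp add: field_simps)
    have meas: "jac H' t \<in> borel_measurable (lebesgue_on D)"
      unfolding jac_def[abs_def] by (rule borel_measurable_det_Jacobian[OF Dsets der])
    have int: "(\<lambda>p. \<bar>jac H' t p\<bar>) integrable_on D"
    proof (rule measurable_bounded_by_integrable_imp_integrable)
      show "(\<lambda>p. \<bar>jac H' t p\<bar>) \<in> borel_measurable (lebesgue_on D)" using meas by measurable
      show "(\<lambda>p. t ^ m * C0 / t) integrable_on D" using Dm by (rule integrable_on_const)
    qed (use le Dsets in auto)
    have im: "shift g' t ` D \<in> lmeasurable"
      by (rule measurable_bounded_differentiable_image[OF Dm der int[unfolded jac_def] le[unfolded jac_def]])
    have mle: "measure lebesgue (shift g' t ` D) \<le> t ^ m * C0 / t * measure lebesgue D"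
      by (rule measure_bounded_differentiable_image[OF Dm der int[unfolded jac_def] le[unfolded jac_def]])
    have n1: "negligible (shift g' t ` (prox -` B - regular_points B))"
      by (rule negligible_shift_nondifferentiable) (use g' BU in blast)
    have n2: "negligible (shift g' t ` (regular_points B - D))"
    proof (rule negligible_differentiable_image_negligible[OF order_refl negD])
      show "shift g' t differentiable_on (regular_points B - D)"
        unfolding differentiable_on_def differentiable_def
      proof
        fix p assume "p \<in> regular_points B - D"
        then have "prox differentiable (at p)" "prox p \<in> cball b \<rho>" using BU by (auto simp: regular_points_def)
        then show "\<exists>L. (shift g' t has_derivative L) (at p within regular_points B - D)"
          using has_derivative_at_withinI[OF shift_derivative[where H = H', OF _ g']] by blast
      qed
    qed
    have n3: "negligible (shift g' t ` D - T t \<union> (T t - shift g' t ` D))"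
      by (rule negligible_subset[of "shift g' t ` (prox -` B - regular_points B) \<union> shift g' t ` (regular_points B - D)"])
        (use n1 n2 in \<open>auto simp: T_def D_def regular_points_def negligible_Un_eq\<close>)
    have "T t \<in> lmeasurable" using im n3 by (rule lmeasurable_negligible_symdiff)
    moreover have "measure lebesgue (T t) = measure lebesgue (shift g' t ` D)" using im n3 by (rule measure_negligible_symdiff)
    ultimately show ?thesis using mle t by (simp add: field_simps)
  qed
  obtain r \<delta> t0 where A: "0 < r" "r < \<rho>" "0 < \<delta>" "\<And>b' e t. b' \<in> ball b r \<Longrightarrow> norm e < \<delta> \<Longrightarrow> t0 \<le> t \<Longrightarrow>
     \<exists>z\<in>ball b \<rho>. y + t *\<^sub>R g' b' + e - t *\<^sub>R g' z \<in> subdiff v z"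
    by (rule attained_slopes_near_leaf[OF convex y \<rho>(1)]; (rule \<gamma> cB Bregman \<sigma> exposed | rule that); assumption?)
  have sub: "ball (y + t *\<^sub>R g' (b + \<omega>)) \<delta> \<subseteq> T t" if "norm \<omega> < r" "t \<ge> t0" for \<omega> t
  proof
    fix x assume x: "x \<in> ball (y + t *\<^sub>R g' (b + \<omega>)) \<delta>"
    define e where "e = x - (y + t *\<^sub>R g' (b + \<omega>))"
    have e: "norm e < \<delta>" using x by (simp add: e_def dist_norm norm_minus_commute)
    have "b + \<omega> \<in> ball b r" using that by (simp add: dist_norm)
    from A(4)[OF this e that(2)] obtain z where z: "z \<in> B" "x - t *\<^sub>R g' z \<in> subdiff v z"
      by (auto simp: e_def B_def)
    define p where "p = z + (x - t *\<^sub>R g' z)"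
    have "prox p = z" using z(2) by (intro prox_unique) (simp add: p_def)
    then show "x \<in> T t" unfolding T_def using z(1)
      by (intro image_eqI[of _ _ p]) (auto simp: shift_def p_def)
  qed
  obtain c t1 where c: "c > 0" "\<And>t T. t \<ge> t1 \<Longrightarrow> T \<in> lmeasurable \<Longrightarrow>
     (\<And>\<omega>. \<omega> \<in> W \<Longrightarrow> norm \<omega> < r \<Longrightarrow> ball (y + t *\<^sub>R g' (b + \<omega>)) \<delta> \<subseteq> T) \<Longrightarrow> c * t ^ dim W \<le> measure lebesgue T"
  proof (rule lattice_packing_volume[OF W A(1) A(3) \<kappa>, of "\<lambda>\<omega>. g' (b + \<omega>)" y])
    show "\<kappa> * norm (\<omega> - \<omega>') \<le> norm (g' (b + \<omega>) - g' (b + \<omega>'))"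
      if "\<omega> \<in> W" "\<omega>' \<in> W" "norm \<omega> < r" "norm \<omega>' < r" for \<omega> \<omega>'
      using that A(2) by (intro sep) auto
  qed (rule that; blast)
  \<comment> \<open>Beyond all thresholds, and so large that \<open>c * t^m\<close> exceeds the
    upper bound \<open>t^m * C0 * |D| / t\<close>.\<close>
  define t where "t = Max {1, t0, t1, (C0 * measure lebesgue D + 1) / c}"
  have t: "t \<ge> 1" "t \<ge> t0" "t \<ge> t1" "t \<ge> (C0 * measure lebesgue D + 1) / c" by (auto simp: t_def)
  have "c * t ^ m \<le> measure lebesgue (T t)"
    unfolding m_def using upper[OF t(1)] sub t by (intro c(2)) auto
  then have "t * (c * t ^ m) \<le> t * measure lebesgue (T t)" using t by simp
  also have "\<dots> \<le> t ^ m * (C0 * measure lebesgue D)" using upper[OF t(1)] by blast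
  finally have "t ^ m * (t * c) \<le> t ^ m * (C0 * measure lebesgue D)" by (simp add: mult_ac)
  then have "t * c \<le> C0 * measure lebesgue D" using t by simp
  moreover have "C0 * measure lebesgue D + 1 \<le> t * c" using t(4) c(1) by (simp add: field_simps)
  ultimately show False by simp
qed

end

section \<open>Norm and quadratic perturbations\<close>

lemma orthogonal_projection_exists:
  fixes W :: "'a::euclidean_space set"
  assumes W: "subspace W"
  obtains P where "linear P" "\<And>z. P z \<in> W" "\<And>w. w \<in> W \<Longrightarrow> P w = w" "\<And>x y. P x \<bullet> y = x \<bullet> P y"
proof -
  obtain Bs where Bs: "Bs \<subseteq> W" "pairwise orthogonal Bs" "\<And>x. x \<in> Bs \<Longrightarrow> norm x = 1" "independent Bs" "span Bs = W"
    using orthonormal_basis_subspace[OF W] by metis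
  have fin: "finite Bs" using Bs(4) independent_imp_finite by blast
  define P where "P z = (\<Sum>i\<in>Bs. (z \<bullet> i) *\<^sub>R i)" for z
  show ?thesis
  proof (rule that[of P])
    show lin: "linear P" unfolding P_def
      by (rule linearI) (simp_all add: inner_add_left scaleR_add_left sum.distrib scaleR_sum_right)
    show "P z \<in> W" for z unfolding P_def using Bs(1) W by (intro subspace_sum subspace_scale) auto
    show "P w = w" if "w \<in> W" for w
      using that unfolding Bs(5)[symmetric]
    proof (induction rule: span_induct_alt)
      case base show ?case by (simp add: linear_0[OF lin])
    next
      case (step c x y)
      have "P x = (\<Sum>i\<in>Bs. if i = x then x else 0)" unfolding P_def
        using Bs(2,3) step(1) by (intro sum.cong) (auto simp: pairwise_def orthogonal_def norm_eq_1)
      then have "P x = x" using fin step(1) by simp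
      then show ?case by (simp add: linear_add[OF lin] linear_cmul[OF lin] step)
    qed
    show "P x \<bullet> y = x \<bullet> P y" for x y
      unfolding P_def inner_sum_left inner_sum_right by (rule sum.cong) (simp_all add: inner_commute mult.commute)
  qed
qed

text \<open>The transversal subspace is the kernel of \<open>P\<close>: it contains \<open>b\<close>
  and meets \<open>V\<close> only in 0. Its orthogonal complement \<open>W\<close> is chosen inside
  the hyperplane orthogonal to \<open>b\<close>, whose dimension is at least \<open>m\<close>, so as
  to contain the projection of \<open>V\<close> along \<open>b\<close>.\<close>

lemma transversal_subspace_exists:
  fixes V :: "'a::euclidean_space set"
  assumes V: "subspace V" "b \<notin> V" and m: "dim V \<le> m" "m < DIM('a)"
  obtains W P where "subspace W" "dim W = m" "linear P" "\<And>z. P z \<in> W" "\<And>w. w \<in> W \<Longrightarrow> P w = w"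
    "\<And>x y. P x \<bullet> y = x \<bullet> P y" "P b = 0" "\<And>a. a \<in> V \<Longrightarrow> P a = 0 \<Longrightarrow> a = 0"
proof -
  have b0: "b \<noteq> 0" using V subspace_0 by blast
  define bb where "bb = {x. b \<bullet> x = 0}"
  have sbb: "subspace bb" unfolding bb_def by (simp add: subspace_def inner_add_right)
  have dbb: "dim bb = DIM('a) - 1" unfolding bb_def using b0 by (rule dim_hyperplane)
  define Q where "Q a = a - ((b \<bullet> a) / (b \<bullet> b)) *\<^sub>R b" for a
  have linQ: "linear Q" unfolding Q_def
    by (rule linearI) (simp_all add: inner_add_right add_divide_distrib scaleR_add_left algebra_simps)
  have Qbb: "Q a \<in> bb" for a using b0 by (simp add: Q_def bb_def inner_diff_right)
  have sQV: "subspace (Q ` V)" using linQ V(1) by (rule linear_subspace_image)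
  have dQV: "dim (Q ` V) \<le> m" using dim_image_le[OF linQ, of V] m by linarith
  obtain B where B: "B \<subseteq> Q ` V" "independent B" "Q ` V \<subseteq> span B" "card B = dim (Q ` V)"
    using basis_exists by metis
  have "B \<subseteq> bb" using B(1) Qbb by auto
  from maximal_independent_subset_extend[OF this B(2)]
  obtain C where C: "B \<subseteq> C" "C \<subseteq> bb" "independent C" "bb \<subseteq> span C" by blast
  have finC: "finite C" using C(3) independent_imp_finite by blast
  have "card C = dim bb" using C by (metis basis_card_eq_dim)
  then have "m \<le> card C" using dbb m by simp
  moreover have "card B \<le> m" using B(4) dQV by simp
  ultimately obtain D where D: "B \<subseteq> D" "D \<subseteq> C" "card D = m"
    using exists_subset_between[of B m C] C(1) finC by blast
  define W where "W = span D"
  have sW: "subspace W" by (simp add: W_def)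
  have dW: "dim W = m" unfolding W_def using D C(3) dim_span_eq_card_independent independent_mono by metis
  have Wbb: "W \<subseteq> bb" unfolding W_def using D C sbb by (intro span_minimal) auto
  have QVW: "Q ` V \<subseteq> W" unfolding W_def using B(3) D(1) span_mono by blast
  obtain P where P: "linear P" "\<And>z. P z \<in> W" "\<And>w. w \<in> W \<Longrightarrow> P w = w" "\<And>x y. P x \<bullet> y = x \<bullet> P y"
    using orthogonal_projection_exists[OF sW] by blast
  have Pb: "P b = 0"
  proof -
    have "P b \<bullet> P b = b \<bullet> P (P b)" by (rule P(4))
    also have "\<dots> = b \<bullet> P b" using P by simp
    also have "\<dots> = 0" using P(2)[of b] Wbb by (auto simp: bb_def)
    finally show ?thesis by simp
  qed
  \<comment> \<open>On \<open>V\<close>, \<open>P\<close> agrees with the projection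
    \<open>Q\<close> along \<open>b\<close>. A vector of \<open>V\<close> killed by \<open>P\<close>
    is thus a multiple of \<open>b\<close>, hence 0.\<close>
  have inj: "a = 0" if a: "a \<in> V" "P a = 0" for a
  proof -
    have "a = Q a + ((b \<bullet> a) / (b \<bullet> b)) *\<^sub>R b" by (simp add: Q_def)
    then have "P a = P (Q a) + ((b \<bullet> a) / (b \<bullet> b)) *\<^sub>R P b"
      by (metis P(1) linear_add linear_cmul)
    then have "Q a = 0" using a Pb P(3) QVW by auto
    then have ab: "a = ((b \<bullet> a) / (b \<bullet> b)) *\<^sub>R b" by (simp add: Q_def)
    show "a = 0"
    proof (rule ccontr)
      assume "a \<noteq> 0"
      then have "(b \<bullet> a) / (b \<bullet> b) \<noteq> 0" using ab by (metis scaleR_zero_left)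
      then have "b = ((b \<bullet> b) / (b \<bullet> a)) *\<^sub>R a" using ab
        by (metis (no_types, lifting) inverse_divide left_inverse scaleR_one scaleR_scaleR inverse_inverse_eq right_inverse divide_inverse)
      then have "b \<in> V" using a V(1) subspace_scale by metis
      then show False using V by simp
    qed
  qed
  show ?thesis by (rule that[OF sW dW P Pb inj])
qed

lemma norm_projection_le:
  assumes "\<And>x y. P x \<bullet> y = x \<bullet> P y" "\<And>z. P (P z) = P z"
  shows "norm (P z) \<le> norm (z :: 'a::real_inner)"
proof -
  have "P z \<bullet> P z = z \<bullet> P z" using assms by metis
  also have "\<dots> \<le> norm z * norm (P z)" by (rule norm_cauchy_schwarz)
  finally have "norm (P z) * norm (P z) \<le> norm z * norm (P z)" by (simp add: dot_square_norm power2_eq_square)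
  then show ?thesis by (cases "norm (P z) = 0") auto
qed

lemma dim_le_if_injective:
  fixes V :: "'a::euclidean_space set" and L :: "'a \<Rightarrow> 'b::euclidean_space"
  assumes "linear L" "subspace V" "\<And>a. a \<in> V \<Longrightarrow> a \<noteq> 0 \<Longrightarrow> L a \<noteq> 0" "L ` V \<subseteq> W"
  shows "dim V \<le> dim W"
proof -
  have "inj_on L (span V)" using assms by (subst linear_inj_on_iff_eq_0) (auto simp: span_eq_iff[THEN iffD2])
  then have "dim (L ` V) = dim V" using assms(1) by (intro dim_image_eq)
  then show ?thesis using assms(4) dim_subset by metis
qed

lemma half_norm_square_convex: "convex_on UNIV (\<lambda>z::'a::real_inner. (norm z)\<^sup>2 / 2)"
proof (rule convex_onI)
  fix t :: real and x y :: 'a assume t: "0 < t" "t < 1"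
  have "(1 - t) * (x \<bullet> x) + t * (y \<bullet> y) - (norm ((1 - t) *\<^sub>R x + t *\<^sub>R y))\<^sup>2 = t * (1 - t) * ((x - y) \<bullet> (x - y))"
    unfolding power2_norm_eq_inner
    by (simp add: inner_add_left inner_add_right inner_diff_left inner_diff_right inner_commute algebra_simps)
  moreover have "0 \<le> t * (1 - t) * ((x - y) \<bullet> (x - y))" using t by simp
  ultimately show "(norm ((1 - t) *\<^sub>R x + t *\<^sub>R y))\<^sup>2 / 2 \<le> (1 - t) * ((norm x)\<^sup>2 / 2) + t * ((norm y)\<^sup>2 / 2)"
    unfolding power2_norm_eq_inner by (simp add: field_simps)
qed simp

lemma half_norm_square_gradient: "((\<lambda>z. (norm z)\<^sup>2 / 2) has_derivative (\<bullet>) z) (at (z::'a::real_inner))"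
  unfolding power2_norm_eq_inner by (rule derivative_eq_intros refl | simp add: inner_commute fun_eq_iff)+

text \<open>A positively homogeneous convex \<open>v\<close> is the support function of a convex
  body, and the coefficients are those of its Steiner polynomial.\<close>

locale quadratic_perturbation = proximal_derivative v for v :: "real^'n::{finite,wellorder} \<Rightarrow> real" +
  assumes homogeneous: "\<And>s z. 0 \<le> s \<Longrightarrow> v (s *\<^sub>R z) = s * v z"
begin

sublocale smooth_perturbation v "\<lambda>z. (norm z)\<^sup>2 / 2" "\<lambda>z. z" "\<lambda>z a. a" UNIV "cball 0 1"
proof
  show "selfadjoint (\<lambda>a::real^'n::_. a)" by (simp add: selfadjoint_def linear_id[unfolded id_def])
qed (auto intro: has_derivative_ident half_norm_square_convex half_norm_square_gradient)

lemma subdiff_homogeneous: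
  assumes y: "y \<in> subdiff v z"
  shows "v z = y \<bullet> z" "y \<bullet> x \<le> v x"
proof -
  have "v 0 = 0" using homogeneous[of 0 0] by simp
  moreover have "v (2 *\<^sub>R z) = 2 * v z" using homogeneous[of 2 z] by simp
  ultimately show eq: "v z = y \<bullet> z"
    using subdiffD[OF y, of 0] subdiffD[OF y, of "2 *\<^sub>R z"] by (simp add: inner_diff_right)
  show "y \<bullet> x \<le> v x" using subdiffD[OF y, of x] by (simp add: eq inner_diff_right)
qed

text \<open>The Hessian is the identity here, so any vector outside \<open>V\<close> can take the
  role of \<open>b\<close> in the choice of the transversal subspace. The comparison function is
  \<open>|P z|^2 / 2\<close>, and its leaves are the parallel fibres of \<open>P\<close>.\<close>

lemma MA_coeff_pos_mono:
  assumes d: "d1 \<le> d2" "d2 < CARD('n)" and pos: "0 < MA_coeff d1"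
  shows "0 < MA_coeff d2"
proof -
  obtain z y V where zV: "z \<in> cball 0 1" "y \<in> subdiff v z" "subspace V" "dim V = d1"
    "\<And>x. v x = v z + y \<bullet> (x - z) \<Longrightarrow> x - z \<in> V"
  proof (rule MA_coeff_pos_contact[OF _ pos])
    show "d1 \<le> CARD('n)" using d by simp
  qed (rule that; assumption)
  have "V \<noteq> UNIV" using zV(4) d by auto
  then obtain e where "e \<notin> V" by blast
  obtain W P where W: "subspace W" "dim W = d2" and P: "linear P" "\<And>z. P z \<in> W" "\<And>w. w \<in> W \<Longrightarrow> P w = w"
    "\<And>x y. P x \<bullet> y = x \<bullet> P y" and inj: "\<And>a. a \<in> V \<Longrightarrow> P a = 0 \<Longrightarrow> a = 0"
  proof (rule transversal_subspace_exists[OF zV(3) \<open>e \<notin> V\<close>, of d2])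
    show "dim V \<le> d2" "d2 < DIM(real^'n::_)" using d zV(4) by auto
  qed (rule that; assumption)
  have bl: "bounded_linear P" using P(1) by (simp add: linear_conv_bounded_linear)
  have PP: "P (P x) = P x" for x using P by simp
  have aPa: "a \<bullet> P a = P a \<bullet> P a" for a using P(4)[of a "P a"] PP by simp
  \<comment> \<open>Halving \<open>z\<close> makes a ball of radius \<open>1 / 2\<close> around the
    contact point fit into the unit ball; homogeneity carries the contact condition along.\<close>
  define b where "b = (1/2) *\<^sub>R z"
  note sub = subdiff_homogeneous[OF zV(2)]
  have vb: "v b = y \<bullet> b" using homogeneous[of "1/2" z] sub(1) by (simp add: b_def)
  have contact: "x - b \<in> V" if "v x = y \<bullet> x" for x
  proof -
    have "v (2 *\<^sub>R x) = v z + y \<bullet> (2 *\<^sub>R x - z)" using homogeneous[of 2 x] that sub(1) by (simp add: inner_diff_right)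
    from zV(5)[OF this] have "(1/2) *\<^sub>R (2 *\<^sub>R x - z) \<in> V" using zV(3) subspace_scale by blast
    then show ?thesis by (simp add: b_def scaleR_diff_right)
  qed
  have "0 < MA_coeff (dim W)"
  proof (rule MA_coeff_pos_if_exposed_on_leaf[where b = b and y = y and \<rho> = "1/2" and \<gamma> = "\<lambda>z. (norm (P z))\<^sup>2 / 2"
        and g' = P and H' = "\<lambda>_. P" and K = 1 and cB = "1/2" and \<kappa> = 1 and \<sigma> = P])
    show "y \<in> subdiff v b" by (rule subdiffI) (use sub(2) in \<open>simp add: vb inner_diff_right\<close>)
    show "cball b (1/2) \<subseteq> cball 0 1"
      using zV(1) by (intro cball_subset_cball_iff[THEN iffD2]) (simp add: b_def)
    show "((\<lambda>z. (norm (P z))\<^sup>2 / 2) has_derivative (\<bullet>) (P x)) (at x)" for x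
      unfolding power2_norm_eq_inner
    proof (rule has_derivative_eq_rhs)
      have dP: "(P has_derivative P) (at x)" by (rule bounded_linear_imp_has_derivative[OF bl])
      show "((\<lambda>z. P z \<bullet> P z / 2) has_derivative (\<lambda>h. (P x \<bullet> P h + P h \<bullet> P x) / 2)) (at x)"
        unfolding divide_inverse by (intro has_derivative_mult_left has_derivative_inner dP)
      have "P x \<bullet> P h = P x \<bullet> h" for h using P(4)[of "P x" h] PP by simp
      then show "(\<lambda>h. (P x \<bullet> P h + P h \<bullet> P x) / 2) = (\<bullet>) (P x)"
        by (simp add: fun_eq_iff inner_commute[of "P _" "P x"])
    qed
    show "(P has_derivative P) (at x)" for x by (rule bounded_linear_imp_has_derivative[OF bl])
    show "selfadjoint P" using P by (simp add: selfadjoint_def)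
    show "0 \<le> a \<bullet> P a" for a by (simp add: aPa)
    show "norm (P a) \<le> 1 * norm a" for a using norm_projection_le[OF P(4) PP] by simp
    show "0 < a \<bullet> a" if "0 < a \<bullet> P a" for a using that by auto
    show "dim V' \<le> dim W" if "subspace V'" "\<And>a. a \<in> V' \<Longrightarrow> a \<noteq> 0 \<Longrightarrow> 0 < a \<bullet> P a" for V'
      by (rule dim_le_if_injective[OF P(1) that(1)]) (use that(2) P(2) in force)+
    show "1/2 * (norm (P x - P x'))\<^sup>2 \<le> (norm (P x))\<^sup>2 / 2 - (norm (P x'))\<^sup>2 / 2 - P x' \<bullet> (x - x')" for x x'
    proof -
      have "P x' \<bullet> (x - x') = P x' \<bullet> (P x - P x')"
        using P(4)[of "P x'" "x - x'"] PP linear_diff[OF P(1)] by simp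
      then show ?thesis unfolding power2_norm_eq_inner
        by (simp add: inner_diff_left inner_diff_right inner_commute field_simps)
    qed
    show "continuous_on (cball b (1/2)) P" using bl by (rule linear_continuous_on)
    show "v x \<noteq> v b + y \<bullet> (x - b)" if "x \<noteq> b" "P x = P b" for x
    proof
      assume "v x = v b + y \<bullet> (x - b)"
      then have "x - b \<in> V" using contact by (simp add: vb inner_diff_right)
      moreover have "P (x - b) = 0" using that linear_diff[OF P(1)] by simp
      ultimately show False using inj that by force
    qed
    show "1 * norm (\<omega> - \<omega>') \<le> norm (P (b + \<omega>) - P (b + \<omega>'))" if "\<omega> \<in> W" "\<omega>' \<in> W" for \<omega> \<omega>'
      using P(3) that linear_add[OF P(1)] by simp
  qed (use W in auto)
  then show ?thesis using W by simp
qed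

end

section \<open>The norm away from the origin\<close>

text \<open>The Hessian of the norm at \<open>z\<close>: orthogonal projection to the complement of
  \<open>z\<close>, divided by \<open>norm z\<close>.\<close>

definition dirhess :: "'a::real_inner \<Rightarrow> 'a \<Rightarrow> 'a" where
  "dirhess z a = (a - ((z \<bullet> a) / (z \<bullet> z)) *\<^sub>R z) /\<^sub>R norm z"

lemma dirhess_inner: "a \<bullet> dirhess z c = (a \<bullet> c - (z \<bullet> a) * (z \<bullet> c) / (z \<bullet> z)) / norm z"
  by (simp add: dirhess_def inner_diff_right inner_commute divide_inverse mult_ac)

lemma dirhess_selfadjoint: "selfadjoint (dirhess z)"
  unfolding selfadjoint_def
proof (intro conjI allI)
  show "linear (dirhess z)" unfolding dirhess_def
    by (rule linearI) (simp_all add: inner_add_right add_divide_distrib scaleR_add_left scaleR_diff_right algebra_simps)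
  show "dirhess z x \<bullet> y = x \<bullet> dirhess z y" for x y
    using dirhess_inner[of y z x] dirhess_inner[of x z y] by (simp add: inner_commute mult.commute)
qed

lemma dirhess_psd: "0 \<le> a \<bullet> dirhess z a"
proof -
  have "(z \<bullet> a) * (z \<bullet> a) \<le> (z \<bullet> z) * (a \<bullet> a)" using Cauchy_Schwarz_ineq[of z a] by (simp add: power2_eq_square)
  then have "(z \<bullet> a) * (z \<bullet> a) / (z \<bullet> z) \<le> a \<bullet> a" by (cases "z = 0") (simp_all add: divide_simps mult.commute)
  then show ?thesis by (simp add: dirhess_inner)
qed

lemma norm_convex: "convex_on UNIV (norm :: 'a::real_normed_vector \<Rightarrow> real)"
proof (rule convex_onI)
  fix t :: real and x y :: 'a assume "0 < t" "t < 1"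
  then show "norm ((1 - t) *\<^sub>R x + t *\<^sub>R y) \<le> (1 - t) * norm x + t * norm y"
    using norm_triangle_ineq[of "(1 - t) *\<^sub>R x" "t *\<^sub>R y"] by simp
qed simp

lemma norm_gradient: "z \<noteq> 0 \<Longrightarrow> (norm has_derivative (\<bullet>) (z /\<^sub>R norm z)) (at (z::'a::real_inner))"
  by (rule has_derivative_eq_rhs[OF has_derivative_norm]) (simp_all add: sgn_div_norm inner_commute fun_eq_iff)

lemma normalize_has_derivative: "z \<noteq> 0 \<Longrightarrow> ((\<lambda>z. z /\<^sub>R norm z) has_derivative dirhess z) (at (z::'a::real_inner))"
proof -
  assume z: "z \<noteq> 0"
  have "((\<lambda>z. inverse (norm z) *\<^sub>R z) has_derivative (\<lambda>h. inverse (norm z) *\<^sub>R h + (- (inverse (norm z) * ((z /\<^sub>R norm z) \<bullet> h) * inverse (norm z))) *\<^sub>R z)) (at z)"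
    by (rule has_derivative_scaleR[OF Deriv.has_derivative_inverse[OF _ norm_gradient[OF z]] has_derivative_ident]) (use z in simp)
  then show ?thesis
  proof (rule has_derivative_eq_rhs)
    show "(\<lambda>h. inverse (norm z) *\<^sub>R h + (- (inverse (norm z) * ((z /\<^sub>R norm z) \<bullet> h) * inverse (norm z))) *\<^sub>R z) = dirhess z"
    proof
      fix h
      have "inverse (norm z) * inverse (norm z) = inverse (z \<bullet> z)" using z
        by (simp add: dot_square_norm power2_eq_square)
      then show "inverse (norm z) *\<^sub>R h + (- (inverse (norm z) * ((z /\<^sub>R norm z) \<bullet> h) * inverse (norm z))) *\<^sub>R z = dirhess z h"
        by (simp add: dirhess_def scaleR_diff_right divide_inverse mult_ac)
    qed
  qed
qed

locale norm_perturbation = proximal_derivative v for v :: "real^'n::{finite,wellorder} \<Rightarrow> real" +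
  fixes U :: "(real^'n::_) set"
  assumes U_open: "open U" and U_bounded: "bounded U" and U_nonzero: "0 \<notin> U"
begin

sublocale smooth_perturbation v norm "\<lambda>z. z /\<^sub>R norm z" dirhess "- {0}" U
proof
  show "open (- {0::real^'n::_})" by auto
  show "U \<subseteq> - {0}" using U_nonzero by auto
  show "(norm has_derivative (\<bullet>) (z /\<^sub>R norm z)) (at z)" if "z \<in> - {0}" for z :: "real^'n::_" using norm_gradient that by auto
  show "((\<lambda>z. z /\<^sub>R norm z) has_derivative dirhess z) (at z)" if "z \<in> - {0}" for z :: "real^'n::_" using normalize_has_derivative that by auto
qed (use U_open U_bounded in \<open>auto simp: norm_convex dirhess_selfadjoint dirhess_psd\<close>)

text \<open>The function \<open>\<gamma> z = |P z|^2 / (2 <z, u>)\<close> is linear on each leaf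
  \<open>P z / <z, u> = const\<close>, a piece of a linear subspace of dimension
  \<open>n - d2\<close>. Its Hessian form is \<open><L a, L c> / <z, u>\<close>, where
  \<open>L\<close> is \<open><z, u>\<close> times the derivative of \<open>\<sigma>\<close>;
  \<open>L\<close> kills \<open>z\<close>, just as the Hessian of the norm does.\<close>

lemma MA_coeff_pos_mono:
  assumes d: "d1 \<le> d2" "d2 < CARD('n)" and pos: "0 < MA_coeff d1"
  shows "0 < MA_coeff d2"
proof -
  obtain b y V where bV: "b \<in> U" "y \<in> subdiff v b" "subspace V" "dim V = d1"
    and pd: "\<And>a. a \<in> V \<Longrightarrow> a \<noteq> 0 \<Longrightarrow> 0 < a \<bullet> dirhess b a"
    and contact: "\<And>x. v x = v b + y \<bullet> (x - b) \<Longrightarrow> x - b \<in> V"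
  proof (rule MA_coeff_pos_contact[OF _ pos])
    show "d1 \<le> CARD('n)" using d by simp
  qed (rule that; assumption)
  have b0: "b \<noteq> 0" using bV U_nonzero by auto
  \<comment> \<open>The Hessian of the norm vanishes radially but is positive on \<open>V\<close>,
    so the touching set spans no radial direction.\<close>
  have "b \<bullet> dirhess b b = 0" using b0 by (simp add: dirhess_inner)
  then have bnV: "b \<notin> V" using pd[of b] b0 by auto
  obtain W P where W: "subspace W" "dim W = d2" and P: "linear P" "\<And>z. P z \<in> W" "\<And>w. w \<in> W \<Longrightarrow> P w = w"
    "\<And>x y. P x \<bullet> y = x \<bullet> P y" and Pb: "P b = 0" and inj: "\<And>a. a \<in> V \<Longrightarrow> P a = 0 \<Longrightarrow> a = 0"
  proof (rule transversal_subspace_exists[OF bV(3) bnV, of d2])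
    show "dim V \<le> d2" "d2 < DIM(real^'n::_)" using d bV(4) by auto
  qed (rule that; assumption)
  have bl: "bounded_linear P" using P(1) by (simp add: linear_conv_bounded_linear)
  have PP: "P (P x) = P x" for x using P by simp
  have Pi: "P x \<bullet> y = P x \<bullet> P y" for x y using P(4)[of "P x" y] PP by simp
  have Pn: "norm (P x) \<le> norm x" for x using norm_projection_le[OF P(4) PP] .
  define \<beta> where "\<beta> = norm b"
  have \<beta>: "\<beta> > 0" using b0 by (simp add: \<beta>_def)
  define u where "u = b /\<^sub>R \<beta>"
  have u: "norm u = 1" using \<beta> by (simp add: u_def \<beta>_def)
  have Pu: "P u = 0" using Pb linear_cmul[OF P(1)] by (simp add: u_def)
  have uP: "P x \<bullet> u = 0" for x using P(4)[of x u] Pu by simp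
  obtain \<epsilon> where \<epsilon>: "\<epsilon> > 0" "cball b \<epsilon> \<subseteq> U" using U_open bV(1) open_contains_cball by metis
  \<comment> \<open>Within distance \<open>\<beta> / 2\<close> of \<open>b\<close> the denominator
    \<open><z, u>\<close> is at least \<open>\<beta> / 2\<close>.\<close>
  define \<rho> where "\<rho> = min \<epsilon> (\<beta> / 2)"
  have \<rho>: "\<rho> > 0" "cball b \<rho> \<subseteq> U" using \<epsilon> \<beta> by (auto simp: \<rho>_def)
  have bu: "b \<bullet> u = \<beta>" using \<beta> by (simp add: u_def \<beta>_def dot_square_norm power2_eq_square)
  have r: "\<beta> / 2 \<le> z \<bullet> u" "norm z \<le> 2 * \<beta>" if "z \<in> cball b \<rho>" for z
  proof -
    have zb: "norm (z - b) \<le> \<beta> / 2" using that by (simp add: \<rho>_def dist_norm norm_minus_commute)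
    have "\<bar>(z - b) \<bullet> u\<bar> \<le> norm (z - b) * norm u" by (rule Cauchy_Schwarz_ineq2)
    then have "\<bar>(z - b) \<bullet> u\<bar> \<le> \<beta> / 2" using zb u by simp
    then show "\<beta> / 2 \<le> z \<bullet> u" unfolding inner_diff_left bu by linarith
    show "norm z \<le> 2 * \<beta>" using zb norm_triangle_ineq[of "z - b" b] \<beta> by (simp add: \<beta>_def[symmetric])
  qed
  have rp: "z \<bullet> u > 0" "z \<bullet> u \<noteq> 0" if "z \<in> cball b \<rho>" for z using r(1)[OF that] \<beta> by auto
  define \<gamma> where "\<gamma> z = (P z \<bullet> P z) / (2 * (z \<bullet> u))" for z
  define g' where "g' z = P z /\<^sub>R (z \<bullet> u) - ((P z \<bullet> P z) / (2 * (z \<bullet> u)\<^sup>2)) *\<^sub>R u" for z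
  define L where "L z a = P a - ((a \<bullet> u) / (z \<bullet> u)) *\<^sub>R P z" for z a
  define H' where "H' z a = (L z a - ((P z \<bullet> L z a) / (z \<bullet> u)) *\<^sub>R u) /\<^sub>R (z \<bullet> u)" for z a
  define \<sigma> where "\<sigma> z = P z /\<^sub>R (z \<bullet> u)" for z
  have linL: "linear (L z)" for z unfolding L_def
    by (rule linearI) (simp_all add: linear_add[OF P(1)] linear_cmul[OF P(1)] inner_add_left add_divide_distrib scaleR_add_left scaleR_diff_right)
  have LW: "L z a \<in> W" for z a unfolding L_def using W P by (simp add: subspace_diff subspace_scale)
  have Lz: "L z z = 0" if "z \<in> cball b \<rho>" for z using rp[OF that] by (simp add: L_def)
  have Linner: "L z a \<bullet> c = L z a \<bullet> P c" for z a c using P(3)[OF LW[of z a]] Pi[of "L z a" c] by simp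
  have H'L: "H' z a \<bullet> c = (L z a \<bullet> L z c) / (z \<bullet> u)" if "z \<in> cball b \<rho>" for z a c
  proof -
    have "H' z a \<bullet> c = (L z a \<bullet> P c - (P z \<bullet> L z a) * (c \<bullet> u) / (z \<bullet> u)) / (z \<bullet> u)"
      unfolding H'_def inner_scaleR_left inner_diff_left Linner[of z a c]
      by (simp add: inner_commute[of u c] divide_inverse mult_ac)
    also have "L z a \<bullet> P c - (P z \<bullet> L z a) * (c \<bullet> u) / (z \<bullet> u) = L z a \<bullet> L z c"
      unfolding L_def[of z c] by (simp add: inner_diff_right inner_commute divide_inverse mult_ac)
    finally show ?thesis .
  qed
  have "0 < MA_coeff (dim W)"
  \<comment> \<open>\<open>K\<close> is 25 times the bound \<open>2 / \<beta>\<close> on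
    \<open>1 / <z, u>\<close>, with 25 = 5 + 20 from the two terms of \<open>H'\<close>.
    \<open>cB\<close> is half the lower bound of \<open><z, u>\<close>. \<open>\<kappa>\<close>
    comes from \<open>P (g' (b + \<omega>)) = \<omega> / \<beta>\<close> on
    \<open>W\<close>.\<close>
  proof (rule MA_coeff_pos_if_exposed_on_leaf[where b = b and y = y and \<rho> = \<rho> and \<gamma> = \<gamma>
        and g' = g' and H' = H' and K = "50 / \<beta>" and cB = "\<beta> / 4" and \<kappa> = "1 / \<beta>" and \<sigma> = \<sigma>])
    show "(\<gamma> has_derivative (\<bullet>) (g' z)) (at z)" if z: "z \<in> cball b \<rho>" for z
    proof -
      have "(\<gamma> has_derivative (\<lambda>h. ((P z \<bullet> P h + P h \<bullet> P z) * (2 * (z \<bullet> u)) - (P z \<bullet> P z) * (2 * (h \<bullet> u))) / ((2 * (z \<bullet> u)) * (2 * (z \<bullet> u))))) (at z)"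
        unfolding \<gamma>_def using rp[OF z]
        by (intro has_derivative_divide' has_derivative_inner bounded_linear_imp_has_derivative[OF bl]
           has_derivative_mult_right has_derivative_inner_left has_derivative_ident) auto
      then show ?thesis
      proof (rule has_derivative_eq_rhs, intro ext)
        fix h
        have "((P z \<bullet> P h + P h \<bullet> P z) * (2 * (z \<bullet> u)) - (P z \<bullet> P z) * (2 * (h \<bullet> u))) / ((2 * (z \<bullet> u)) * (2 * (z \<bullet> u))) =
          (P z \<bullet> P h) / (z \<bullet> u) - (P z \<bullet> P z) / (2 * (z \<bullet> u)\<^sup>2) * (h \<bullet> u)"
          using rp[OF z] by (simp add: inner_commute power2_eq_square divide_simps)
        also have "\<dots> = g' z \<bullet> h"
        proof -
          have "g' z \<bullet> h = inverse (z \<bullet> u) * (P z \<bullet> P h) - (P z \<bullet> P z) / (2 * (z \<bullet> u)\<^sup>2) * (h \<bullet> u)"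
            unfolding g'_def inner_diff_left inner_scaleR_left Pi[of z h] inner_commute[of u h] ..
          then show ?thesis by (simp only: divide_inverse mult.commute)
        qed
        finally show "((P z \<bullet> P h + P h \<bullet> P z) * (2 * (z \<bullet> u)) - (P z \<bullet> P z) * (2 * (h \<bullet> u))) / ((2 * (z \<bullet> u)) * (2 * (z \<bullet> u))) = g' z \<bullet> h" .
      qed
    qed
    show "(g' has_derivative H' z) (at z)" if z: "z \<in> cball b \<rho>" for z
    proof -
      let ?r = "z \<bullet> u"
      have rn: "?r \<noteq> 0" using rp[OF z] by simp
      have d1: "((\<lambda>z. inverse (z \<bullet> u)) has_derivative (\<lambda>h. - (inverse ?r * (h \<bullet> u) * inverse ?r))) (at z)"
        using rn by (intro Deriv.has_derivative_inverse has_derivative_inner_left has_derivative_ident)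
      have dP: "(P has_derivative P) (at z)" by (rule bounded_linear_imp_has_derivative[OF bl])
      have d2: "((\<lambda>z. (P z \<bullet> P z) * ((inverse (z \<bullet> u) * inverse (z \<bullet> u)) * (1/2))) has_derivative
         (\<lambda>h. (P z \<bullet> P z) * ((inverse ?r * (- (inverse ?r * (h \<bullet> u) * inverse ?r)) + (- (inverse ?r * (h \<bullet> u) * inverse ?r)) * inverse ?r) * (1/2))
            + (P z \<bullet> P h + P h \<bullet> P z) * ((inverse ?r * inverse ?r) * (1/2)))) (at z)"
        by (intro has_derivative_mult has_derivative_inner dP d1 has_derivative_mult_left)
      have "(g' has_derivative (\<lambda>h. (inverse ?r *\<^sub>R P h + (- (inverse ?r * (h \<bullet> u) * inverse ?r)) *\<^sub>R P z) -
         ((P z \<bullet> P z) * ((inverse ?r * (- (inverse ?r * (h \<bullet> u) * inverse ?r)) + (- (inverse ?r * (h \<bullet> u) * inverse ?r)) * inverse ?r) * (1/2))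
            + (P z \<bullet> P h + P h \<bullet> P z) * ((inverse ?r * inverse ?r) * (1/2))) *\<^sub>R u)) (at z)"
      proof -
        have "g' = (\<lambda>z. inverse (z \<bullet> u) *\<^sub>R P z - ((P z \<bullet> P z) * ((inverse (z \<bullet> u) * inverse (z \<bullet> u)) * (1/2))) *\<^sub>R u)"
        proof
          fix x
          have "c / (2 * r\<^sup>2) = c * ((inverse r * inverse r) * (1/2))" for c r :: real
            by (cases "r = 0") (simp_all add: power2_eq_square field_simps)
          then show "g' x = inverse (x \<bullet> u) *\<^sub>R P x - ((P x \<bullet> P x) * ((inverse (x \<bullet> u) * inverse (x \<bullet> u)) * (1/2))) *\<^sub>R u"
            unfolding g'_def by (simp only:)
        qed
        then show ?thesis
          using has_derivative_diff[OF has_derivative_scaleR[OF d1 dP] has_derivative_scaleR_left[OF d2, of u]]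
          by (simp only:)
      qed
      then show ?thesis
      proof (rule has_derivative_eq_rhs, intro ext)
        fix h
        have e1: "inverse ?r *\<^sub>R P h + (- (inverse ?r * (h \<bullet> u) * inverse ?r)) *\<^sub>R P z = L z h /\<^sub>R ?r"
          unfolding L_def by (simp only: scaleR_diff_right scaleR_scaleR divide_inverse scaleR_minus_left add_uminus_conv_diff mult.assoc)
        have arith: "a * ((i * (- (i * b * i)) + (- (i * b * i)) * i) * (1/2)) + (c + c) * ((i * i) * (1/2)) = i * ((c - b * i * a) * i)" for a b c i :: real
          by (simp add: algebra_simps)
        have "P z \<bullet> L z h = P z \<bullet> P h - (h \<bullet> u) * inverse ?r * (P z \<bullet> P z)"
          unfolding L_def by (simp only: inner_diff_right inner_scaleR_right divide_inverse)
        then have e2: "(P z \<bullet> P z) * ((inverse ?r * (- (inverse ?r * (h \<bullet> u) * inverse ?r)) + (- (inverse ?r * (h \<bullet> u) * inverse ?r)) * inverse ?r) * (1/2))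
            + (P z \<bullet> P h + P h \<bullet> P z) * ((inverse ?r * inverse ?r) * (1/2)) = inverse ?r * ((P z \<bullet> L z h) / ?r)"
          unfolding inner_commute[of "P h" "P z"] divide_inverse[of _ ?r] by (simp only: arith)
        show "(inverse ?r *\<^sub>R P h + (- (inverse ?r * (h \<bullet> u) * inverse ?r)) *\<^sub>R P z) -
         ((P z \<bullet> P z) * ((inverse ?r * (- (inverse ?r * (h \<bullet> u) * inverse ?r)) + (- (inverse ?r * (h \<bullet> u) * inverse ?r)) * inverse ?r) * (1/2))
            + (P z \<bullet> P h + P h \<bullet> P z) * ((inverse ?r * inverse ?r) * (1/2))) *\<^sub>R u = H' z h"
          unfolding e1 e2 H'_def by (simp add: scaleR_diff_right)
      qed
    qed
    show "selfadjoint (H' z)" if z: "z \<in> cball b \<rho>" for z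
      unfolding selfadjoint_def
    proof (intro conjI allI)
      show "linear (H' z)" unfolding H'_def
        by (rule linearI) (simp_all add: linear_add[OF linL] linear_cmul[OF linL] inner_add_right add_divide_distrib scaleR_add_left scaleR_diff_right scaleR_add_right mult.commute mult.left_commute)
      show "H' z x \<bullet> y = x \<bullet> H' z y" for x y
        using H'L[OF z, of x y] H'L[OF z, of y x] by (simp add: inner_commute)
    qed
    show "0 \<le> a \<bullet> H' z a" if z: "z \<in> cball b \<rho>" for z a
      using H'L[OF z, of a a] rp[OF z] by (simp add: inner_commute)
    show "norm (H' z a) \<le> 50 / \<beta> * norm a" if z: "z \<in> cball b \<rho>" for z a
    proof -
      let ?r = "z \<bullet> u"
      have quo: "norm z / ?r \<le> 4" using r[OF z] rp[OF z] \<beta> by (simp add: divide_le_eq)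
      have au: "\<bar>a \<bullet> u\<bar> \<le> norm a" using Cauchy_Schwarz_ineq2[of a u] u by simp
      have "norm (L z a) \<le> norm (P a) + \<bar>a \<bullet> u\<bar> / ?r * norm (P z)"
        unfolding L_def using norm_triangle_ineq4[of "P a" "((a \<bullet> u) / ?r) *\<^sub>R P z"] rp[OF z] by simp
      also have "\<dots> \<le> norm a + norm a / ?r * norm z"
        using Pn[of a] Pn[of z] au rp[OF z] by (intro add_mono mult_mono divide_right_mono) auto
      also have "\<dots> = norm a + norm a * (norm z / ?r)" by simp
      also have "\<dots> \<le> norm a + norm a * 4" using quo by (intro add_left_mono mult_left_mono) auto
      finally have Ln: "norm (L z a) \<le> 5 * norm a" by simp
      have "\<bar>P z \<bullet> L z a\<bar> \<le> norm (P z) * norm (L z a)" by (rule Cauchy_Schwarz_ineq2)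
      also have "\<dots> \<le> norm z * (5 * norm a)" using Pn[of z] Ln by (intro mult_mono) auto
      finally have "\<bar>P z \<bullet> L z a\<bar> / ?r \<le> norm z * (5 * norm a) / ?r" using rp[OF z] by (intro divide_right_mono) auto
      also have "\<dots> = (norm z / ?r) * (5 * norm a)" by simp
      also have "\<dots> \<le> 4 * (5 * norm a)" using quo by (intro mult_right_mono) auto
      finally have q2: "\<bar>P z \<bullet> L z a\<bar> / ?r \<le> 20 * norm a" by simp
      have "norm (L z a - ((P z \<bullet> L z a) / ?r) *\<^sub>R u) \<le> norm (L z a) + \<bar>P z \<bullet> L z a\<bar> / ?r"
        using norm_triangle_ineq4[of "L z a" "((P z \<bullet> L z a) / ?r) *\<^sub>R u"] rp[OF z] u by simp
      then have le25: "norm (L z a - ((P z \<bullet> L z a) / ?r) *\<^sub>R u) \<le> 25 * norm a" using Ln q2 by simp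
      have "norm (H' z a) = inverse ?r * norm (L z a - ((P z \<bullet> L z a) / ?r) *\<^sub>R u)"
        using rp[OF z] by (simp add: H'_def)
      also have "\<dots> \<le> (2 / \<beta>) * (25 * norm a)"
      proof (rule mult_mono[OF _ le25])
        have "inverse ?r \<le> inverse (\<beta> / 2)" using r(1)[OF z] \<beta> by (intro le_imp_inverse_le) auto
        then show "inverse ?r \<le> 2 / \<beta>" by simp
      qed (use \<beta> in auto)
      finally show ?thesis by simp
    qed
    \<comment> \<open>The form of \<open>dirhess z\<close> vanishes only on multiples of
      \<open>z\<close>, where \<open>L z\<close> vanishes too.\<close>
    show "0 < a \<bullet> dirhess z a" if z: "z \<in> cball b \<rho>" and pos: "0 < a \<bullet> H' z a" for z a
    proof (rule ccontr)
      assume "\<not> 0 < a \<bullet> dirhess z a"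
      then have "a \<bullet> dirhess z a = 0" using dirhess_psd[of a z] by simp
      then have "dirhess z a = 0" using selfadjoint_psd_kernel[OF dirhess_selfadjoint dirhess_psd] by blast
      moreover have "z \<noteq> 0" using rp[OF z] by auto
      ultimately have "a = ((z \<bullet> a) / (z \<bullet> z)) *\<^sub>R z" by (simp add: dirhess_def)
      then have "L z a = 0" using linear_cmul[OF linL] Lz[OF z] by (metis scaleR_zero_right)
      then show False using pos H'L[OF z, of a a] by (simp add: inner_commute)
    qed
    show "dim V' \<le> dim W" if z: "z \<in> cball b \<rho>" and V': "subspace V'" "\<And>a. a \<in> V' \<Longrightarrow> a \<noteq> 0 \<Longrightarrow> 0 < a \<bullet> H' z a" for z V'
    proof (rule dim_le_if_injective[OF linL V'(1)])
      show "L z a \<noteq> 0" if "a \<in> V'" "a \<noteq> 0" for a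
        using V'(2)[OF that] H'L[OF z, of a a] by (auto simp: inner_commute)
    qed (use LW in auto)
    show "\<beta> / 4 * (norm (\<sigma> z - \<sigma> z'))\<^sup>2 \<le> \<gamma> z - \<gamma> z' - g' z' \<bullet> (z - z')"
      if z: "z \<in> cball b \<rho>" and z': "z' \<in> cball b \<rho>" for z z'
    proof -
      \<comment> \<open>In terms of \<open>\<sigma>\<close> the first-order remainder is exactly
        \<open><z, u> / 2 * |\<sigma> z - \<sigma> z'|^2\<close>.\<close>
      define s s' r0 r' where "s = \<sigma> z" and "s' = \<sigma> z'" and "r0 = z \<bullet> u" and "r' = z' \<bullet> u"
      have rr: "r0 > 0" "r' > 0" "\<beta> / 2 \<le> r0" using rp z z' r(1) by (auto simp: r0_def r'_def)
      have Pz: "P z = r0 *\<^sub>R s" "P z' = r' *\<^sub>R s'" using rr by (auto simp: s_def s'_def r0_def r'_def \<sigma>_def)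
      have g1: "\<gamma> z = r0 / 2 * (s \<bullet> s)" "\<gamma> z' = r' / 2 * (s' \<bullet> s')"
        using rr unfolding \<gamma>_def r0_def[symmetric] r'_def[symmetric] Pz by (auto simp: field_simps)
      have g2: "g' z' = s' - ((s' \<bullet> s') / 2) *\<^sub>R u"
        using rr unfolding g'_def r'_def[symmetric] Pz by (auto simp: field_simps power2_eq_square)
      have "s' \<bullet> (z - z') = s' \<bullet> (P z - P z')"
      proof -
        have "s' = P s'" by (simp add: s'_def \<sigma>_def linear_cmul[OF P(1)] PP)
        then show ?thesis using Pi[of s' "z - z'"] linear_diff[OF P(1)] by simp
      qed
      then have g3: "g' z' \<bullet> (z - z') = r0 * (s' \<bullet> s) - r' * (s' \<bullet> s') - (s' \<bullet> s') / 2 * (r0 - r')"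
        unfolding g2 Pz by (simp add: inner_diff_left inner_diff_right r0_def r'_def inner_commute algebra_simps)
      have "\<gamma> z - \<gamma> z' - g' z' \<bullet> (z - z') = r0 / 2 * ((s - s') \<bullet> (s - s'))"
        unfolding g1 g3 by (simp add: inner_diff_left inner_diff_right inner_commute field_simps)
      moreover have "\<beta> / 4 * ((s - s') \<bullet> (s - s')) \<le> r0 / 2 * ((s - s') \<bullet> (s - s'))"
        using rr by (intro mult_right_mono) auto
      ultimately show ?thesis unfolding power2_norm_eq_inner s_def[symmetric] s'_def[symmetric] by simp
    qed
    show "continuous_on (cball b \<rho>) \<sigma>" unfolding \<sigma>_def
      using rp(2) by (intro continuous_on_scaleR continuous_on_inverse continuous_on_inner continuous_on_id continuous_on_const linear_continuous_on[OF bl]) auto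
    show "v x \<noteq> v b + y \<bullet> (x - b)" if x: "x \<in> cball b \<rho>" "x \<noteq> b" "\<sigma> x = \<sigma> b" for x
    proof
      assume "v x = v b + y \<bullet> (x - b)"
      then have "x - b \<in> V" by (rule contact)
      moreover have "P x = 0" using x(3) rp[OF x(1)] Pb by (simp add: \<sigma>_def)
      then have "P (x - b) = 0" using Pb linear_diff[OF P(1)] by simp
      ultimately show False using inj x(2) by force
    qed
    show "1 / \<beta> * norm (\<omega> - \<omega>') \<le> norm (g' (b + \<omega>) - g' (b + \<omega>'))" if \<omega>: "\<omega> \<in> W" "\<omega>' \<in> W" for \<omega> \<omega>'
    proof -
      have P\<omega>: "P (g' (b + x)) = x /\<^sub>R \<beta>" if "x \<in> W" for x
      proof -
        have "x \<bullet> u = 0" using uP[of x] P(3)[OF that] by simp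
        moreover have "P (b + x) = x" using Pb P(3)[OF that] linear_add[OF P(1)] by simp
        ultimately show ?thesis
          by (simp add: g'_def inner_add_left bu linear_diff[OF P(1)] linear_cmul[OF P(1)] Pu P(3)[OF that])
      qed
      have "1 / \<beta> * norm (\<omega> - \<omega>') = norm (P (g' (b + \<omega>)) - P (g' (b + \<omega>')))"
        unfolding P\<omega>[OF \<omega>(1)] P\<omega>[OF \<omega>(2)] using \<beta> by (simp add: scaleR_diff_right[symmetric] divide_inverse)
      also have "\<dots> = norm (P (g' (b + \<omega>) - g' (b + \<omega>')))" by (simp add: linear_diff[OF P(1)])
      also have "\<dots> \<le> norm (g' (b + \<omega>) - g' (b + \<omega>'))" by (rule Pn)
      finally show ?thesis .
    qed
  qed (use bV W \<rho> \<beta> in auto)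
  then show ?thesis using W by simp
qed

end

section \<open>The mass at the origin\<close>

text \<open>The one-sided directional derivative at 0: the quotients of a convex function decrease
  as the step shrinks, so the limit is an infimum.\<close>

definition dirderiv0 :: "('a::real_vector \<Rightarrow> real) \<Rightarrow> 'a \<Rightarrow> real" where
  "dirderiv0 v z = (INF s\<in>{0<..}. (v (s *\<^sub>R z) - v 0) / s)"

locale convex_at_zero =
  fixes v :: "'a::euclidean_space \<Rightarrow> real"
  assumes convex: "convex_on UNIV v"
begin

text \<open>The origin lies between \<open>s z\<close> and \<open>- z\<close>, and convexity there
  bounds the quotients below uniformly in \<open>s\<close>, which keeps the infimum finite.\<close>

lemma quotient_lower: "0 < s \<Longrightarrow> v 0 - v (- z) \<le> (v (s *\<^sub>R z) - v 0) / s"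
proof -
  assume s: "0 < s"
  have "(1 - s / (1 + s)) *\<^sub>R (s *\<^sub>R z) + (s / (1 + s)) *\<^sub>R (- z) = 0"
  proof -
    have "(1 - s / (1 + s)) * s = s / (1 + s)" using s by (simp add: field_simps)
    then show ?thesis by simp
  qed
  moreover have "0 \<le> s / (1 + s)" "s / (1 + s) \<le> 1" using s by auto
  ultimately have "v 0 \<le> (1 - s / (1 + s)) * v (s *\<^sub>R z) + (s / (1 + s)) * v (- z)"
    using convex_onD[OF convex, of "s / (1 + s)" "s *\<^sub>R z" "- z"] by (simp only: UNIV_I)
  then have "(1 + s) * v 0 \<le> (1 + s) * ((1 - s / (1 + s)) * v (s *\<^sub>R z) + (s / (1 + s)) * v (- z))" using s by simp
  also have "\<dots> = ((1 + s) * (1 - s / (1 + s))) * v (s *\<^sub>R z) + ((1 + s) * (s / (1 + s))) * v (- z)"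
    by (simp only: distrib_left mult.assoc)
  also have "(1 + s) * (1 - s / (1 + s)) = 1" using s by (simp add: field_simps)
  also have "(1 + s) * (s / (1 + s)) = s" using s by simp
  finally show ?thesis using s by (simp add: field_simps)
qed

lemma dirderiv0_le: "0 < s \<Longrightarrow> dirderiv0 v z \<le> (v (s *\<^sub>R z) - v 0) / s"
  unfolding dirderiv0_def
  by (rule cINF_lower) (auto intro!: bdd_belowI[of _ "v 0 - v (- z)"] quotient_lower)

lemma dirderiv0_greatest: "(\<And>s. 0 < s \<Longrightarrow> c \<le> (v (s *\<^sub>R z) - v 0) / s) \<Longrightarrow> c \<le> dirderiv0 v z"
  unfolding dirderiv0_def by (rule cINF_greatest) auto

lemma quotient_mono:
  assumes s: "0 < s" "s \<le> s'"
  shows "(v (s *\<^sub>R z) - v 0) / s \<le> (v (s' *\<^sub>R z) - v 0) / s'"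
proof -
  have "(1 - s / s') *\<^sub>R 0 + (s / s') *\<^sub>R (s' *\<^sub>R z) = s *\<^sub>R z" using s by simp
  then have "v (s *\<^sub>R z) \<le> (1 - s / s') * v 0 + (s / s') * v (s' *\<^sub>R z)"
    using convex_onD[OF convex, of "s / s'" 0 "s' *\<^sub>R z"] s by simp
  then have "v (s *\<^sub>R z) - v 0 \<le> (s / s') * (v (s' *\<^sub>R z) - v 0)" by (simp add: algebra_simps)
  then have "(v (s *\<^sub>R z) - v 0) / s \<le> (s / s') * (v (s' *\<^sub>R z) - v 0) / s" using s by (intro divide_right_mono) auto
  also have "\<dots> = (v (s' *\<^sub>R z) - v 0) / s'" using s by simp
  finally show ?thesis .
qed

lemma dirderiv0_homogeneous: "0 \<le> c \<Longrightarrow> dirderiv0 v (c *\<^sub>R z) = c * dirderiv0 v z"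
proof -
  have le: "dirderiv0 v (c *\<^sub>R z) \<le> c * dirderiv0 v z" if c: "0 < c" for c z
  proof -
    have "dirderiv0 v (c *\<^sub>R z) / c \<le> dirderiv0 v z"
    proof (rule dirderiv0_greatest)
      fix s :: real assume s: "0 < s"
      have "dirderiv0 v (c *\<^sub>R z) \<le> (v ((s / c) *\<^sub>R (c *\<^sub>R z)) - v 0) / (s / c)"
        using s c by (intro dirderiv0_le) simp
      also have "\<dots> = c * ((v (s *\<^sub>R z) - v 0) / s)" using c by (simp add: field_simps)
      finally show "dirderiv0 v (c *\<^sub>R z) / c \<le> (v (s *\<^sub>R z) - v 0) / s" using c by (simp add: field_simps)
    qed
    then show ?thesis using c by (simp add: field_simps)
  qed
  assume "0 \<le> c"
  show ?thesis
  proof (cases "c = 0")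
    case True then show ?thesis by (simp add: dirderiv0_def)
  next
    case False
    then have c: "c > 0" using \<open>0 \<le> c\<close> by simp
    have "dirderiv0 v z \<le> inverse c * dirderiv0 v (c *\<^sub>R z)" using le[of "inverse c" "c *\<^sub>R z"] c by simp
    then have "c * dirderiv0 v z \<le> dirderiv0 v (c *\<^sub>R z)" using c by (simp add: field_simps)
    then show ?thesis using le[OF c, of z] by simp
  qed
qed

lemma dirderiv0_convex: "convex_on UNIV (dirderiv0 v)"
proof (rule convex_onI)
  fix t :: real and x y :: 'a assume t: "0 < t" "t < 1"
  show "dirderiv0 v ((1 - t) *\<^sub>R x + t *\<^sub>R y) \<le> (1 - t) * dirderiv0 v x + t * dirderiv0 v y"
  proof (rule field_le_epsilon)
    fix e :: real assume e: "e > 0"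
    have ex: "\<exists>s>0. (v (s *\<^sub>R z) - v 0) / s < dirderiv0 v z + e" for z
    proof (rule ccontr)
      assume "\<not> ?thesis"
      then have "dirderiv0 v z + e \<le> dirderiv0 v z" by (intro dirderiv0_greatest) (meson not_less)
      then show False using e by simp
    qed
    obtain s1 where s1: "s1 > 0" "(v (s1 *\<^sub>R x) - v 0) / s1 < dirderiv0 v x + e" using ex by blast
    obtain s2 where s2: "s2 > 0" "(v (s2 *\<^sub>R y) - v 0) / s2 < dirderiv0 v y + e" using ex by blast
    \<comment> \<open>Smaller steps only lower the quotients, so one common step serves both
      directions.\<close>
    define s where "s = min s1 s2"
    have s: "s > 0" "s \<le> s1" "s \<le> s2" using s1 s2 by (auto simp: s_def)
    have "s *\<^sub>R ((1 - t) *\<^sub>R x + t *\<^sub>R y) = (1 - t) *\<^sub>R (s *\<^sub>R x) + t *\<^sub>R (s *\<^sub>R y)"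
      by (simp add: scaleR_add_right mult.commute)
    then have "v (s *\<^sub>R ((1 - t) *\<^sub>R x + t *\<^sub>R y)) \<le> (1 - t) * v (s *\<^sub>R x) + t * v (s *\<^sub>R y)"
      using convex_onD[OF convex, of t "s *\<^sub>R x" "s *\<^sub>R y"] t by simp
    then have "v (s *\<^sub>R ((1 - t) *\<^sub>R x + t *\<^sub>R y)) - v 0 \<le> (1 - t) * (v (s *\<^sub>R x) - v 0) + t * (v (s *\<^sub>R y) - v 0)"
      by (simp add: algebra_simps)
    then have "(v (s *\<^sub>R ((1 - t) *\<^sub>R x + t *\<^sub>R y)) - v 0) / s \<le> ((1 - t) * (v (s *\<^sub>R x) - v 0) + t * (v (s *\<^sub>R y) - v 0)) / s"
      using s by (intro divide_right_mono) auto
    also have "\<dots> = (1 - t) * ((v (s *\<^sub>R x) - v 0) / s) + t * ((v (s *\<^sub>R y) - v 0) / s)"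
      by (simp add: add_divide_distrib)
    also have "\<dots> \<le> (1 - t) * (dirderiv0 v x + e) + t * (dirderiv0 v y + e)"
      using quotient_mono[OF s(1,2), of x] quotient_mono[OF s(1,3), of y] s1 s2 t
      by (intro add_mono mult_left_mono) auto
    also have "\<dots> = (1 - t) * dirderiv0 v x + t * dirderiv0 v y + e" by (simp add: algebra_simps)
    finally show "dirderiv0 v ((1 - t) *\<^sub>R x + t *\<^sub>R y) \<le> (1 - t) * dirderiv0 v x + t * dirderiv0 v y + e"
      using dirderiv0_le[OF s(1), of "(1 - t) *\<^sub>R x + t *\<^sub>R y"] by simp
  qed
qed simp

text \<open>Dividing the subgradient inequality at \<open>s z\<close> by \<open>s\<close> and taking
  the infimum leaves a condition on the directional derivative.\<close>

lemma subdiff_at_zero_iff: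
  assumes t: "0 \<le> t"
  shows "w \<in> subdiff (\<lambda>x. v x + t * norm x) 0 \<longleftrightarrow> (\<forall>z. w \<bullet> z \<le> dirderiv0 v z + t * norm z)"
proof (intro iffI allI)
  fix z assume w: "w \<in> subdiff (\<lambda>x. v x + t * norm x) 0"
  have "w \<bullet> z - t * norm z \<le> dirderiv0 v z"
  proof (rule dirderiv0_greatest)
    fix s :: real assume s: "0 < s"
    have "s * (w \<bullet> z - t * norm z) \<le> v (s *\<^sub>R z) - v 0"
      using subdiffD[OF w, of "s *\<^sub>R z"] s by (simp add: algebra_simps)
    then show "w \<bullet> z - t * norm z \<le> (v (s *\<^sub>R z) - v 0) / s" using s by (simp add: field_simps)
  qed
  then show "w \<bullet> z \<le> dirderiv0 v z + t * norm z" by simp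
next
  assume w: "\<forall>z. w \<bullet> z \<le> dirderiv0 v z + t * norm z"
  show "w \<in> subdiff (\<lambda>x. v x + t * norm x) 0"
  proof (rule subdiffI)
    fix z
    show "v 0 + t * norm (0::'a) + w \<bullet> (z - 0) \<le> v z + t * norm z"
      using spec[OF w, of z] dirderiv0_le[of 1 z] by simp
  qed
qed

text \<open>The subdifferential of \<open>v + t|\<cdot>|\<close> at the kink \<open>0\<close> is a gradient image of a quadratic perturbation: its
  elements are the \<open>y + t \<eta>\<close> with \<open>y\<close> the metric projection onto the subdifferential of \<open>v\<close> at \<open>0\<close>.\<close>
lemma subdiff_at_zero:
  assumes t: "0 < t"
  shows "subdiff (\<lambda>x. v x + t * norm x) 0 = (\<Union>z\<in>cball 0 1. subdiff (\<lambda>x. dirderiv0 v x + t * ((norm x)\<^sup>2 / 2)) z)"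
proof -
  have iff: "w \<in> subdiff (\<lambda>x. dirderiv0 v x + t * ((norm x)\<^sup>2 / 2)) z \<longleftrightarrow> w - t *\<^sub>R z \<in> subdiff (dirderiv0 v) z" for w z
    by (rule subdiff_add_smooth[OF dirderiv0_convex half_norm_square_convex half_norm_square_gradient]) (use t in simp)
  have v00: "dirderiv0 v 0 = 0" by (simp add: dirderiv0_def)
  have hom: "dirderiv0 v z = y \<bullet> z \<and> (\<forall>x. y \<bullet> x \<le> dirderiv0 v x)" if y: "y \<in> subdiff (dirderiv0 v) z" for y z
  proof -
    have "dirderiv0 v (2 *\<^sub>R z) = 2 * dirderiv0 v z" by (rule dirderiv0_homogeneous) simp
    then have eq: "dirderiv0 v z = y \<bullet> z"
      using subdiffD[OF y, of 0] subdiffD[OF y, of "2 *\<^sub>R z"] v00 by (simp add: inner_diff_right)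
    then show ?thesis using subdiffD[OF y] by (simp add: inner_diff_right)
  qed
  show ?thesis
  proof (intro equalityI subsetI)
    fix w assume "w \<in> subdiff (\<lambda>x. v x + t * norm x) 0"
    then have w: "\<And>z. w \<bullet> z \<le> dirderiv0 v z + t * norm z" using subdiff_at_zero_iff t by auto
    \<comment> \<open>With \<open>v'\<close> the directional derivative, the proximal point
      \<open>z\<close> of \<open>v' / t\<close> at \<open>w / t\<close> splits \<open>w\<close> into
      \<open>t z\<close> and a subgradient of \<open>v'\<close> at \<open>z\<close>.\<close>
    have "convex_on UNIV (\<lambda>z. inverse t * dirderiv0 v z)" using t by (intro convex_on_cmul dirderiv0_convex) simp
    from convex_proximal_point_exists[OF this, of "inverse t *\<^sub>R w"]
    obtain z where z: "inverse t *\<^sub>R w - z \<in> subdiff (\<lambda>z. inverse t * dirderiv0 v z) z" by blast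
    have y: "w - t *\<^sub>R z \<in> subdiff (dirderiv0 v) z"
    proof (rule subdiffI)
      fix x
      have "t * (inverse t * dirderiv0 v z + (inverse t *\<^sub>R w - z) \<bullet> (x - z)) \<le> t * (inverse t * dirderiv0 v x)"
        using subdiffD[OF z, of x] t by (intro mult_left_mono) auto
      moreover have "t * ((inverse t *\<^sub>R w - z) \<bullet> (x - z)) = (w - t *\<^sub>R z) \<bullet> (x - z)"
        using t by (simp add: inner_diff_left right_diff_distrib)
      ultimately show "dirderiv0 v z + (w - t *\<^sub>R z) \<bullet> (x - z) \<le> dirderiv0 v x"
        using t by (simp add: distrib_left mult.assoc[symmetric])
    qed
    \<comment> \<open>Testing \<open>w\<close> against \<open>z\<close> itself gives
      \<open>|z|^2 \<le> |z|\<close>.\<close>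
    have "w \<bullet> z \<le> (w - t *\<^sub>R z) \<bullet> z + t * norm z" using w[of z] hom[OF y] by simp
    then have "t * (norm z * norm z) \<le> t * norm z" by (simp add: inner_diff_left dot_square_norm power2_eq_square)
    then have "norm z * norm z \<le> norm z" using t by simp
    then have "norm z \<le> 1"
      using mult_strict_left_mono[of 1 "norm z" "norm z"] by linarith
    then show "w \<in> (\<Union>z\<in>cball 0 1. subdiff (\<lambda>x. dirderiv0 v x + t * ((norm x)\<^sup>2 / 2)) z)"
      using y iff by auto
  next
    fix w assume "w \<in> (\<Union>z\<in>cball 0 1. subdiff (\<lambda>x. dirderiv0 v x + t * ((norm x)\<^sup>2 / 2)) z)"
    then obtain z where z: "norm z \<le> 1" "w - t *\<^sub>R z \<in> subdiff (dirderiv0 v) z" using iff by auto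
    have "w \<bullet> x \<le> dirderiv0 v x + t * norm x" for x
    proof -
      have "(w - t *\<^sub>R z) \<bullet> x \<le> dirderiv0 v x" using hom[OF z(2)] by blast
      moreover have "z \<bullet> x \<le> norm x"
        using norm_cauchy_schwarz[of z x] z(1) mult_right_mono[OF z(1), of "norm x"] by simp
      then have "t * (z \<bullet> x) \<le> t * norm x" using t by simp
      ultimately show ?thesis by (simp add: inner_diff_left)
    qed
    then show "w \<in> subdiff (\<lambda>x. v x + t * norm x) 0" using subdiff_at_zero_iff t by auto
  qed
qed

end

section \<open>Balls that may contain the origin\<close>

text \<open>Refers to \<open>MA\<close> only; the expansion that characterises the mixed measures
  makes it a binomial multiple of the one with \<open>d\<close> copies of the norm.\<close>

definition ball_coeff :: "('a::euclidean_space \<Rightarrow> real) \<Rightarrow> 'a set \<Rightarrow> nat \<Rightarrow> real" where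
  "ball_coeff v B d = (\<Sum>i\<le>DIM('a). interp DIM('a) d i * MA (\<lambda>x. v x + real (Suc i) * norm x) B)"

context
  fixes v :: "real^'n::{finite,wellorder} \<Rightarrow> real" and x :: "real^'n::{finite,wellorder}" and e :: real
  assumes v: "convex_on UNIV v"
begin

interpretation N: norm_perturbation v "ball x e - {0}"
  using v by unfold_locales (auto simp: bounded_diff open_delete)

interpretation Z: convex_at_zero v using v by unfold_locales

interpretation Q: quadratic_perturbation "dirderiv0 v"
  by unfold_locales (auto simp: Z.dirderiv0_convex Z.dirderiv0_homogeneous)

text \<open>The subgradient images of the origin and of the punctured ball overlap in a null set, so
  their measures add.\<close>

lemma lmeasurable_subdiff_ball:
  assumes t: "0 < t"
  shows "(\<Union>z\<in>ball x e. subdiff (\<lambda>x. v x + t * norm x) z) \<in> lmeasurable"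
    "0 \<in> ball x e \<Longrightarrow> MA (\<lambda>x. v x + t * norm x) (ball x e) =
       MA (\<lambda>x. v x + t * norm x) (ball x e - {0}) + MA (\<lambda>x. dirderiv0 v x + t * ((norm x)\<^sup>2 / 2)) (cball 0 1)"
proof -
  let ?S = "\<lambda>z. subdiff (\<lambda>x. v x + t * norm x) z"
  have A: "(\<Union>z\<in>ball x e - {0}. ?S z) \<in> lmeasurable" by (rule N.lmeasurable_subdiff_image[OF t])
  have C: "?S 0 \<in> lmeasurable" unfolding Z.subdiff_at_zero[OF t] by (rule Q.lmeasurable_subdiff_image[OF t])
  have split: "(\<Union>z\<in>ball x e. ?S z) = (\<Union>z\<in>ball x e - {0}. ?S z) \<union> ?S 0" if "0 \<in> ball x e" using that by blast
  show "(\<Union>z\<in>ball x e. ?S z) \<in> lmeasurable"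
  proof (cases "0 \<in> ball x e")
    case True show ?thesis unfolding split[OF True] by (rule fmeasurable.Un[OF A C])
  qed (use A in simp)
  assume 0: "0 \<in> ball x e"
  have "negligible ((\<Union>z\<in>ball x e - {0}. ?S z) \<inter> ?S 0)"
  proof (rule negligible_subset[OF N.negligible_not_unique[OF t]], clarify)
    fix w z assume "z \<in> ball x e" "z \<noteq> 0" "w \<in> ?S z" "w \<in> ?S 0"
    then show "\<exists>z\<in>ball x e - {0}. \<exists>z'. z' \<noteq> z \<and> w \<in> ?S z \<and> w \<in> ?S z'"
      by (intro bexI[of _ z] exI[of _ 0]) auto
  qed
  then have "measure lebesgue ((\<Union>z\<in>ball x e - {0}. ?S z) \<union> ?S 0) = measure lebesgue (\<Union>z\<in>ball x e - {0}. ?S z) + measure lebesgue (?S 0)"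
    using measure_Un3[OF A C] by (simp add: negligible_imp_measure0)
  then show "MA (\<lambda>x. v x + t * norm x) (ball x e) =
       MA (\<lambda>x. v x + t * norm x) (ball x e - {0}) + MA (\<lambda>x. dirderiv0 v x + t * ((norm x)\<^sup>2 / 2)) (cball 0 1)"
    unfolding MA_def split[OF 0] Z.subdiff_at_zero[OF t] .
qed

lemma ball_coeff_split:
  "ball_coeff v (ball x e) d = N.MA_coeff d + (if 0 \<in> ball x e then Q.MA_coeff d else 0)"
proof (cases "0 \<in> ball x e")
  case True
  then show ?thesis
    unfolding ball_coeff_def N.MA_coeff_def Q.MA_coeff_def
    by (simp add: lmeasurable_subdiff_ball(2) distrib_left sum.distrib del: of_nat_Suc mem_ball)
next
  case False
  then have "ball x e - {0} = ball x e" by auto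
  then show ?thesis using False unfolding ball_coeff_def N.MA_coeff_def by simp
qed

text \<open>Both summands are nonnegative, so a positive coefficient is positive in one of them and
  persists there.\<close>

lemma ball_coeff_pos_mono:
  assumes d: "d1 \<le> d2" "d2 < CARD('n)" and pos: "0 < ball_coeff v (ball x e) d1"
  shows "0 < ball_coeff v (ball x e) d2"
proof -
  have nn: "0 \<le> N.MA_coeff d2" "0 \<le> Q.MA_coeff d2" using N.MA_coeff(1) Q.MA_coeff(1) d by auto
  consider "0 < N.MA_coeff d1" | "0 \<in> ball x e" "0 < Q.MA_coeff d1"
    using pos N.MA_coeff(1)[of d1] d unfolding ball_coeff_split by (cases "0 \<in> ball x e"; fastforce)
  then show ?thesis
  proof cases
    case 1
    from N.MA_coeff_pos_mono[OF d this] show ?thesis using nn unfolding ball_coeff_split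
      by (smt (verit, best))
  next
    case 2
    from Q.MA_coeff_pos_mono[OF d this(2)] show ?thesis using nn unfolding ball_coeff_split if_P[OF 2(1)] by linarith
  qed
qed

end

section \<open>Transfer to coordinates\<close>

text \<open>The change of variables theorems of the library are stated for \<open>real^'n\<close> with a well-ordered index type;
  this type provides such a model of an arbitrary Euclidean space.\<close>
typedef (overloaded) ('a::euclidean_space) basis_index = "{..<DIM('a)}"
  using DIM_positive by blast

instantiation basis_index :: (euclidean_space) "{finite, wellorder}"
begin

definition less_basis_index :: "'a basis_index \<Rightarrow> 'a basis_index \<Rightarrow> bool" where
  "less_basis_index i j \<longleftrightarrow> Rep_basis_index i < Rep_basis_index j"

definition less_eq_basis_index :: "'a basis_index \<Rightarrow> 'a basis_index \<Rightarrow> bool" where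
  "less_eq_basis_index i j \<longleftrightarrow> Rep_basis_index i \<le> Rep_basis_index j"

instance
proof
  show "finite (UNIV :: 'a basis_index set)"
    by (subst type_definition.Abs_image[OF type_definition_basis_index, symmetric]) simp
  show "P i" if step: "\<And>i. (\<And>j. j < i \<Longrightarrow> P j) \<Longrightarrow> P i" for P and i :: "'a basis_index"
  proof (rule measure_induct_rule[of Rep_basis_index P])
    fix i :: "'a basis_index" assume IH: "\<And>j. Rep_basis_index j < Rep_basis_index i \<Longrightarrow> P j"
    show "P i" by (rule step, rule IH, simp only: less_basis_index_def)
  qed
next
  fix i j k :: "'a basis_index"
  show "i < j \<longleftrightarrow> i \<le> j \<and> \<not> j \<le> i" "i \<le> i" "i \<le> j \<or> j \<le> i"
    unfolding less_basis_index_def less_eq_basis_index_def by linarith+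
  show "i \<le> j \<Longrightarrow> j \<le> k \<Longrightarrow> i \<le> k"
    unfolding less_eq_basis_index_def by (rule order_trans)
  show "i \<le> j \<Longrightarrow> j \<le> i \<Longrightarrow> i = j"
    unfolding less_eq_basis_index_def by (rule Rep_basis_index_inject[THEN iffD1]) (rule antisym)
qed

end

lemma card_basis_index: "CARD('a::euclidean_space basis_index) = DIM('a)"
  using type_definition.card[OF type_definition_basis_index] by simp

definition basis_enum :: "'a::euclidean_space basis_index \<Rightarrow> 'a" where
  "basis_enum = (SOME f. bij_betw f UNIV Basis)"

lemma basis_enum: "bij_betw basis_enum UNIV (Basis :: 'a::euclidean_space set)"
proof -
  have "\<exists>f. bij_betw f (UNIV :: 'a basis_index set) (Basis :: 'a set)"
    by (rule finite_same_card_bij) (simp_all add: card_basis_index)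
  then show ?thesis unfolding basis_enum_def by (rule someI_ex)
qed

definition to_vec :: "'a::euclidean_space \<Rightarrow> real^('a basis_index)" where
  "to_vec x = (\<chi> i. x \<bullet> basis_enum i)"

definition of_vec :: "real^('a basis_index) \<Rightarrow> 'a::euclidean_space" where
  "of_vec y = (\<Sum>i\<in>UNIV. y $ i *\<^sub>R basis_enum i)"

lemma sum_basis_enum: "(\<Sum>i\<in>UNIV. h (basis_enum i)) = (\<Sum>b\<in>(Basis :: 'a::euclidean_space set). h b)"
  by (rule sum.reindex_bij_betw[OF basis_enum])

lemma of_vec_to_vec [simp]: "of_vec (to_vec x) = x"
  unfolding of_vec_def to_vec_def using sum_basis_enum[of "\<lambda>b. (x \<bullet> b) *\<^sub>R b"] by (simp add: euclidean_representation)

lemma basis_enum_inner: "basis_enum i \<bullet> basis_enum j = (if i = j then 1 else 0 :: real)"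
proof -
  have "basis_enum i \<in> Basis" "basis_enum j \<in> Basis" "basis_enum i = basis_enum j \<longleftrightarrow> i = j"
    using basis_enum by (auto simp: bij_betw_def inj_on_def)
  then show ?thesis by (simp add: inner_Basis)
qed

lemma to_vec_of_vec [simp]: "to_vec (of_vec y) = y"
  unfolding of_vec_def to_vec_def
  by (simp add: vec_eq_iff inner_sum_left basis_enum_inner if_distrib[of "\<lambda>c. _ * c"] cong: if_cong)

lemma to_vec_inner [simp]: "to_vec x \<bullet> to_vec y = x \<bullet> y"
proof -
  have "to_vec x \<bullet> to_vec y = (\<Sum>b\<in>Basis. (x \<bullet> b) * (y \<bullet> b))"
    using sum_basis_enum[of "\<lambda>b. (x \<bullet> b) * (y \<bullet> b)"] by (simp add: to_vec_def inner_vec_def)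
  then show ?thesis by (simp add: euclidean_inner[of x y])
qed

lemma linear_to_vec: "linear to_vec"
  by (rule linearI) (simp_all add: to_vec_def vec_eq_iff inner_add_left)

lemma linear_of_vec: "linear of_vec"
  by (rule linearI) (simp_all add: of_vec_def scaleR_add_left sum.distrib scaleR_sum_right)

lemma norm_to_vec [simp]: "norm (to_vec x) = norm x"
  by (simp add: norm_eq_sqrt_inner)

lemma norm_of_vec [simp]: "norm (of_vec y) = norm y"
  by (metis norm_to_vec to_vec_of_vec)

lemma to_vec_image_ball: "to_vec ` ball x e = ball (to_vec x) e"
proof -
  have d: "dist (to_vec x) (to_vec y) = dist x y" for x y :: 'a
    by (simp add: dist_norm linear_diff[OF linear_to_vec, symmetric])
  show ?thesis
  proof (intro equalityI subsetI)
    fix z assume "z \<in> ball (to_vec x) e"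
    then have "of_vec z \<in> ball x e" using d[of x "of_vec z"] by simp
    then show "z \<in> to_vec ` ball x e" by (intro image_eqI[of _ _ "of_vec z"]) auto
  qed (auto simp: d)
qed

lemma lborel_distr_to_vec: "(lborel :: (real^('a::euclidean_space basis_index)) measure) = distr lborel borel to_vec"
proof (rule lborel_eqI)
  have [measurable]: "(to_vec :: 'a \<Rightarrow> _) \<in> borel_measurable borel"
    by (intro borel_measurable_continuous_onI linear_continuous_on) (simp add: linear_to_vec linear_conv_bounded_linear[symmetric])
  fix l u :: "real^('a basis_index)" assume lu: "\<And>b. b \<in> Basis \<Longrightarrow> l \<bullet> b \<le> u \<bullet> b"
  have lu': "l $ i \<le> u $ i" for i using lu[of "axis i 1"] by (simp add: inner_axis axis_in_Basis_iff)
  have comp: "of_vec y \<bullet> basis_enum i = y $ i" for y :: "real^('a basis_index)" and i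
    using to_vec_of_vec[of y] by (simp add: to_vec_def vec_eq_iff)
  have vim: "to_vec -` box l u = box (of_vec l) (of_vec u :: 'a)"
  proof -
    have "to_vec x \<in> box l u \<longleftrightarrow> x \<in> box (of_vec l) (of_vec u)" for x :: 'a
    proof -
      have "to_vec x \<in> box l u \<longleftrightarrow> (\<forall>i. l $ i < x \<bullet> basis_enum i \<and> x \<bullet> basis_enum i < u $ i)"
        by (simp add: mem_box_cart to_vec_def)
      also have "\<dots> \<longleftrightarrow> (\<forall>b\<in>basis_enum ` UNIV. of_vec l \<bullet> b < x \<bullet> b \<and> x \<bullet> b < of_vec u \<bullet> b)"
        by (simp add: comp)
      also have "basis_enum ` UNIV = (Basis :: 'a set)" by (rule bij_betw_imp_surj_on[OF basis_enum])
      finally show ?thesis unfolding mem_box(1) .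
    qed
    then show ?thesis by auto
  qed
  have le: "of_vec l \<bullet> b \<le> of_vec u \<bullet> b" if b: "b \<in> Basis" for b :: 'a
  proof -
    have "b \<in> basis_enum ` UNIV" using b by (simp add: bij_betw_imp_surj_on[OF basis_enum])
    then show ?thesis using comp lu' by auto
  qed
  have "emeasure (distr lborel borel to_vec) (box l u) = emeasure lborel (box (of_vec l) (of_vec u :: 'a))"
    by (subst emeasure_distr) (auto simp: vim)
  also have "\<dots> = (\<Prod>b\<in>Basis. (of_vec u - of_vec l) \<bullet> (b :: 'a))"
    using le by (simp add: emeasure_lborel_box_eq)
  also have "(\<Prod>b\<in>Basis. (of_vec u - of_vec l) \<bullet> (b :: 'a)) = (\<Prod>i\<in>UNIV. (of_vec u - of_vec l) \<bullet> (basis_enum i :: 'a))"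
    by (rule prod.reindex_bij_betw[OF basis_enum, symmetric])
  also have "\<dots> = (\<Prod>i\<in>UNIV. (u - l) \<bullet> axis i 1)"
    by (simp add: inner_diff_left comp inner_axis)
  also have "\<dots> = (\<Prod>b\<in>Basis. (u - l) \<bullet> b)"
  proof -
    have "bij_betw (\<lambda>i. axis i (1::real)) UNIV (Basis :: (real^('a basis_index)) set)"
      by (auto simp: bij_betw_def inj_on_def Basis_vec_def axis_eq_axis)
    from prod.reindex_bij_betw[OF this, of "\<lambda>b. (u - l) \<bullet> b"] show ?thesis by simp
  qed
  finally show "emeasure (distr lborel borel to_vec) (box l u) = (\<Prod>b\<in>Basis. (u - l) \<bullet> b)" .
qed simp

lemma measure_vimage_to_vec:
  fixes A :: "(real^('a::euclidean_space basis_index)) set"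
  assumes A: "A \<in> sets lebesgue"
  shows "measure lebesgue (to_vec -` A :: 'a set) = measure lebesgue A"
proof -
  have m: "(to_vec :: 'a \<Rightarrow> _) \<in> borel_measurable borel"
    by (intro borel_measurable_continuous_onI linear_continuous_on) (simp add: linear_to_vec linear_conv_bounded_linear[symmetric])
  have vb: "to_vec -` C \<in> sets (borel :: 'a measure)" if "C \<in> sets borel" for C
    using measurable_sets[OF m that] by simp
  have em: "emeasure lborel (to_vec -` C :: 'a set) = emeasure lborel C" if "C \<in> sets borel" for C
    by (subst lborel_distr_to_vec, subst emeasure_distr) (use m that in auto)
  obtain C N where C: "C \<in> sets borel" "negligible N" "C \<union> N = A"
    using sets_lebesgue_almost_borel[OF A] .
  have "N \<in> null_sets lebesgue" using C(2) by (simp add: negligible_iff_null_sets)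
  then obtain N' where N': "N' \<in> null_sets lborel" "N \<subseteq> N'" using null_sets_completion_iff2 by metis
  have "to_vec -` N' \<in> null_sets (lborel :: 'a measure)"
    using N'(1) em[of N'] vb[of N'] by (simp add: null_sets_def)
  then have n: "to_vec -` N \<in> null_sets (lebesgue :: 'a measure)"
    using N'(2) null_sets_completion_iff2 by (metis vimage_mono)
  have "measure lebesgue (to_vec -` A :: 'a set) = measure lebesgue (to_vec -` C :: 'a set)"
    using n vb[OF C(1)] C(3)[symmetric] by (simp add: measure_Un_null_set vimage_Un)
  also have "\<dots> = measure lebesgue C"
    using vb[OF C(1)] C(1) em[OF C(1)] by (simp add: measure_def)
  also have "\<dots> = measure lebesgue A"
    using C \<open>N \<in> null_sets lebesgue\<close> by (subst C(3)[symmetric], subst measure_Un_null_set) auto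
  finally show ?thesis .
qed

lemma subdiff_to_vec: "w \<in> subdiff f b \<longleftrightarrow> to_vec w \<in> subdiff (f \<circ> of_vec) (to_vec b)"
proof
  assume w: "w \<in> subdiff f b"
  show "to_vec w \<in> subdiff (f \<circ> of_vec) (to_vec b)"
  proof (rule subdiffI)
    fix z
    have "z - to_vec b = to_vec (of_vec z - b)" by (simp add: linear_diff[OF linear_to_vec])
    then show "(f \<circ> of_vec) (to_vec b) + to_vec w \<bullet> (z - to_vec b) \<le> (f \<circ> of_vec) z"
      using subdiffD[OF w, of "of_vec z"] by simp
  qed
next
  assume w: "to_vec w \<in> subdiff (f \<circ> of_vec) (to_vec b)"
  show "w \<in> subdiff f b"
    by (rule subdiffI) (use subdiffD[OF w, of "to_vec _"] in \<open>simp add: linear_diff[OF linear_to_vec, symmetric]\<close>)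
qed

lemma MA_to_vec:
  assumes "(\<Union>b\<in>to_vec ` B. subdiff (f \<circ> of_vec) b) \<in> sets lebesgue"
  shows "MA f B = MA (f \<circ> of_vec) (to_vec ` B)"
proof -
  have "(\<Union>b\<in>B. subdiff f b) = to_vec -` (\<Union>b\<in>to_vec ` B. subdiff (f \<circ> of_vec) b)"
    using subdiff_to_vec[of _ f] by auto
  then show ?thesis unfolding MA_def using measure_vimage_to_vec[OF assms] by simp
qed

lemma ball_coeff_pos_mono_euclidean:
  fixes v :: "'a::euclidean_space \<Rightarrow> real"
  assumes v: "convex_on UNIV v" and d: "d1 \<le> d2" "d2 < DIM('a)" and pos: "0 < ball_coeff v (ball x e) d1"
  shows "0 < ball_coeff v (ball x e) d2"
proof -
  have v': "convex_on UNIV (v \<circ> of_vec)"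
  proof (rule convex_onI)
    fix t :: real and y z :: "real^('a basis_index)" assume "0 < t" "t < 1"
    then show "(v \<circ> of_vec) ((1 - t) *\<^sub>R y + t *\<^sub>R z) \<le> (1 - t) * (v \<circ> of_vec) y + t * (v \<circ> of_vec) z"
      using convex_onD[OF v, of t "of_vec y" "of_vec z"] by (simp add: linear_add[OF linear_of_vec] linear_cmul[OF linear_of_vec])
  qed simp
  have comp: "(\<lambda>x. v x + t * norm x) \<circ> of_vec = (\<lambda>x. (v \<circ> of_vec) x + t * norm x)" for t by auto
  have "MA (\<lambda>x. v x + real (Suc i) * norm x) (ball x e) = MA (\<lambda>x. (v \<circ> of_vec) x + real (Suc i) * norm x) (ball (to_vec x) e)" for i
    unfolding comp[symmetric] to_vec_image_ball[symmetric]
    by (rule MA_to_vec, unfold comp to_vec_image_ball, rule fmeasurableD, rule lmeasurable_subdiff_ball(1)[OF v']) simp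
  then have "ball_coeff v (ball x e) d = ball_coeff (v \<circ> of_vec) (ball (to_vec x) e) d" for d
    unfolding ball_coeff_def by (simp add: card_basis_index)
  then show ?thesis using ball_coeff_pos_mono[OF v' d(1)] d(2) pos by (simp add: card_basis_index)
qed

section \<open>Mixed measures of conjugates\<close>

text \<open>The expansion is specialised to two functions with weights 1 and \<open>t\<close>. By
  symmetry, index lists with equally many ones contribute equally, so their number is the factor;
  interpolation isolates the coefficient.\<close>

lemma mixed_family_coefficient:
  fixes F :: "('a::euclidean_space \<Rightarrow> real) list \<Rightarrow> 'a set \<Rightarrow> real"
  assumes F: "is_mixed_MA_family F" and v: "convex_on UNIV v" and B: "B \<in> sets borel" "bounded B" and k: "k \<le> DIM('a)"
  shows "real (card {is::nat list. length is = DIM('a) \<and> set is \<subseteq> {..<2} \<and> count_list is 1 = DIM('a) - k}) *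
      F (replicate k v @ replicate (DIM('a) - k) norm) B = ball_coeff v B (DIM('a) - k)"
proof -
  define n where "n = DIM('a)"
  define L where "L = {is::nat list. length is = n \<and> set is \<subseteq> {..<2}}"
  have finL: "finite L" unfolding L_def using finite_lists_length_eq[of "{..<2::nat}" n] by (simp add: conj_commute)
  define vs where "vs i = (if i = 0 then v else norm)" for i :: nat
  define Fd where "Fd d = F (replicate (n - d) v @ replicate d norm) B" for d
  have ms: "mset (map vs is) = mset (replicate (count_list is 0) v @ replicate (count_list is 1) norm) \<and>
      length is = count_list is 0 + count_list is 1" if "set is \<subseteq> {..<2}" for "is"
    using that
  proof (induction "is")
    case (Cons a "is")
    then have "a = 0 \<or> a = 1" by auto
    then show ?case using Cons by (auto simp: vs_def)
  qed simp
  have sym: "F (map vs is) B = Fd (count_list is 1)" if i: "is \<in> L" for "is"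
  proof -
    have m: "mset (map vs is) = mset (replicate (count_list is 0) v @ replicate (count_list is 1) norm)"
      "n = count_list is 0 + count_list is 1"
      using ms[of "is"] i by (auto simp: L_def)
    have "length (map vs is) = DIM('a)" using i by (simp add: L_def n_def)
    then have "F (replicate (count_list is 0) v @ replicate (count_list is 1) norm) B = F (map vs is) B"
      using F m(1) unfolding is_mixed_MA_family_def by metis
    then show ?thesis using m(2) by (simp add: Fd_def)
  qed
  define c where "c d = real (card {is\<in>L. count_list is 1 = d}) * Fd d" for d
  have MAc: "MA (\<lambda>x. v x + t * norm x) B = (\<Sum>d\<le>n. c d * t ^ d)" if t: "t \<ge> 0" for t
  proof -
    \<comment> \<open>Index 0 carries \<open>v\<close> and index 1 the norm, so the number of ones
      in a list is the exponent of \<open>t\<close>.\<close>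
    define lam where "lam i = (if i = 0 then 1 else t)" for i :: nat
    have "finite_convex (vs i) \<and> lam i \<ge> 0" for i
      using v t norm_convex by (auto simp: vs_def lam_def finite_convex_def)
    then have "MA (\<lambda>x. \<Sum>i<2. lam i * vs i x) B = (\<Sum>is\<in>L. (\<Prod>i\<leftarrow>is. lam i) * F (map vs is) B)"
      using F B unfolding is_mixed_MA_family_def L_def n_def by blast
    moreover have "(\<Sum>i<2. lam i * vs i x) = v x + t * norm x" for x
      by (simp add: numeral_2_eq_2 lam_def vs_def)
    moreover have "(\<Sum>is\<in>L. (\<Prod>i\<leftarrow>is. lam i) * F (map vs is) B) = (\<Sum>is\<in>L. Fd (count_list is 1) * t ^ count_list is 1)"
    proof (rule sum.cong[OF refl])
      fix "is" assume i: "is \<in> L"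
      have "set is \<subseteq> {..<2} \<Longrightarrow> (\<Prod>i\<leftarrow>is. lam i) = t ^ count_list is 1"
      proof (induction "is")
        case (Cons a "is")
        then have "a = 0 \<or> a = 1" by auto
        then show ?case using Cons by (auto simp: lam_def)
      qed simp
      then show "(\<Prod>i\<leftarrow>is. lam i) * F (map vs is) B = Fd (count_list is 1) * t ^ count_list is 1"
        using i sym[OF i] by (simp add: L_def)
    qed
    moreover have "\<dots> = (\<Sum>d\<le>n. \<Sum>is\<in>{is\<in>L. count_list is 1 = d}. Fd (count_list is 1) * t ^ count_list is 1)"
    proof (rule sum.group[symmetric, OF finL])
      show "(\<lambda>is. count_list is 1) ` L \<subseteq> {..n}" using count_le_length by (auto simp: L_def)
    qed simp
    ultimately show ?thesis by (simp add: c_def mult.assoc)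
  qed
  have "c (n - k) = (\<Sum>i\<le>n. interp n (n - k) i * (\<Sum>e\<le>n. c e * real (Suc i) ^ e))" by (rule interp) simp
  also have "\<dots> = ball_coeff v B (n - k)"
    unfolding ball_coeff_def n_def[symmetric] by (intro sum.cong refl) (simp add: MAc del: of_nat_Suc)
  finally show ?thesis using k unfolding c_def Fd_def L_def n_def by (simp add: conj_assoc)
qed

text \<open>Every family gives the same value here, so the definite description denotes it; the
  number of index lists is a positive factor.\<close>

lemma mixed_MA_sign:
  fixes v :: "'a::euclidean_space \<Rightarrow> real"
  assumes fam: "\<exists>F :: ('a \<Rightarrow> real) list \<Rightarrow> 'a set \<Rightarrow> real. is_mixed_MA_family F"
    and v: "convex_on UNIV v" and B: "B \<in> sets borel" "bounded B" and k: "k \<le> DIM('a)"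
  shows "0 < mixed_MA (replicate k v @ replicate (DIM('a) - k) norm) B \<longleftrightarrow> 0 < ball_coeff v B (DIM('a) - k)"
proof -
  define I where "I = {is::nat list. length is = DIM('a) \<and> set is \<subseteq> {..<2} \<and> count_list is 1 = DIM('a) - k}"
  have "finite I" unfolding I_def
    by (rule finite_subset[OF _ finite_lists_length_eq[of "{..<2::nat}" "DIM('a)"]]) auto
  moreover have "count_list (replicate m a) b = (if a = b then m else 0)" for m and a b :: nat
    by (induction m) auto
  then have "replicate k 0 @ replicate (DIM('a) - k) 1 \<in> I" using k by (auto simp: I_def)
  ultimately have N: "0 < real (card I)" by (auto simp: card_gt_0_iff)
  have val: "F (replicate k v @ replicate (DIM('a) - k) norm) B = ball_coeff v B (DIM('a) - k) / real (card I)"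
    if "is_mixed_MA_family F" for F
    using mixed_family_coefficient[OF that v B k] N unfolding I_def by (simp add: field_simps)
  have "mixed_MA (replicate k v @ replicate (DIM('a) - k) norm) B = ball_coeff v B (DIM('a) - k) / real (card I)"
    unfolding mixed_MA_def by (rule the_equality) (use fam val in auto)
  then show ?thesis using N by (simp add: zero_less_divide_iff)
qed

section \<open>Conjugates, and the inclusion of supports\<close>

lemma conjugate_ind_ball: "conjugate ind_ball = (norm :: 'a::euclidean_space \<Rightarrow> real)"
proof
  fix x :: 'a
  have "(SUP y. ereal (x \<bullet> y) - ind_ball y) = ereal (norm x)"
  proof (rule SUP_eqI)
    show "ereal (x \<bullet> y) - ind_ball y \<le> ereal (norm x)" for y
    proof (cases "y \<in> cball 0 1")
      case True
      have "x \<bullet> y \<le> norm x * norm y" by (rule norm_cauchy_schwarz)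
      also have "\<dots> \<le> norm x * 1" using True by (intro mult_left_mono) auto
      finally show ?thesis using True by (simp add: ind_ball_def)
    qed (simp add: ind_ball_def)
    fix z assume z: "\<And>y. y \<in> UNIV \<Longrightarrow> ereal (x \<bullet> y) - ind_ball y \<le> z"
    have "x \<bullet> (x /\<^sub>R norm x) = norm x" by (cases "x = 0") (simp_all add: dot_square_norm power2_eq_square)
    moreover have "norm (x /\<^sub>R norm x) \<le> 1" by (cases "x = 0") simp_all
    then have "ind_ball (x /\<^sub>R norm x) = 0" unfolding ind_ball_def mem_cball_0 by (rule if_P)
    ultimately show "ereal (norm x) \<le> z" using z[of "x /\<^sub>R norm x"] by (simp only: UNIV_I simp_thms) simp
  qed
  then show "conjugate ind_ball x = norm x" by (simp add: conjugate_def)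
qed

text \<open>Lower semicontinuity bounds \<open>u\<close> below near each point, and compactness
  leaves finitely many bounds. The \<open>Liminf\<close> omits the point itself, whose value exceeds
  the same constant.\<close>

lemma Conv_sc_lower_bound:
  fixes u :: "'a::euclidean_space \<Rightarrow> ereal"
  assumes u: "lsc_ereal u" "proper_ereal u"
  obtains m where "\<And>y. y \<in> cball 0 R \<Longrightarrow> ereal m \<le> u y"
proof -
  have "\<exists>c U. open U \<and> y \<in> U \<and> (\<forall>z\<in>U. ereal c \<le> u z)" for y
  proof -
    have "u y \<noteq> -\<infinity>" using u(2) by (simp add: proper_ereal_def)
    then have "-\<infinity> < u y" by simp
    then obtain c where c: "ereal c < u y" using ereal_dense2[of "-\<infinity>" "u y"] by auto
    then have "ereal c < Liminf (at y) u" using u(1) unfolding lsc_ereal_def by (meson less_le_trans)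
    then have "\<forall>\<^sub>F z in at y. ereal c < u z" by (rule less_LiminfD)
    then obtain U where U: "open U" "y \<in> U" "\<And>z. z \<in> U \<Longrightarrow> z \<noteq> y \<Longrightarrow> ereal c < u z"
      unfolding eventually_at_topological by auto
    then have "\<forall>z\<in>U. ereal c \<le> u z" using c by (metis less_imp_le)
    then show ?thesis using U by blast
  qed
  then obtain c U where cU: "\<And>y. open (U y)" "\<And>y. y \<in> U y" "\<And>y z. z \<in> U y \<Longrightarrow> ereal (c y) \<le> u z" by metis
  obtain D where D: "finite D" "cball 0 R \<subseteq> (\<Union>y\<in>D. U y)"
    using compactE_image[OF compact_cball, of "cball 0 R" U 0 R] cU by (metis (no_types, lifting) UN_I subsetI)
  show ?thesis
  proof (rule that[of "Min (insert 0 (c ` D))"])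
    fix y :: 'a assume "y \<in> cball 0 R"
    then obtain z where z: "z \<in> D" "y \<in> U z" using D(2) by blast
    have "Min (insert 0 (c ` D)) \<le> c z" using D(1) z(1) by (intro Min_le) auto
    then show "ereal (Min (insert 0 (c ` D))) \<le> u y" using cU(3)[OF z(2)] by (meson ereal_less_eq(3) order_trans)
  qed
qed

text \<open>Superlinear growth makes the terms with large \<open>y\<close> nonpositive, and
  \<open>u\<close> is bounded below on the remaining ball. Finiteness ensures that
  \<open>real_of_ereal\<close> in the definition of \<open>conjugate\<close> loses nothing.\<close>

lemma conjugate_finite:
  fixes u :: "'a::euclidean_space \<Rightarrow> ereal"
  assumes u: "u \<in> Conv_sc"
  shows "(SUP y. ereal (x \<bullet> y) - u y) = ereal (conjugate u x)"
proof -
  have uu: "lsc_ereal u" "proper_ereal u" "((\<lambda>x. u x / ereal (norm x)) \<longlongrightarrow> \<infinity>) at_infinity"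
    using u by (auto simp: Conv_sc_def)
  have "\<forall>\<^sub>F y in at_infinity. ereal (norm x) < u y / ereal (norm y)"
    using uu(3) by (simp add: tendsto_PInfty)
  then obtain R0 where R0: "\<And>y. R0 \<le> norm y \<Longrightarrow> ereal (norm x) < u y / ereal (norm y)"
    by (auto simp: eventually_at_infinity)
  define R where "R = max R0 1"
  obtain m where m: "\<And>y. y \<in> cball 0 R \<Longrightarrow> ereal m \<le> u y" using Conv_sc_lower_bound[OF uu(1,2)] by blast
  \<comment> \<open>The entry 0 bounds the terms outside the ball of radius \<open>R\<close>, the
    other entry those inside.\<close>
  define C where "C = max 0 (norm x * R - m)"
  have "ereal (x \<bullet> y) - u y \<le> ereal C" for y
  proof (cases "norm y \<le> R")
    case True
    then have "ereal m \<le> u y" by (intro m) simp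
    moreover have "x \<bullet> y \<le> norm x * R"
      using norm_cauchy_schwarz[of x y] mult_left_mono[OF True, of "norm x"] by simp
    ultimately show ?thesis by (cases "u y") (auto simp: C_def simp del: ereal_max)
  next
    case False
    then have y: "norm y > 0" "ereal (norm x) < u y / ereal (norm y)" using R0[of y] by (auto simp: R_def)
    have "x \<bullet> y \<le> norm x * norm y" by (rule norm_cauchy_schwarz)
    then show ?thesis using y by (cases "u y") (auto simp: C_def field_simps simp del: ereal_max)
  qed
  then have "(SUP y. ereal (x \<bullet> y) - u y) \<le> ereal C" by (rule SUP_least)
  moreover obtain y0 where "u y0 \<noteq> \<infinity>" "u y0 \<noteq> -\<infinity>" using uu(2) by (auto simp: proper_ereal_def)
  then obtain r where "u y0 = ereal r" by (cases "u y0") auto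
  then have "ereal (x \<bullet> y0 - r) \<le> (SUP y. ereal (x \<bullet> y) - u y)" by (intro SUP_upper2[of y0]) auto
  ultimately show ?thesis unfolding conjugate_def by (cases "SUP y. ereal (x \<bullet> y) - u y") auto
qed

lemma conjugate_convex:
  fixes u :: "'a::euclidean_space \<Rightarrow> ereal"
  assumes u: "u \<in> Conv_sc"
  shows "convex_on UNIV (conjugate u)"
proof (rule convex_onI)
  fix t :: real and x y :: 'a assume t: "0 < t" "t < 1"
  have "(SUP z. ereal (((1 - t) *\<^sub>R x + t *\<^sub>R y) \<bullet> z) - u z) \<le> ereal ((1 - t) * conjugate u x + t * conjugate u y)"
  proof (rule SUP_least)
    fix z
    have le: "ereal (p \<bullet> z) - u z \<le> ereal (conjugate u p)" for p
      unfolding conjugate_finite[OF u, symmetric] by (rule SUP_upper) simp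
    show "ereal (((1 - t) *\<^sub>R x + t *\<^sub>R y) \<bullet> z) - u z \<le> ereal ((1 - t) * conjugate u x + t * conjugate u y)"
    proof (cases "u z")
      case (real r)
      have "x \<bullet> z - r \<le> conjugate u x" "y \<bullet> z - r \<le> conjugate u y" using le[of x] le[of y] real by auto
      then have "(1 - t) * (x \<bullet> z - r) + t * (y \<bullet> z - r) \<le> (1 - t) * conjugate u x + t * conjugate u y"
        using t by (intro add_mono mult_left_mono) auto
      then show ?thesis using real by (simp add: inner_add_left algebra_simps)
    qed (use le in auto)
  qed
  then show "conjugate u ((1 - t) *\<^sub>R x + t *\<^sub>R y) \<le> (1 - t) * conjugate u x + t * conjugate u y"
    by (simp add: conjugate_finite[OF u])
qed simp

theorem theorem5p6:
  fixes u :: "'a::euclidean_space \<Rightarrow> ereal" and j k :: nat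
  assumes "1 \<le> j" and "j \<le> k" and "k \<le> DIM('a)"
    and "u \<in> Conv_sc"
  shows "supp_MA (conj_mixed_MA (replicate k u @ replicate (DIM('a) - k) ind_ball))
       \<subseteq> supp_MA (conj_mixed_MA (replicate j u @ replicate (DIM('a) - j) ind_ball))"
proof (cases "\<exists>F :: ('a \<Rightarrow> real) list \<Rightarrow> 'a set \<Rightarrow> real. is_mixed_MA_family F")
  case True
  note v = conjugate_convex[OF assms(4)]
  have eq: "conj_mixed_MA (replicate i u @ replicate (DIM('a) - i) ind_ball) =
      mixed_MA (replicate i (conjugate u) @ replicate (DIM('a) - i) norm)" for i
    by (auto simp: conj_mixed_MA_def fun_eq_iff conjugate_ind_ball)
  show ?thesis
  proof
    fix x assume x: "x \<in> supp_MA (conj_mixed_MA (replicate k u @ replicate (DIM('a) - k) ind_ball))"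
    show "x \<in> supp_MA (conj_mixed_MA (replicate j u @ replicate (DIM('a) - j) ind_ball))"
      unfolding supp_MA_def eq
    proof (intro CollectI allI impI)
      fix e :: real assume e: "e > 0"
      \<comment> \<open>The support tests balls only, and these are bounded Borel sets, on which the
        expansion of the family holds.\<close>
      have B: "ball x e \<in> sets borel" "bounded (ball x e)" by auto
      have "0 < mixed_MA (replicate k (conjugate u) @ replicate (DIM('a) - k) norm) (ball x e)"
        using x e unfolding supp_MA_def eq by blast
      then have "0 < ball_coeff (conjugate u) (ball x e) (DIM('a) - k)"
        using mixed_MA_sign[OF True v B assms(3)] by blast
      then have "0 < ball_coeff (conjugate u) (ball x e) (DIM('a) - j)"
        by (rule ball_coeff_pos_mono_euclidean[OF v, rotated 2]) (use assms in auto)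
      then show "0 < mixed_MA (replicate j (conjugate u) @ replicate (DIM('a) - j) norm) (ball x e)"
        using mixed_MA_sign[OF True v B, of j] assms by auto
    qed
  qed
next
  case False
  \<comment> \<open>Without a family, \<open>mixed_MA\<close> is the same junk value for all arguments.\<close>
  then show ?thesis by (simp add: supp_MA_def conj_mixed_MA_def mixed_MA_def)
qed

end
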